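(* For every $T>0$, let $X_T=\sum_{p\le T}\left[\frac{\cos(TU\log p)}{\sqrt p}-\mathbf{E}\frac{\cos(TU\log p)}{\sqrt p}\right]$, the sum being over primes $p$. Then $$\langle DX_T,D(-L)^{-1}X_T\rangle=\sum_{p_1,p_2\le T}\frac{1}{\sqrt{p_1p_2}}\frac{\log p_2}{\log p_1}\Big[\sin(TU\log p_2)\sin(TU\log p_1)-U\sin(TU\log p_2)\sin(T\log p_1)\Big],$$ where $p_1,p_2$ range over primes.
   Context: $H$ is a real separable Hilbert space with scalar product $\langle\cdot,\cdot\rangle$ and $(W(h),h\in H)$ is an isonormal Gaussian process (centered Gaussian family with $\mathbf{E}[W(h)W(h')]=\langle h,h'\rangle$). $U=\exp\left(-\frac12(W(f)^2+W(g)^2)\right)$ with $f,g\in H$, $\|f\|=\|g\|=1$, $\langle f,g\rangle=0$; $U$ is uniform on $[0,1]$. $D$ is the Malliavin derivative with respect to $W$ (closure of $DF=\sum_i\partial_i\varphi(W(h_1),\ldots,W(h_n))h_i$ for $F=\varphi(W(h_1),\ldots,W(h_n))$), $L$ is the infinitesimal generator of the Ornstein–Uhlenbeck semigroup, and $(-L)^{-1}$ is the (pseudo-)inverse of $-L$ on centered square integrable functionals of $W$. *)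

theory Defs
  imports "HOL-Probability.Probability" "HOL-Computational_Algebra.Primes"
begin

section \<open>Isonormal Gaussian processes\<close>

text \<open>Almost surely constant variables count as Gaussian (variance zero).\<close>

definition gaussian_rv :: "'a measure \<Rightarrow> ('a \<Rightarrow> real) \<Rightarrow> bool" where
  "gaussian_rv M X \<longleftrightarrow> X \<in> borel_measurable M \<and>
     ((\<exists>\<mu> \<sigma>. 0 < \<sigma> \<and> distributed M lborel X (normal_density \<mu> \<sigma>)) \<or>
      (\<exists>c. AE \<omega> in M. X \<omega> = c))"

text \<open>The index space is a real separable Hilbert space: on a real inner product space the sort
  \<^class>\<open>polish_space\<close> adds completeness and second countability, which for metric
  spaces is separability.\<close>

locale isonormal_gaussian_process = prob_space M for M :: "'a measure" +
  fixes W :: "'h::{real_inner, polish_space} \<Rightarrow> 'a \<Rightarrow> real"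
  assumes gaussian_family: "finite J \<Longrightarrow> gaussian_rv M (\<lambda>\<omega>. \<Sum>h\<in>J. c h * W h \<omega>)"
    and centered: "expectation (W h) = 0"
    and covariance: "expectation (\<lambda>\<omega>. W h \<omega> * W h' \<omega>) = inner h h'"


section \<open>The Malliavin derivative\<close>

text \<open>Functions on \<open>\<real>\<^sup>n\<close> are encoded as functions on \<^typ>\<open>nat \<Rightarrow> real\<close>
  that depend only on the coordinates below \<open>n\<close>; on these, continuity for the product topology is
  continuity on \<open>\<real>\<^sup>n\<close>.\<close>

definition partial_deriv :: "nat \<Rightarrow> ((nat \<Rightarrow> real) \<Rightarrow> real) \<Rightarrow> (nat \<Rightarrow> real) \<Rightarrow> real" where
  "partial_deriv i \<phi> x = deriv (\<lambda>s. \<phi> (x(i := s))) (x i)"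

text \<open>\<open>C\<^sup>\<infinity>\<close> functions on \<open>\<real>\<^sup>n\<close> which, together with all their partial
  derivatives, have at most polynomial growth.\<close>

definition smooth_poly_growth :: "nat \<Rightarrow> ((nat \<Rightarrow> real) \<Rightarrow> real) \<Rightarrow> bool" where
  "smooth_poly_growth n \<phi> \<longleftrightarrow>
     (\<forall>x y. (\<forall>i<n. x i = y i) \<longrightarrow> \<phi> x = \<phi> y) \<and>
     (\<forall>is. set is \<subseteq> {..<n} \<longrightarrow>
        (let \<psi> = foldr partial_deriv is \<phi> in
           continuous_on UNIV \<psi> \<and>
           (\<forall>i<n. \<forall>x. (\<lambda>s. \<psi> (x(i := s))) differentiable (at (x i))) \<and>
           (\<exists>C k. \<forall>x. \<bar>\<psi> x\<bar> \<le> C * (1 + (\<Sum>i<n. (x i)\<^sup>2)) ^ k)))"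

text \<open>\<open>F\<close> is a smooth cylindrical functional and \<open>u\<close> its derivative
  for some representation of \<open>F\<close>.\<close>

definition smooth_functional_deriv ::
  "('h::real_inner \<Rightarrow> 'a \<Rightarrow> real) \<Rightarrow> ('a \<Rightarrow> real) \<Rightarrow> ('a \<Rightarrow> 'h) \<Rightarrow> bool" where
  "smooth_functional_deriv W F u \<longleftrightarrow>
     (\<exists>n \<phi> h. smooth_poly_growth n \<phi> \<and>
        F = (\<lambda>\<omega>. \<phi> (\<lambda>i. W (h i) \<omega>)) \<and>
        u = (\<lambda>\<omega>. \<Sum>i<n. partial_deriv i \<phi> (\<lambda>i. W (h i) \<omega>) *\<^sub>R h i))"

text \<open>The graph of the closure of this operator from \<open>L\<^sup>2(\<Omega>)\<close> to
  \<open>L\<^sup>2(\<Omega>; H)\<close>.\<close>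

definition has_malliavin_deriv ::
  "'a measure \<Rightarrow> ('h::{real_inner, polish_space} \<Rightarrow> 'a \<Rightarrow> real) \<Rightarrow> ('a \<Rightarrow> real) \<Rightarrow> ('a \<Rightarrow> 'h) \<Rightarrow> bool"
  where
  "has_malliavin_deriv M W F u \<longleftrightarrow>
     F \<in> borel_measurable M \<and> u \<in> borel_measurable M \<and>
     (\<exists>Fs us. (\<forall>n. smooth_functional_deriv W (Fs n) (us n)) \<and>
        (\<lambda>n. \<integral>\<^sup>+\<omega>. ennreal ((Fs n \<omega> - F \<omega>)\<^sup>2) \<partial>M) \<longlonglongrightarrow> 0 \<and>
        (\<lambda>n. \<integral>\<^sup>+\<omega>. ennreal ((norm (us n \<omega> - u \<omega>))\<^sup>2) \<partial>M) \<longlonglongrightarrow> 0)"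

definition malliavin_domain ::
  "'a measure \<Rightarrow> ('h::{real_inner, polish_space} \<Rightarrow> 'a \<Rightarrow> real) \<Rightarrow> ('a \<Rightarrow> real) set" where
  "malliavin_domain M W = {F. \<exists>u. has_malliavin_deriv M W F u}"

text \<open>On its domain the derivative is determined up to almost sure equality (closability); the
  operator below picks a version.\<close>

definition malliavin_deriv ::
  "'a measure \<Rightarrow> ('h::{real_inner, polish_space} \<Rightarrow> 'a \<Rightarrow> real) \<Rightarrow> ('a \<Rightarrow> real) \<Rightarrow> 'a \<Rightarrow> 'h" where
  "malliavin_deriv M W F = (SOME u. has_malliavin_deriv M W F u)"


section \<open>The Ornstein--Uhlenbeck semigroup and its generator\<close>

definition represents ::
  "'a measure \<Rightarrow> ('h \<Rightarrow> 'a \<Rightarrow> real) \<Rightarrow> ('a \<Rightarrow> real) \<Rightarrow> (('h \<Rightarrow> real) \<Rightarrow> real) \<Rightarrow> bool" where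
  "represents M W F \<Phi> \<longleftrightarrow> \<Phi> \<in> borel_measurable (Pi\<^sub>M UNIV (\<lambda>_. borel)) \<and>
     (AE \<omega> in M. F \<omega> = \<Phi> (\<lambda>h. W h \<omega>))"

definition L2_functional ::
  "'a measure \<Rightarrow> ('h \<Rightarrow> 'a \<Rightarrow> real) \<Rightarrow> ('a \<Rightarrow> real) \<Rightarrow> bool" where
  "L2_functional M W F \<longleftrightarrow> F \<in> borel_measurable M \<and> integrable M (\<lambda>\<omega>. (F \<omega>)\<^sup>2) \<and>
     (\<exists>\<Phi>. represents M W F \<Phi>)"

text \<open>Mehler's formula
  \<open>P\<^sub>t F = E'[\<Phi>(e\<^sup>-\<^sup>t W + \<surd>(1 - e\<^sup>-\<^sup>2\<^sup>t) W')]\<close> for \<open>F = \<Phi>(W)\<close>, where \<open>W'\<close> is an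
  independent copy of \<open>W\<close>: the copy lives on the second factor of \<open>M \<Otimes> M\<close>, over which one
  integrates. Up to almost sure equality the result does not depend on the choice of \<open>\<Phi>\<close>,
  because \<open>e\<^sup>-\<^sup>t W + \<surd>(1 - e\<^sup>-\<^sup>2\<^sup>t) W'\<close> has the law of \<open>W\<close>.\<close>

definition OU_semigroup ::
  "'a measure \<Rightarrow> ('h \<Rightarrow> 'a \<Rightarrow> real) \<Rightarrow> real \<Rightarrow> ('a \<Rightarrow> real) \<Rightarrow> 'a \<Rightarrow> real" where
  "OU_semigroup M W t F \<omega> =
     (\<integral>\<omega>'. (SOME \<Phi>. represents M W F \<Phi>)
        (\<lambda>h. exp (- t) * W h \<omega> + sqrt (1 - exp (- 2 * t)) * W h \<omega>') \<partial>M)"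

text \<open>\<open>F\<close> is in the domain of the infinitesimal generator \<open>L\<close> on
  \<open>L\<^sup>2(\<Omega>, \<sigma>(W), P)\<close> and \<open>L F = G\<close>.\<close>

definition has_OU_generator ::
  "'a measure \<Rightarrow> ('h \<Rightarrow> 'a \<Rightarrow> real) \<Rightarrow> ('a \<Rightarrow> real) \<Rightarrow> ('a \<Rightarrow> real) \<Rightarrow> bool" where
  "has_OU_generator M W F G \<longleftrightarrow> L2_functional M W F \<and> L2_functional M W G \<and>
     ((\<lambda>t. \<integral>\<^sup>+\<omega>. ennreal (((OU_semigroup M W t F \<omega> - F \<omega>) / t - G \<omega>)\<^sup>2) \<partial>M) \<longlongrightarrow> 0) (at_right 0)"

text \<open>The kernel of \<open>L\<close> consists of the constants, so \<open>-L\<close> is inverted on centered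
  functionals by requiring the preimage to be centered.\<close>

definition has_neg_OU_inverse ::
  "'a measure \<Rightarrow> ('h \<Rightarrow> 'a \<Rightarrow> real) \<Rightarrow> ('a \<Rightarrow> real) \<Rightarrow> ('a \<Rightarrow> real) \<Rightarrow> bool" where
  "has_neg_OU_inverse M W F Y \<longleftrightarrow>
     L2_functional M W F \<and> (\<integral>\<omega>. F \<omega> \<partial>M) = 0 \<and>
     (\<integral>\<omega>. Y \<omega> \<partial>M) = 0 \<and> has_OU_generator M W Y (\<lambda>\<omega>. - F \<omega>)"

definition neg_OU_inverse_domain ::
  "'a measure \<Rightarrow> ('h \<Rightarrow> 'a \<Rightarrow> real) \<Rightarrow> ('a \<Rightarrow> real) set" where
  "neg_OU_inverse_domain M W = {F. \<exists>Y. has_neg_OU_inverse M W F Y}"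

definition neg_OU_inverse ::
  "'a measure \<Rightarrow> ('h \<Rightarrow> 'a \<Rightarrow> real) \<Rightarrow> ('a \<Rightarrow> real) \<Rightarrow> 'a \<Rightarrow> real" where
  "neg_OU_inverse M W F = (SOME Y. has_neg_OU_inverse M W F Y)"


section \<open>The random variables\<close>

definition unif_rv :: "('h \<Rightarrow> 'a \<Rightarrow> real) \<Rightarrow> 'h \<Rightarrow> 'h \<Rightarrow> 'a \<Rightarrow> real" where
  "unif_rv W f g \<omega> = exp (- (1 / 2) * ((W f \<omega>)\<^sup>2 + (W g \<omega>)\<^sup>2))"

definition primes_le :: "real \<Rightarrow> nat set" where
  "primes_le T = {p. prime p \<and> real p \<le> T}"

definition prime_cos_sum ::
  "'a measure \<Rightarrow> ('a \<Rightarrow> real) \<Rightarrow> real \<Rightarrow> 'a \<Rightarrow> real" where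
  "prime_cos_sum M U T \<omega> =
     (\<Sum>p\<in>primes_le T. cos (T * U \<omega> * ln (real p)) / sqrt (real p)
        - (\<integral>\<omega>'. cos (T * U \<omega>' * ln (real p)) / sqrt (real p) \<partial>M))"

end

theory Submission
  imports Defs "HOL-Real_Asymp.Real_Asymp" "HOL-Complex_Analysis.Complex_Analysis"
begin

text \<open>Everything is a function of \<open>R = W(f)\<^sup>2 + W(g)\<^sup>2\<close>, with \<open>U = exp (- R / 2)\<close>. If \<open>\<phi>' = q\<close>, then
  \<open>D \<phi>(R) = 2 q(R) (W(f) f + W(g) g)\<close> and \<open>L \<phi>(R) = 4 R q'(R) + (4 - 2 R) q(R)\<close>. For the summand
  \<open>cos (\<tau> U) - sin \<tau> / \<tau>\<close>, \<open>\<tau> = T log p\<close>, the equation \<open>- L \<phi>(R) = cos (\<tau> U) - sin \<tau> / \<tau>\<close> integrates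
  once to \<open>2 \<tau> U R q(R) = sin (\<tau> U) - U sin \<tau>\<close>, and the claim is the product of this with
  \<open>D cos (\<tau>' U)\<close>. The singularity of \<open>q\<close> at \<open>R = 0\<close> is removable, and \<open>q\<close> vanishes at infinity, which
  makes \<open>\<phi>(R)\<close> Malliavin differentiable. Since both operators pick versions, the formula also needs that
  the Malliavin derivative is closable and that \<open>L Z = 0\<close> forces \<open>Z\<close> to be constant.\<close>

section \<open>Laws of Gaussian families\<close>

text \<open>\<open>OU_semigroup\<close> evaluates a chosen representative \<Phi> on mixed paths, and
  \<Phi> may be any measurable function on the space of all paths indexed by the Hilbert space.
  Identities in law are therefore wanted for the whole process, and Mehler's formula is read as a
  rotation of two independent copies with exp (- t) = cos \<theta>. This reading takes the place of
  a chaos expansion: existence of the inverse comes from differentiating along the rotation,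
  uniqueness from invariance under it. The radial formula for L is the Laplacian minus x . grad in
  the plane of f and g. Multiplied by exp (- R / 2) it becomes the exact derivative of 4 R U q with
  respect to R, which is why a single integration suffices and why U is the natural variable. The
  mean sin \<tau> / \<tau> is a by-product, since images under L are centered.\<close>

lemma char_eqI:
  assumes \<mu>: "real_distribution \<mu>" and \<nu>: "real_distribution \<nu>"
    and trig: "\<And>t \<eta>. (\<integral>x. cos (t * x + \<eta>) \<partial>\<mu>) = (\<integral>x. cos (t * x + \<eta>) \<partial>\<nu>)"
  shows "char \<mu> = char \<nu>"
proof
  fix t
  \<comment> \<open>The phase makes cosine integrals sufficient: \<eta> = 0 gives the real part of
    the characteristic function and \<eta> = - pi / 2 the imaginary part.\<close>
  have Re: "Re (char \<mu> t) = (\<integral>x. cos (t * x + 0) \<partial>\<mu>)"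
    and Im: "Im (char \<mu> t) = (\<integral>x. cos (t * x + - (pi / 2)) \<partial>\<mu>)"
    if "real_distribution \<mu>" for \<mu>
  proof -
    interpret real_distribution \<mu> by fact
    have i: "integrable \<mu> (\<lambda>x. iexp (t * x))" by (rule integrable_iexp) simp_all
    show "Re (char \<mu> t) = (\<integral>x. cos (t * x + 0) \<partial>\<mu>)"
      unfolding char_def integral_Re[OF i, symmetric] by (simp add: Re_exp)
    show "Im (char \<mu> t) = (\<integral>x. cos (t * x + - (pi / 2)) \<partial>\<mu>)"
      unfolding char_def integral_Im[OF i, symmetric] by (simp add: Im_exp cos_diff)
  qed
  show "char \<mu> t = char \<nu> t"
    by (rule complex_eqI) (simp_all only: Re[OF \<mu>] Re[OF \<nu>] Im[OF \<mu>] Im[OF \<nu>] trig)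
qed

text \<open>The lower bound 1 on the weight keeps the normalising constant positive, so that the
  weighted image under \<open>Z\<close> is a probability measure, to which uniqueness of
  characteristic functions applies.\<close>

lemma (in prob_space) weighted_law:
  fixes Z w :: "'a \<Rightarrow> real"
  assumes [measurable]: "Z \<in> borel_measurable M" "w \<in> borel_measurable M"
    and w: "\<And>\<omega>. 1 \<le> w \<omega>" "\<And>\<omega>. w \<omega> \<le> K"
  defines "\<mu> \<equiv> distr (density M (\<lambda>\<omega>. ennreal (w \<omega> / expectation w))) borel Z"
  shows "0 < expectation w" and "real_distribution \<mu>"
    and "\<And>h :: real \<Rightarrow> real. h \<in> borel_measurable borel \<Longrightarrow> (\<integral>x. h x \<partial>\<mu>) = expectation (\<lambda>\<omega>. h (Z \<omega>) * w \<omega>) / expectation w"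
proof -
  have "\<bar>w \<omega>\<bar> \<le> K" for \<omega> using w[of \<omega>] by linarith
  then have int: "integrable M w" by (intro integrable_const_bound[where B=K]) auto
  have "(1::real) = expectation (\<lambda>\<omega>. 1)" by (simp add: prob_space)
  also have "\<dots> \<le> expectation w" using int w by (intro integral_mono) auto
  finally show m: "0 < expectation w" by simp
  have wp: "0 \<le> w \<omega> / expectation w" for \<omega> using w(1)[of \<omega>] m by simp
  have "(\<integral>\<^sup>+\<omega>. ennreal (w \<omega> / expectation w) \<partial>M) = ennreal (\<integral>\<omega>. w \<omega> / expectation w \<partial>M)"
    by (rule nn_integral_eq_integral) (use int wp in auto)
  also have "\<dots> = 1" using m by simp
  finally have "prob_space (density M (\<lambda>\<omega>. ennreal (w \<omega> / expectation w)))"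
    by (intro prob_spaceI) (simp add: emeasure_density cong: nn_integral_cong)
  then show "real_distribution \<mu>"
    unfolding \<mu>_def by (intro prob_space.real_distribution_distr) auto
  show "(\<integral>x. h x \<partial>\<mu>) = expectation (\<lambda>\<omega>. h (Z \<omega>) * w \<omega>) / expectation w"
    if [measurable]: "h \<in> borel_measurable borel" for h :: "real \<Rightarrow> real"
    unfolding \<mu>_def using wp by (subst integral_distr) (auto simp: integral_real_density mult.commute)
qed

lemma weighted_law_eqI:
  fixes Z w :: "'a \<Rightarrow> real" and Z' w' :: "'b \<Rightarrow> real"
  assumes M: "prob_space M" and N: "prob_space N"
    and Z: "Z \<in> borel_measurable M" "w \<in> borel_measurable M" and Z': "Z' \<in> borel_measurable N" "w' \<in> borel_measurable N"
    and w: "\<And>\<omega>. 1 \<le> w \<omega>" "\<And>\<omega>. w \<omega> \<le> K" and w': "\<And>\<omega>. 1 \<le> w' \<omega>" "\<And>\<omega>. w' \<omega> \<le> K"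
    and trig: "\<And>t \<eta>. (\<integral>\<omega>. cos (t * Z \<omega> + \<eta>) * w \<omega> \<partial>M) = (\<integral>\<omega>. cos (t * Z' \<omega> + \<eta>) * w' \<omega> \<partial>N)"
    and S [measurable]: "S \<in> sets borel"
  shows "(\<integral>\<omega>. indicator S (Z \<omega>) * w \<omega> \<partial>M) = (\<integral>\<omega>. indicator S (Z' \<omega>) * w' \<omega> \<partial>N)"
proof -
  note \<mu> = prob_space.weighted_law[OF M Z w] and \<nu> = prob_space.weighted_law[OF N Z' w']
  \<comment> \<open>t = 0 and \<eta> = 0 compare the total masses; the two normalising constants
    agree and cancel at the end.\<close>
  have m: "(\<integral>\<omega>. w \<omega> \<partial>M) = (\<integral>\<omega>. w' \<omega> \<partial>N)" using trig[of 0 0] by simp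
  have c: "(\<lambda>x. cos (t * x + \<eta>)) \<in> borel_measurable borel" for t \<eta> :: real by measurable
  have "distr (density M (\<lambda>\<omega>. ennreal (w \<omega> / (\<integral>\<omega>. w \<omega> \<partial>M)))) borel Z =
      distr (density N (\<lambda>\<omega>. ennreal (w' \<omega> / (\<integral>\<omega>. w' \<omega> \<partial>N)))) borel Z'"
    by (rule Levy_uniqueness[OF \<mu>(2) \<nu>(2) char_eqI[OF \<mu>(2) \<nu>(2)]])
      (unfold \<mu>(3)[OF c] \<nu>(3)[OF c] trig, unfold m, rule refl)
  then show ?thesis
    using \<mu>(3)[of "indicator S"] \<nu>(3)[of "indicator S"] \<mu>(1) m by simp
qed

lemma sum_fun_upd_add:
  fixes c :: "'i \<Rightarrow> real"
  assumes "finite I" "j \<in> I"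
  shows "(\<Sum>i\<in>I. (c(j := c j + t)) i * v i) = (\<Sum>i\<in>I. c i * v i) + t * v j"
proof -
  have "(\<Sum>i\<in>I. (c(j := c j + t)) i * v i) = (\<Sum>i\<in>I. c i * v i + (if i = j then t * v j else 0))"
    by (intro sum.cong) (auto simp: algebra_simps)
  then show ?thesis using assms by (simp add: sum.distrib)
qed

context prob_space
begin

context
  fixes V :: "'i \<Rightarrow> 'a \<Rightarrow> real" and I :: "'i set" and j :: 'i and a :: "'a \<Rightarrow> real"
  assumes V [measurable]: "\<And>i. V i \<in> borel_measurable M" and I: "finite I" and j: "j \<in> I"
    and a [measurable]: "a \<in> borel_measurable M" and a01: "\<And>\<omega>. 0 \<le> a \<omega>" "\<And>\<omega>. a \<omega> \<le> 1"
begin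

lemma weighted_cos_integrable: "integrable M (\<lambda>\<omega>. a \<omega> * cos ((\<Sum>i\<in>I. c i * V i \<omega>) + \<theta>))"
proof (rule integrable_const_bound[where B=1])
  have "\<bar>x * cos y\<bar> \<le> 1" if "0 \<le> x" "x \<le> 1" for x y :: real
    using that mult_mono[of "\<bar>x\<bar>" 1 "\<bar>cos y\<bar>" 1] by (simp add: abs_mult)
  then show "AE \<omega> in M. norm (a \<omega> * cos ((\<Sum>i\<in>I. c i * V i \<omega>) + \<theta>)) \<le> 1" using a01 by simp
qed measurable

text \<open>The product-to-sum formula produces cosines whose coefficient at \<open>j\<close> is
  shifted by t. Each term falls under the induction hypothesis for the smaller cylinder, which is
  why that hypothesis has to cover all coefficients and phases.\<close>

lemma weighted_cos_expansion:
  "expectation (\<lambda>\<omega>. cos (t * V j \<omega> + \<eta>) * (2 + a \<omega> * cos ((\<Sum>i\<in>I. c i * V i \<omega>) + \<theta>))) =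
    2 * expectation (\<lambda>\<omega>. cos ((\<Sum>i\<in>I. ((\<lambda>i. 0)(j := 0 + t)) i * V i \<omega>) + \<eta>)) +
    (expectation (\<lambda>\<omega>. a \<omega> * cos ((\<Sum>i\<in>I. (c(j := c j + t)) i * V i \<omega>) + (\<theta> + \<eta>))) +
     expectation (\<lambda>\<omega>. a \<omega> * cos ((\<Sum>i\<in>I. ((\<lambda>i. - c i)(j := - c j + t)) i * V i \<omega>) + (\<eta> - \<theta>)))) / 2"
proof -
  have dL: "(\<Sum>i\<in>I. ((\<lambda>i. 0)(j := 0 + t)) i * V i \<omega>) = t * V j \<omega>"
    "(\<Sum>i\<in>I. (c(j := c j + t)) i * V i \<omega>) = (\<Sum>i\<in>I. c i * V i \<omega>) + t * V j \<omega>"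
    "(\<Sum>i\<in>I. ((\<lambda>i. - c i)(j := - c j + t)) i * V i \<omega>) = t * V j \<omega> - (\<Sum>i\<in>I. c i * V i \<omega>)" for \<omega>
    using sum_fun_upd_add[OF I j, of "\<lambda>_. 0" t "\<lambda>i. V i \<omega>"] sum_fun_upd_add[OF I j, of c t "\<lambda>i. V i \<omega>"]
      sum_fun_upd_add[OF I j, of "\<lambda>i. - c i" t "\<lambda>i. V i \<omega>"]
    by (simp_all only: minus_mult_left[symmetric] sum_negf, simp_all)
  have cos3: "cos (x + \<eta>) * (2 + b * cos (y + \<theta>)) =
      2 * cos (x + \<eta>) + (b * cos (y + x + (\<theta> + \<eta>)) + b * cos (x - y + (\<eta> - \<theta>))) / 2" for x y b :: real
  proof -
    have e: "y + x + (\<theta> + \<eta>) = (x + \<eta>) + (y + \<theta>)" "x - y + (\<eta> - \<theta>) = (x + \<eta>) - (y + \<theta>)" by simp_all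
    show ?thesis
      unfolding e cos_add[of "x + \<eta>"] cos_diff[of "x + \<eta>"] by (simp add: distrib_left right_diff_distrib)
  qed
  have ci: "integrable M (\<lambda>\<omega>. cos ((\<Sum>i\<in>I. ((\<lambda>i. 0)(j := 0 + t)) i * V i \<omega>) + \<eta>))"
    by (rule integrable_const_bound[where B=1]) auto
  have "expectation (\<lambda>\<omega>. cos (t * V j \<omega> + \<eta>) * (2 + a \<omega> * cos ((\<Sum>i\<in>I. c i * V i \<omega>) + \<theta>))) =
    expectation (\<lambda>\<omega>. 2 * cos ((\<Sum>i\<in>I. ((\<lambda>i. 0)(j := 0 + t)) i * V i \<omega>) + \<eta>) +
      (a \<omega> * cos ((\<Sum>i\<in>I. (c(j := c j + t)) i * V i \<omega>) + (\<theta> + \<eta>)) +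
       a \<omega> * cos ((\<Sum>i\<in>I. ((\<lambda>i. - c i)(j := - c j + t)) i * V i \<omega>) + (\<eta> - \<theta>))) / 2)"
    unfolding dL by (simp only: cos3)
  then show ?thesis
    by (simp only: Bochner_Integration.integral_add integral_mult_right_zero integral_divide_zero weighted_cos_integrable ci
        integrable_mult_right Bochner_Integration.integrable_add integrable_divide_zero simp_thms)
qed

text \<open>The last term carries the weight of the cylinder enlarged by a condition on
  \<open>V j\<close>; it is what the induction is after.\<close>

lemma weighted_cos_indicator:
  assumes [measurable]: "S \<in> sets borel"
  shows "expectation (\<lambda>\<omega>. indicator S (V j \<omega>) * (2 + a \<omega> * cos ((\<Sum>i\<in>I. c i * V i \<omega>) + \<theta>))) =
    2 * expectation (\<lambda>\<omega>. indicator S (V j \<omega>)) +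
    expectation (\<lambda>\<omega>. indicator S (V j \<omega>) * a \<omega> * cos ((\<Sum>i\<in>I. c i * V i \<omega>) + \<theta>))"
proof -
  have "integrable M (\<lambda>\<omega>. indicator S (V j \<omega>) * (a \<omega> * cos ((\<Sum>i\<in>I. c i * V i \<omega>) + \<theta>)))"
    by (rule Bochner_Integration.integrable_bound[OF weighted_cos_integrable[of c \<theta>]]) (auto simp: indicator_def)
  moreover have "integrable M (\<lambda>\<omega>. indicator S (V j \<omega>) * 2 :: real)"
    by (rule integrable_const_bound[where B=2]) (auto simp: indicator_def)
  ultimately show ?thesis by (simp add: distrib_left mult.assoc)
qed

end

end

text \<open>The law of \<open>V j\<close> under the signed weight \<open>1\<^sub>A cos L\<close> is identified through the positive
  weight \<open>2 + 1\<^sub>A cos L\<close>, to which Levy's one-dimensional uniqueness theorem applies; this adds one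
  coordinate at a time to the cylinder \<open>A\<close>.\<close>

lemma cramer_wold_cylinder:
  fixes V :: "'i \<Rightarrow> 'a \<Rightarrow> real" and V' :: "'i \<Rightarrow> 'b \<Rightarrow> real"
  assumes M: "prob_space M" and N: "prob_space N"
    and V [measurable]: "\<And>i. V i \<in> borel_measurable M" and V' [measurable]: "\<And>i. V' i \<in> borel_measurable N"
    and I: "finite I"
    and eq: "\<And>c \<theta>. (\<integral>\<omega>. cos ((\<Sum>i\<in>I. c i * V i \<omega>) + \<theta>) \<partial>M) = (\<integral>\<omega>. cos ((\<Sum>i\<in>I. c i * V' i \<omega>) + \<theta>) \<partial>N)"
    and "A \<subseteq> I" and [measurable]: "\<And>i. S i \<in> sets borel"
  shows "(\<integral>\<omega>. (\<Prod>i\<in>A. indicator (S i) (V i \<omega>)) * cos ((\<Sum>i\<in>I. c i * V i \<omega>) + \<theta>) \<partial>M) =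
         (\<integral>\<omega>. (\<Prod>i\<in>A. indicator (S i) (V' i \<omega>)) * cos ((\<Sum>i\<in>I. c i * V' i \<omega>) + \<theta>) \<partial>N)"
proof -
  have "finite A" using assms finite_subset by blast
  then show ?thesis using \<open>A \<subseteq> I\<close>
  proof (induction A arbitrary: c \<theta>)
    case empty
    show ?case using eq by simp
  next
    case (insert j A)
    then have j: "j \<in> I" by auto
    define a where "a \<omega> = (\<Prod>i\<in>A. indicator (S i) (V i \<omega>) :: real)" for \<omega>
    define a' where "a' \<omega> = (\<Prod>i\<in>A. indicator (S i) (V' i \<omega>) :: real)" for \<omega>
    have am [measurable]: "a \<in> borel_measurable M" "a' \<in> borel_measurable N"
      unfolding a_def[abs_def] a'_def[abs_def] by measurable
    have a01: "0 \<le> a \<omega>" "a \<omega> \<le> 1" for \<omega>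
      unfolding a_def by (auto intro!: prod_nonneg prod_le_1 simp: indicator_def)
    have a01': "0 \<le> a' \<omega>" "a' \<omega> \<le> 1" for \<omega>
      unfolding a'_def by (auto intro!: prod_nonneg prod_le_1 simp: indicator_def)
    note ex = prob_space.weighted_cos_expansion[where V=V, OF M V I j am(1) a01]
      and ex' = prob_space.weighted_cos_expansion[where V=V', OF N V' I j am(2) a01']
      and ind = prob_space.weighted_cos_indicator[where V=V, OF M V I j am(1) a01]
      and ind' = prob_space.weighted_cos_indicator[where V=V', OF N V' I j am(2) a01']
    let ?w = "\<lambda>\<omega>. 2 + a \<omega> * cos ((\<Sum>i\<in>I. c i * V i \<omega>) + \<theta>)"
    let ?w' = "\<lambda>\<omega>. 2 + a' \<omega> * cos ((\<Sum>i\<in>I. c i * V' i \<omega>) + \<theta>)"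
    have IH: "(\<integral>\<omega>. a \<omega> * cos ((\<Sum>i\<in>I. c i * V i \<omega>) + \<theta>) \<partial>M) = (\<integral>\<omega>. a' \<omega> * cos ((\<Sum>i\<in>I. c i * V' i \<omega>) + \<theta>) \<partial>N)" for c \<theta>
      using insert unfolding a_def a'_def by simp
    have bb: "1 \<le> 2 + b * cos x" "2 + b * cos x \<le> 3" if "0 \<le> b" "b \<le> 1" for b x :: real
      using that mult_mono[of "\<bar>b\<bar>" 1 "\<bar>cos x\<bar>" 1] unfolding abs_mult[symmetric] abs_le_iff by auto
    have W: "(\<integral>\<omega>. indicator (S j) (V j \<omega>) * ?w \<omega> \<partial>M) = (\<integral>\<omega>. indicator (S j) (V' j \<omega>) * ?w' \<omega> \<partial>N)"
    proof (rule weighted_law_eqI[OF M N, where K=3])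
      fix t \<eta>
      show "(\<integral>\<omega>. cos (t * V j \<omega> + \<eta>) * ?w \<omega> \<partial>M) = (\<integral>\<omega>. cos (t * V' j \<omega> + \<eta>) * ?w' \<omega> \<partial>N)"
        unfolding ex ex' IH eq ..
    qed (use bb a01 a01' in auto)
    \<comment> \<open>Weight 1 compares the laws of the single coordinate \<open>V j\<close>; this
      cancels the contribution of the constant 2 in the previous identity.\<close>
    have "(\<integral>\<omega>. indicator (S j) (V j \<omega>) * 1 \<partial>M) = (\<integral>\<omega>. indicator (S j) (V' j \<omega>) * 1 \<partial>N :: real)"
    proof (rule weighted_law_eqI[OF M N, where K=1])
      fix t \<eta>
      show "(\<integral>\<omega>. cos (t * V j \<omega> + \<eta>) * 1 \<partial>M) = (\<integral>\<omega>. cos (t * V' j \<omega> + \<eta>) * 1 \<partial>N)"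
        using eq[of "(\<lambda>i. 0)(j := 0 + t)" \<eta>] sum_fun_upd_add[OF I j, of "\<lambda>_. 0" t] by simp
    qed simp_all
    then show ?case
      using W unfolding ind[OF \<open>S j \<in> sets borel\<close>] ind'[OF \<open>S j \<in> sets borel\<close>] using insert(1,2) by (simp add: a_def a'_def)
  qed
qed

abbreviation paths :: "('i \<Rightarrow> real) measure" where
  "paths \<equiv> Pi\<^sub>M UNIV (\<lambda>_. borel)"

proposition cramer_wold:
  fixes V :: "'i \<Rightarrow> 'a \<Rightarrow> real" and V' :: "'i \<Rightarrow> 'b \<Rightarrow> real"
  assumes M: "prob_space M" and N: "prob_space N"
    and [measurable]: "\<And>i. V i \<in> borel_measurable M" "\<And>i. V' i \<in> borel_measurable N"
    and eq: "\<And>I c \<theta>. finite I \<Longrightarrow> (\<integral>\<omega>. cos ((\<Sum>i\<in>I. c i * V i \<omega>) + \<theta>) \<partial>M) = (\<integral>\<omega>. cos ((\<Sum>i\<in>I. c i * V' i \<omega>) + \<theta>) \<partial>N)"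
  shows "distr M paths (\<lambda>\<omega> i. V i \<omega>) = distr N paths (\<lambda>\<omega> i. V' i \<omega>)"
proof (rule measure_eqI_PiM_infinite)
  interpret M: prob_space M by fact
  interpret N: prob_space N by fact
  have [measurable]: "(\<lambda>\<omega> i. V i \<omega>) \<in> measurable M paths"
    by (rule measurable_PiM_single') auto
  have [measurable]: "(\<lambda>\<omega> i. V' i \<omega>) \<in> measurable N paths"
    by (rule measurable_PiM_single') auto
  show "finite_measure (distr M paths (\<lambda>\<omega> i. V i \<omega>))"
    by (intro M.finite_measure_distr) simp
  fix S :: "'i \<Rightarrow> real set" and J :: "'i set"
  assume J: "finite J" and S: "\<And>i. i \<in> J \<Longrightarrow> S i \<in> sets borel"
  define S' where "S' i = (if i \<in> J then S i else UNIV)" for i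
  have [measurable]: "S' i \<in> sets borel" for i using S by (auto simp: S'_def)
  have P: "prod_emb UNIV (\<lambda>_. borel) J (Pi\<^sub>E J S) = {v \<in> space paths. \<forall>i\<in>J. v i \<in> S' i}"
    using J by (auto simp: prod_emb_def S'_def space_PiM PiE_iff)
  have [measurable]: "{v \<in> space paths. \<forall>i\<in>J. v i \<in> S' i} \<in> sets paths"
    using J by measurable
  \<comment> \<open>The zero coefficients turn the cosine into 1, so that the identity for signed
    weights becomes equality of probabilities.\<close>
  have ind: "indicator {v \<in> space paths. \<forall>i\<in>J. v i \<in> S' i} v = (\<Prod>i\<in>J. indicator (S' i) (v i)) * cos ((\<Sum>i\<in>J. 0 * v i) + 0)" for v :: "'i \<Rightarrow> real"
    using J by (auto simp: indicator_def space_PiM)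
  have "measure (distr M paths (\<lambda>\<omega> i. V i \<omega>)) {v \<in> space paths. \<forall>i\<in>J. v i \<in> S' i}
     = (\<integral>v. indicator {v \<in> space paths. \<forall>i\<in>J. v i \<in> S' i} v \<partial>distr M paths (\<lambda>\<omega> i. V i \<omega>))"
    by simp
  also have "\<dots> = (\<integral>v. indicator {v \<in> space paths. \<forall>i\<in>J. v i \<in> S' i} v \<partial>distr N paths (\<lambda>\<omega> i. V' i \<omega>))"
    apply (subst integral_distr, simp, simp)
    apply (subst integral_distr, simp, simp)
    unfolding ind
    by (rule cramer_wold_cylinder[OF M N _ _ J eq]) (use J in auto)
  also have "\<dots> = measure (distr N paths (\<lambda>\<omega> i. V' i \<omega>)) {v \<in> space paths. \<forall>i\<in>J. v i \<in> S' i}"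
    by simp
  finally show "emeasure (distr M paths (\<lambda>\<omega> i. V i \<omega>)) (prod_emb UNIV (\<lambda>_. borel) J (Pi\<^sub>E J S)) =
    emeasure (distr N paths (\<lambda>\<omega> i. V' i \<omega>)) (prod_emb UNIV (\<lambda>_. borel) J (Pi\<^sub>E J S))"
    unfolding P
    using M.finite_measure_distr[of "\<lambda>\<omega> i. V i \<omega>" paths]
      N.finite_measure_distr[of "\<lambda>\<omega> i. V' i \<omega>" paths]
    by (simp add: finite_measure.emeasure_eq_measure)
qed simp_all

section \<open>One-dimensional Gaussian laws and the covariance of the process\<close>

lemma (in prob_space) gaussian_rv_square_integrable:
  assumes "gaussian_rv M X"
  shows "integrable M (\<lambda>\<omega>. (X \<omega>)\<^sup>2)"
  using assms unfolding gaussian_rv_def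
proof (elim conjE disjE exE)
  fix \<mu> \<sigma> :: real assume \<sigma>: "0 < \<sigma>" and D: "distributed M lborel X (normal_density \<mu> \<sigma>)"
  have "integrable lborel (\<lambda>x. normal_density \<mu> \<sigma> x * (x - \<mu>) ^ 2 + (2 * \<mu>) * (normal_density \<mu> \<sigma> x * (x - \<mu>) ^ 1)
      + \<mu>\<^sup>2 * normal_density \<mu> \<sigma> x)"
    using \<sigma> by (intro Bochner_Integration.integrable_add integrable_mult_right integrable_normal_moment integrable_normal_density)
  then have "integrable lborel (\<lambda>x. normal_density \<mu> \<sigma> x * x\<^sup>2)"
    by (rule Bochner_Integration.integrable_cong[THEN iffD1, rotated 2]) (auto simp: power2_eq_square algebra_simps)
  then show ?thesis
    using distributed_integrable[OF D, of "\<lambda>x. x\<^sup>2"] by simp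
next
  fix c assume [measurable]: "X \<in> borel_measurable M" and "AE \<omega> in M. X \<omega> = c"
  then show ?thesis
    by (intro integrable_const_bound[where B="c\<^sup>2"]) (auto elim!: AE_mp)
qed

lemma (in prob_space) normal_cos_expectation:
  assumes \<sigma>: "0 < \<sigma>" and D: "distributed M lborel X (normal_density 0 \<sigma>)"
  shows "expectation (\<lambda>\<omega>. cos (X \<omega> + \<theta>)) = cos \<theta> * exp (- \<sigma>\<^sup>2 / 2)"
proof -
  have [measurable]: "X \<in> borel_measurable M" using D by (simp add: distributed_def)
  have D': "distributed M lborel (\<lambda>\<omega>. X \<omega> / \<sigma>) std_normal_density"
    using normal_standard_normal_convert[OF \<sigma>, of X 0] D by simp
  have e: "char std_normal_distribution \<sigma> = complex_of_real (exp (- (\<sigma>\<^sup>2) / 2))"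
    by (simp add: char_std_normal_distribution)
  interpret S: real_distribution std_normal_distribution
    by (rule real_dist_normal_dist)
  have tr: "(\<integral>x. h (\<sigma> * x) \<partial>std_normal_distribution) = expectation (\<lambda>\<omega>. h (X \<omega>))" if [measurable]: "h \<in> borel_measurable borel" for h :: "real \<Rightarrow> real"
    using distributed_integral[OF D', of "\<lambda>x. h (\<sigma> * x)"] \<sigma> by (simp add: integral_real_density mult.commute)
  have "(\<integral>x. cos (\<sigma> * x) \<partial>std_normal_distribution) = exp (- (\<sigma>\<^sup>2) / 2)"
    using arg_cong[OF e, of Re] integral_Re[OF S.integrable_iexp[of "\<lambda>x. of_real (\<sigma> * x)"]]
    by (simp add: char_def Re_exp)
  moreover have "(\<integral>x. sin (\<sigma> * x) \<partial>std_normal_distribution) = 0"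
    using arg_cong[OF e, of Im] integral_Im[OF S.integrable_iexp[of "\<lambda>x. of_real (\<sigma> * x)"]]
    by (simp add: char_def Im_exp)
  ultimately have "expectation (\<lambda>\<omega>. cos (X \<omega>)) = exp (- \<sigma>\<^sup>2 / 2)" "expectation (\<lambda>\<omega>. sin (X \<omega>)) = 0"
    using tr[of cos] tr[of sin] by simp_all
  moreover have "integrable M (\<lambda>\<omega>. cos (X \<omega>))" "integrable M (\<lambda>\<omega>. sin (X \<omega>))"
    by (auto intro!: integrable_const_bound[where B=1])
  ultimately show ?thesis
    by (simp add: cos_add)
qed

context isonormal_gaussian_process
begin

lemma W_measurable [measurable]: "W h \<in> borel_measurable M"
  using gaussian_family[of "{h}" "\<lambda>_. 1"] by (simp add: gaussian_rv_def)

lemma W_process_measurable [measurable]: "(\<lambda>\<omega> h. W h \<omega>) \<in> measurable M paths"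
  by (rule measurable_PiM_single') auto

lemma W_square_integrable: "integrable M (\<lambda>\<omega>. (W h \<omega>)\<^sup>2)"
  using gaussian_rv_square_integrable[OF gaussian_family[of "{h}" "\<lambda>_. 1"]] by simp

lemma W_integrable: "integrable M (W h)"
  using W_square_integrable by (rule square_integrable_imp_integrable[rotated]) simp

lemma W_mult_integrable: "integrable M (\<lambda>\<omega>. W h \<omega> * W k \<omega>)"
proof (rule Bochner_Integration.integrable_bound)
  show "integrable M (\<lambda>\<omega>. (W h \<omega>)\<^sup>2 + (W k \<omega>)\<^sup>2)"
    using W_square_integrable by auto
  have "\<bar>x * y\<bar> \<le> x\<^sup>2 + y\<^sup>2" for x y :: real
    using sum_squares_bound[of "\<bar>x\<bar>" "\<bar>y\<bar>"] mult_nonneg_nonneg[OF abs_ge_zero abs_ge_zero, of x y]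
    unfolding abs_mult power2_abs by linarith
  then show "AE \<omega> in M. norm (W h \<omega> * W k \<omega>) \<le> norm ((W h \<omega>)\<^sup>2 + (W k \<omega>)\<^sup>2)"
    by simp
qed simp

text \<open>A Gaussian law is fixed by mean and variance, here 0 and the squared norm of
  \<open>v\<close>, and it degenerates exactly for v = 0. Linearity of \<open>W\<close> is not an
  axiom; the case v = 0 is its almost sure form.\<close>

lemma lincomb_law:
  fixes c :: "'h \<Rightarrow> real"
  assumes J: "finite J"
  defines "X \<equiv> \<lambda>\<omega>. \<Sum>h\<in>J. c h * W h \<omega>" and "v \<equiv> \<Sum>h\<in>J. c h *\<^sub>R h"
  shows "v = 0 \<Longrightarrow> AE \<omega> in M. X \<omega> = 0"
    and "v \<noteq> 0 \<Longrightarrow> distributed M lborel X (normal_density 0 (norm v))"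
proof -
  have g: "gaussian_rv M X" unfolding X_def by (rule gaussian_family[OF J])
  have [measurable]: "X \<in> borel_measurable M" by (simp add: X_def)
  have m: "expectation X = 0"
    unfolding X_def by (simp add: centered W_integrable)
  have sq: "expectation (\<lambda>\<omega>. (X \<omega>)\<^sup>2) = (norm v)\<^sup>2"
    unfolding X_def power2_eq_square sum_product
    apply (subst Bochner_Integration.integral_sum)
    subgoal using W_mult_integrable by (auto intro!: Bochner_Integration.integrable_sum simp: mult.assoc mult.left_commute)
    apply (subst Bochner_Integration.integral_sum)
    subgoal using W_mult_integrable by (auto simp: mult.assoc mult.left_commute)
    unfolding v_def power2_eq_square[symmetric] power2_norm_eq_inner inner_sum_left inner_sum_right
    by (subst sum.swap) (simp add: mult.assoc mult.left_commute covariance)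
  have "(v = 0 \<longrightarrow> (AE \<omega> in M. X \<omega> = 0)) \<and> (v \<noteq> 0 \<longrightarrow> distributed M lborel X (normal_density 0 (norm v)))"
    using g unfolding gaussian_rv_def
  proof (elim conjE disjE exE)
    fix \<mu> \<sigma> :: real assume \<sigma>: "0 < \<sigma>" and D: "distributed M lborel X (normal_density \<mu> \<sigma>)"
    have "\<mu> = 0" using normal_distributed_expectation[OF \<sigma> D] m by simp
    moreover have "\<sigma>\<^sup>2 = (norm v)\<^sup>2" using normal_distributed_variance[OF \<sigma> D] m sq by simp
    then have "\<sigma> = norm v" using \<sigma> by (simp add: power2_eq_iff_nonneg)
    ultimately show ?thesis using D \<sigma> by auto
  next
    fix k assume k: "AE \<omega> in M. X \<omega> = k"
    then have "expectation X = expectation (\<lambda>_. k)" by (intro integral_cong_AE) auto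
    then have "k = 0" using m by (simp add: prob_space)
    moreover have "expectation (\<lambda>\<omega>. (X \<omega>)\<^sup>2) = expectation (\<lambda>_. k\<^sup>2)"
      using k by (intro integral_cong_AE) auto
    ultimately have "v = 0" using sq by simp
    then show ?thesis using k \<open>k = 0\<close> by auto
  qed
  then show "v = 0 \<Longrightarrow> AE \<omega> in M. X \<omega> = 0"
    and "v \<noteq> 0 \<Longrightarrow> distributed M lborel X (normal_density 0 (norm v))" by auto
qed

lemma W_zero: "AE \<omega> in M. W 0 \<omega> = 0"
  using lincomb_law(1)[of "{0}" "\<lambda>_. 1"] by simp

lemma W_distributed: "h \<noteq> 0 \<Longrightarrow> distributed M lborel (W h) (normal_density 0 (norm h))"
  using lincomb_law(2)[of "{h}" "\<lambda>_. 1"] by simp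

lemma lincomb_cos:
  assumes J: "finite J"
  shows "expectation (\<lambda>\<omega>. cos ((\<Sum>i\<in>J. c i * W (a i) \<omega>) + \<theta>)) =
    cos \<theta> * exp (- (norm (\<Sum>i\<in>J. c i *\<^sub>R a i))\<^sup>2 / 2)"
proof -
  \<comment> \<open>The Gaussian family sums over a set of vectors, so indices with the same vector
    \<open>a i\<close> are merged into one coefficient.\<close>
  define d where "d h = (\<Sum>i\<in>{i\<in>J. a i = h}. c i)" for h
  have 1: "(\<Sum>i\<in>J. c i * W (a i) \<omega>) = (\<Sum>h\<in>a ` J. d h * W h \<omega>)" for \<omega>
  proof -
    have "(\<Sum>h\<in>a ` J. d h * W h \<omega>) = (\<Sum>h\<in>a ` J. \<Sum>i\<in>{i\<in>J. a i = h}. c i * W (a i) \<omega>)"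
      by (intro sum.cong) (auto simp: d_def sum_distrib_right)
    then show ?thesis using sum.image_gen[OF J, of "\<lambda>i. c i * W (a i) \<omega>" a] by simp
  qed
  have 2: "(\<Sum>i\<in>J. c i *\<^sub>R a i) = (\<Sum>h\<in>a ` J. d h *\<^sub>R h)"
  proof -
    have "(\<Sum>h\<in>a ` J. d h *\<^sub>R h) = (\<Sum>h\<in>a ` J. \<Sum>i\<in>{i\<in>J. a i = h}. c i *\<^sub>R a i)"
      by (intro sum.cong) (auto simp: d_def scaleR_sum_left)
    then show ?thesis using sum.image_gen[OF J, of "\<lambda>i. c i *\<^sub>R a i" a] by simp
  qed
  have J': "finite (a ` J)" using J by simp
  show ?thesis
  proof (cases "(\<Sum>h\<in>a ` J. d h *\<^sub>R h) = 0")
    case True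
    have "expectation (\<lambda>\<omega>. cos ((\<Sum>h\<in>a ` J. d h * W h \<omega>) + \<theta>)) = expectation (\<lambda>_. cos \<theta>)"
      by (intro integral_cong_AE) (use lincomb_law(1)[OF J' True] in auto)
    then show ?thesis unfolding 1 2 True by (simp add: prob_space)
  next
    case False
    show ?thesis unfolding 1 2
      by (rule normal_cos_expectation[OF _ lincomb_law(2)[OF J' False]]) (use False in simp)
  qed
qed

sublocale MM: pair_prob_space M M ..

lemma lincomb_cos_pair:
  assumes J: "finite J"
  shows "(\<integral>z. cos ((\<Sum>i\<in>J. c i * (\<alpha> i * W (a i) (fst z) + \<beta> i * W (b i) (snd z))) + \<theta>) \<partial>(M \<Otimes>\<^sub>M M)) =
    cos \<theta> * exp (- (\<Sum>i\<in>J. \<Sum>j\<in>J. c i * c j * (\<alpha> i * \<alpha> j * inner (a i) (a j) + \<beta> i * \<beta> j * inner (b i) (b j))) / 2)"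
proof -
  let ?A = "\<lambda>\<omega>. \<Sum>i\<in>J. (c i * \<alpha> i) * W (a i) \<omega>" and ?B = "\<lambda>\<omega>. \<Sum>i\<in>J. (c i * \<beta> i) * W (b i) \<omega>"
  have s: "(\<Sum>i\<in>J. c i * (\<alpha> i * W (a i) x + \<beta> i * W (b i) y)) + \<theta> = ?B y + (?A x + \<theta>)" for x y
    by (simp add: distrib_left sum.distrib mult.assoc)
  have "(\<integral>z. cos ((\<Sum>i\<in>J. c i * (\<alpha> i * W (a i) (fst z) + \<beta> i * W (b i) (snd z))) + \<theta>) \<partial>(M \<Otimes>\<^sub>M M))
      = (\<integral>x. \<integral>y. cos (?B y + (?A x + \<theta>)) \<partial>M \<partial>M)"
    unfolding s by (subst MM.integral_fst'[symmetric]) (auto intro!: MM.P.integrable_const_bound[where B=1])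
  also have "\<dots> = (\<integral>x. cos (?A x + \<theta>) * exp (- (norm (\<Sum>i\<in>J. (c i * \<beta> i) *\<^sub>R b i))\<^sup>2 / 2) \<partial>M)"
    by (subst lincomb_cos[OF J]) simp
  also have "\<dots> = cos \<theta> * exp (- (norm (\<Sum>i\<in>J. (c i * \<alpha> i) *\<^sub>R a i))\<^sup>2 / 2) * exp (- (norm (\<Sum>i\<in>J. (c i * \<beta> i) *\<^sub>R b i))\<^sup>2 / 2)"
    by (simp add: lincomb_cos[OF J])
  also have "\<dots> = cos \<theta> * exp (- ((norm (\<Sum>i\<in>J. (c i * \<alpha> i) *\<^sub>R a i))\<^sup>2 + (norm (\<Sum>i\<in>J. (c i * \<beta> i) *\<^sub>R b i))\<^sup>2) / 2)"
    by (simp add: exp_add[symmetric] field_simps)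
  also have "(norm (\<Sum>i\<in>J. (c i * \<alpha> i) *\<^sub>R a i))\<^sup>2 + (norm (\<Sum>i\<in>J. (c i * \<beta> i) *\<^sub>R b i))\<^sup>2 =
     (\<Sum>i\<in>J. \<Sum>j\<in>J. c i * c j * (\<alpha> i * \<alpha> j * inner (a i) (a j) + \<beta> i * \<beta> j * inner (b i) (b j)))"
    unfolding power2_norm_eq_inner inner_sum_left inner_sum_right sum.distrib[symmetric]
    by (intro sum.cong) (auto simp: algebra_simps inner_commute)
  finally show ?thesis .
qed

text \<open>The trigonometric integrals in \<open>lincomb_cos_pair\<close> see the vectors and
  coefficients only through the covariance. Rotating the two copies thereby reduces to an identity
  between inner products.\<close>

lemma pair_process_law_eqI:
  assumes "\<And>i j. \<alpha> i * \<alpha> j * inner (a i) (a j) + \<beta> i * \<beta> j * inner (b i) (b j) =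
      \<alpha>' i * \<alpha>' j * inner (a' i) (a' j) + \<beta>' i * \<beta>' j * inner (b' i) (b' j)"
  shows "distr (M \<Otimes>\<^sub>M M) paths (\<lambda>z i. \<alpha> i * W (a i) (fst z) + \<beta> i * W (b i) (snd z)) =
    distr (M \<Otimes>\<^sub>M M) paths (\<lambda>z i. \<alpha>' i * W (a' i) (fst z) + \<beta>' i * W (b' i) (snd z))"
  by (rule cramer_wold) (simp_all add: lincomb_cos_pair assms MM.P.prob_space_axioms)

lemma pair_process_law_eq_single:
  assumes "\<And>h k. \<alpha> h * \<alpha> k * inner (a h) (a k) + \<beta> h * \<beta> k * inner (b h) (b k) = inner h k"
  shows "distr (M \<Otimes>\<^sub>M M) paths (\<lambda>z h. \<alpha> h * W (a h) (fst z) + \<beta> h * W (b h) (snd z)) =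
    distr M paths (\<lambda>\<omega> h. W h \<omega>)"
proof (rule cramer_wold)
  fix J :: "'h set" and c \<theta> assume J: "finite J"
  have e: "(norm (\<Sum>i\<in>J. c i *\<^sub>R i))\<^sup>2 = (\<Sum>i\<in>J. \<Sum>j\<in>J. c i * c j * inner i j)"
    unfolding power2_norm_eq_inner inner_sum_left inner_sum_right
    by (intro sum.cong) (auto simp: algebra_simps inner_commute)
  show "(\<integral>z. cos ((\<Sum>i\<in>J. c i * (\<alpha> i * W (a i) (fst z) + \<beta> i * W (b i) (snd z))) + \<theta>) \<partial>(M \<Otimes>\<^sub>M M)) =
     expectation (\<lambda>\<omega>. cos ((\<Sum>i\<in>J. c i * W i \<omega>) + \<theta>))"
    unfolding lincomb_cos_pair[OF J] lincomb_cos[OF J, of c "\<lambda>i. i", simplified] assms e by simp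
qed (simp_all add: MM.P.prob_space_axioms prob_space_axioms)

end

section \<open>Gaussian integration by parts\<close>

text \<open>The behaviour of G at infinity is controlled only through integrability of x G x. If the
  integral were c \<noteq> 0, then G y - G (- y) would tend to c, and x (G x - G (- x)) would be at
  least |c| / 2 in absolute value on a whole half-line, hence not integrable.\<close>

lemma integral_deriv_eq_0:
  fixes G g :: "real \<Rightarrow> real"
  assumes G: "\<And>x. (G has_real_derivative g x) (at x)" and g: "\<And>x. isCont g x"
    and int_g: "integrable lborel g" and int_G: "integrable lborel (\<lambda>x. x * G x)"
  shows "(\<integral>x. g x \<partial>lborel) = 0"
proof (rule ccontr)
  define c where "c = (\<integral>x. g x \<partial>lborel)"
  assume "(\<integral>x. g x \<partial>lborel) \<noteq> 0"
  then have c: "\<bar>c\<bar> > 0" by (simp add: c_def)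
  have [measurable]: "g \<in> borel_measurable borel"
    using int_g by (simp add: integrable_iff_bounded)
  have "((\<lambda>y. \<integral>x. g x * indicator {- y..y} x \<partial>lborel) \<longlongrightarrow> c) at_top"
    unfolding c_def
  proof (rule integral_dominated_convergence_at_top[where w="\<lambda>x. \<bar>g x\<bar>"])
    show "AE x in lborel. ((\<lambda>y. g x * indicator {- y..y} x) \<longlongrightarrow> g x) at_top"
    proof (rule AE_I2, rule tendsto_eventually)
      fix x :: real
      show "\<forall>\<^sub>F y in at_top. g x * indicator {- y..y} x = g x"
        using eventually_ge_at_top[of "\<bar>x\<bar>"] by eventually_elim (auto simp: indicator_def)
    qed
  qed (use int_g in \<open>auto simp: indicator_def\<close>)
  then have "\<forall>\<^sub>F y in at_top. dist (\<integral>x. g x * indicator {- y..y} x \<partial>lborel) c < \<bar>c\<bar> / 2"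
    using c by (intro tendstoD) auto
  then have "\<forall>\<^sub>F y in at_top. \<bar>c\<bar> / 2 \<le> \<bar>G y - G (- y)\<bar>"
    using eventually_ge_at_top[of 0]
  proof eventually_elim
    case (elim y)
    have "(\<integral>x. g x * indicator {- y..y} x \<partial>lborel) = G y - G (- y)"
      by (rule integral_FTC_Icc_real) (use elim G g in auto)
    then show ?case using elim(1) unfolding dist_real_def by linarith
  qed
  then obtain Y where Y: "\<And>y. Y \<le> y \<Longrightarrow> \<bar>c\<bar> / 2 \<le> \<bar>G y - G (- y)\<bar>"
    by (auto simp: eventually_at_top_linorder)
  \<comment> \<open>Beyond 1 the factor x is at least 1, so each window of length n contributes at
    least n |c| / 2.\<close>
  define Z where "Z = max 1 Y"
  have "integrable lborel (\<lambda>x. x * G x + (0 + (- 1) * x) * G (0 + (- 1) * x))"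
    using int_G lborel_integrable_real_affine[OF int_G, of "-1" 0] by (intro Bochner_Integration.integrable_add) simp_all
  then have k: "integrable lborel (\<lambda>x. x * (G x - G (- x)))"
    by (simp add: algebra_simps)
  define K where "K = (\<integral>x. \<bar>x * (G x - G (- x))\<bar> \<partial>lborel)"
  have "real n * (\<bar>c\<bar> / 2) \<le> K" for n
  proof -
    have "real n * (\<bar>c\<bar> / 2) = (\<integral>x. (\<bar>c\<bar> / 2) * indicator {Z..Z + real n} x \<partial>lborel)" by simp
    also have "\<dots> \<le> K" unfolding K_def
    proof (rule integral_mono)
      show "integrable lborel (\<lambda>x. (\<bar>c\<bar> / 2) * indicator {Z..Z + real n} x)" by simp
      show "integrable lborel (\<lambda>x. \<bar>x * (G x - G (- x))\<bar>)" using k by (rule integrable_abs)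
      fix x
      show "(\<bar>c\<bar> / 2) * indicator {Z..Z + real n} x \<le> \<bar>x * (G x - G (- x))\<bar>"
      proof (cases "x \<in> {Z..Z + real n}")
        case True
        then have "1 \<le> x" "Y \<le> x" by (auto simp: Z_def)
        then have "1 * (\<bar>c\<bar> / 2) \<le> \<bar>x\<bar> * \<bar>G x - G (- x)\<bar>"
          using Y c by (intro mult_mono) auto
        then show ?thesis by (auto simp: abs_mult indicator_def)
      qed auto
    qed
    finally show ?thesis .
  qed
  moreover obtain n where "K / (\<bar>c\<bar> / 2) < real n" using reals_Archimedean2 by blast
  then have "K < real n * (\<bar>c\<bar> / 2)" using c by (simp add: pos_divide_less_eq)
  ultimately show False by (simp add: not_le[symmetric])
qed

lemma stein_lborel:
  fixes \<psi> \<psi>' :: "real \<Rightarrow> real"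
  assumes \<sigma>: "0 < \<sigma>" and d: "\<And>x. (\<psi> has_real_derivative \<psi>' x) (at x)" and c: "\<And>x. isCont \<psi>' x"
    and i1: "integrable lborel (\<lambda>x. normal_density 0 \<sigma> x * (x * \<psi> x))"
    and i2: "integrable lborel (\<lambda>x. normal_density 0 \<sigma> x * \<psi>' x)"
  shows "(\<integral>x. normal_density 0 \<sigma> x * (x * \<psi> x) \<partial>lborel) = \<sigma>\<^sup>2 * (\<integral>x. normal_density 0 \<sigma> x * \<psi>' x \<partial>lborel)"
proof -
  let ?\<gamma> = "normal_density 0 \<sigma>"
  have d\<gamma>: "(?\<gamma> has_real_derivative - (x / \<sigma>\<^sup>2) * ?\<gamma> x) (at x)" for x
    unfolding normal_density_def using \<sigma>
    by (auto intro!: derivative_eq_intros simp: field_simps power2_eq_square)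
  then have c\<gamma>: "isCont ?\<gamma> x" for x by (rule DERIV_isCont)
  have c\<psi>: "isCont \<psi> x" for x using d by (rule DERIV_isCont)
  let ?g = "\<lambda>x. ?\<gamma> x * \<psi>' x - (1 / \<sigma>\<^sup>2) * (?\<gamma> x * (x * \<psi> x))"
  have "(\<integral>x. ?g x \<partial>lborel) = 0"
  proof (rule integral_deriv_eq_0[where G="\<lambda>x. ?\<gamma> x * \<psi> x"])
    show "((\<lambda>x. ?\<gamma> x * \<psi> x) has_real_derivative ?g x) (at x)" for x
      by (rule derivative_eq_intros d\<gamma> d refl)+ (simp add: algebra_simps)
    show "isCont ?g x" for x by (intro continuous_intros c\<gamma> c\<psi> c)
    show "integrable lborel ?g" using i1 i2 by (intro Bochner_Integration.integrable_diff integrable_mult_right)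
    show "integrable lborel (\<lambda>x. x * (?\<gamma> x * \<psi> x))" using i1 by (simp add: algebra_simps)
  qed
  then have "(\<integral>x. ?\<gamma> x * \<psi>' x \<partial>lborel) - (1 / \<sigma>\<^sup>2) * (\<integral>x. ?\<gamma> x * (x * \<psi> x) \<partial>lborel) = 0"
    using i1 i2 by simp
  then show ?thesis using \<sigma> by (simp add: field_simps)
qed

context isonormal_gaussian_process
begin

lemma W_stein:
  fixes \<psi> \<psi>' :: "real \<Rightarrow> real"
  assumes "e \<noteq> 0" and d: "\<And>x. (\<psi> has_real_derivative \<psi>' x) (at x)" and c: "\<And>x. isCont \<psi>' x"
    and i1: "integrable M (\<lambda>\<omega>. W e \<omega> * \<psi> (W e \<omega>))" and i2: "integrable M (\<lambda>\<omega>. \<psi>' (W e \<omega>))"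
  shows "expectation (\<lambda>\<omega>. W e \<omega> * \<psi> (W e \<omega>)) = inner e e * expectation (\<lambda>\<omega>. \<psi>' (W e \<omega>))"
proof -
  have \<sigma>: "0 < norm e" using assms by simp
  note D = W_distributed[OF \<open>e \<noteq> 0\<close>]
  have [measurable]: "\<psi> \<in> borel_measurable borel" "\<psi>' \<in> borel_measurable borel"
    by (auto intro!: borel_measurable_continuous_onI continuous_at_imp_continuous_on c DERIV_isCont[OF d])
  show ?thesis
    using stein_lborel[OF \<sigma> d c] i1 i2
      distributed_integrable[OF D, of "\<lambda>x. x * \<psi> x"] distributed_integrable[OF D, of \<psi>']
      distributed_integral[OF D, of "\<lambda>x. x * \<psi> x"] distributed_integral[OF D, of \<psi>']
    by (simp add: power2_norm_eq_inner)
qed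

text \<open>With \<open>a h = \<langle>h, e\<rangle> / \<langle>e, e\<rangle>\<close>, the process \<open>W\<close> has the law of \<open>W (h - a h e) \<omega> + a h W e \<omega>'\<close> on
  \<open>M \<Otimes> M\<close>; integrating over \<open>\<omega>'\<close> first leaves a one-dimensional integration by parts.\<close>

proposition gaussian_integration_by_parts:
  fixes \<Theta> \<Theta>' :: "('h \<Rightarrow> real) \<Rightarrow> real"
  assumes [measurable]: "\<Theta> \<in> borel_measurable paths" "\<Theta>' \<in> borel_measurable paths"
    and der: "\<And>v s. ((\<lambda>s. \<Theta> (\<lambda>h. v h + s * inner h e)) has_real_derivative \<Theta>' (\<lambda>h. v h + s * inner h e)) (at s)"
    and cont: "\<And>v s. isCont (\<lambda>s. \<Theta>' (\<lambda>h. v h + s * inner h e)) s"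
    and i1: "integrable M (\<lambda>\<omega>. W e \<omega> * \<Theta> (\<lambda>h. W h \<omega>))" and i2: "integrable M (\<lambda>\<omega>. \<Theta>' (\<lambda>h. W h \<omega>))"
  shows "expectation (\<lambda>\<omega>. W e \<omega> * \<Theta> (\<lambda>h. W h \<omega>)) = expectation (\<lambda>\<omega>. \<Theta>' (\<lambda>h. W h \<omega>))"
proof (cases "e = 0")
  case True
  have "\<Theta>' v = 0" for v
    using DERIV_unique[OF der[of v 0], of 0] True by simp
  moreover have "expectation (\<lambda>\<omega>. W e \<omega> * \<Theta> (\<lambda>h. W h \<omega>)) = expectation (\<lambda>_. 0)"
    by (rule integral_cong_AE) (use W_zero True in auto)
  ultimately show ?thesis by simp
next
  case False
  define \<tau> where "\<tau> = inner e e"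
  have \<tau>: "\<tau> > 0" using False by (simp add: \<tau>_def)
  define a where "a h = inner h e / \<tau>" for h
  define b where "b h = h - a h *\<^sub>R e" for h
  define V where "V x y h = W (b h) x + a h * W e y" for x y h
  have Vm [measurable]: "(\<lambda>z. V (fst z) (snd z)) \<in> measurable (M \<Otimes>\<^sub>M M) paths"
    by (rule measurable_PiM_single') (auto simp: V_def)
  have ae: "a e = 1" and be: "b e = 0" using \<tau> by (simp_all add: a_def b_def \<tau>_def)
  have law: "distr (M \<Otimes>\<^sub>M M) paths (\<lambda>z. V (fst z) (snd z)) = distr M paths (\<lambda>\<omega> h. W h \<omega>)"
  proof -
    have he: "inner h e = a h * \<tau>" "inner e h = a h * \<tau>" for h
      using \<tau> by (simp_all add: a_def inner_commute)
    have "inner (b h) (b k) + a h * a k * inner e e = inner h k" for h k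
      unfolding b_def inner_diff_left inner_diff_right inner_scaleR_left inner_scaleR_right
      unfolding he using ae by (simp add: algebra_simps)
    then show ?thesis
      using pair_process_law_eq_single[of "\<lambda>_. 1" b a "\<lambda>_. e"] by (simp add: V_def[abs_def])
  qed
  have tr: "integral\<^sup>L (M \<Otimes>\<^sub>M M) (\<lambda>z. \<Xi> (V (fst z) (snd z))) = expectation (\<lambda>\<omega>. \<Xi> (\<lambda>h. W h \<omega>))"
    and tri: "integrable M (\<lambda>\<omega>. \<Xi> (\<lambda>h. W h \<omega>)) \<Longrightarrow> integrable (M \<Otimes>\<^sub>M M) (\<lambda>z. \<Xi> (V (fst z) (snd z)))"
    if [measurable]: "\<Xi> \<in> borel_measurable paths" for \<Xi> :: "('h \<Rightarrow> real) \<Rightarrow> real"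
    using integral_distr[OF Vm that] integral_distr[OF W_process_measurable that]
      integrable_distr_eq[OF Vm that] integrable_distr_eq[OF W_process_measurable that] law by simp_all
  let ?f = "\<lambda>z. V (fst z) (snd z) e * \<Theta> (V (fst z) (snd z))" and ?g = "\<lambda>z. \<Theta>' (V (fst z) (snd z))"
  have I1: "integrable (M \<Otimes>\<^sub>M M) ?f" and I2: "integrable (M \<Otimes>\<^sub>M M) ?g"
    using tri[of "\<lambda>v. v e * \<Theta> v"] tri[of \<Theta>'] i1 i2 by simp_all
  have "AE x in M. (\<integral>y. ?f (x, y) \<partial>M) = (\<integral>y. ?g (x, y) \<partial>M)"
    using W_zero MM.AE_integrable_fst'[OF I1] MM.AE_integrable_fst'[OF I2]
  proof eventually_elim
    case (elim x)
    \<comment> \<open>\<open>V x y e\<close> contains the summand \<open>W 0 x\<close>, which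
      vanishes only almost surely.\<close>
    have Ve: "V x y e = W e y" for y using elim(1) by (simp add: V_def ae be)
    \<comment> \<open>Division by \<tau> makes the value of \<open>W e y\<close> the argument of
      \<psi>; the factor 1 / \<tau> from the chain rule later cancels the variance inner e e in
      \<open>W_stein\<close>.\<close>
    define \<psi> where "\<psi> s = \<Theta> (\<lambda>h. W (b h) x + (s / \<tau>) * inner h e)" for s
    define \<psi>' where "\<psi>' s = \<Theta>' (\<lambda>h. W (b h) x + (s / \<tau>) * inner h e)" for s
    have \<psi>V: "\<Theta> (V x y) = \<psi> (W e y)" "\<Theta>' (V x y) = \<psi>' (W e y)" for y
      by (simp_all add: \<psi>_def \<psi>'_def V_def[abs_def] a_def mult.commute)
    have "(\<psi> has_real_derivative \<psi>' s * (1 / \<tau>)) (at s)" for s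
      unfolding \<psi>_def \<psi>'_def
      by (rule DERIV_chain2[OF der]) (use \<tau> in \<open>auto intro!: derivative_eq_intros\<close>)
    moreover have "isCont (\<lambda>s. \<psi>' s * (1 / \<tau>)) s" for s
      unfolding \<psi>'_def
      by (intro continuous_intros isCont_o2[where f="\<lambda>s. s / \<tau>", OF _ cont]) (use \<tau> in auto)
    ultimately have "expectation (\<lambda>y. W e y * \<psi> (W e y)) = inner e e * expectation (\<lambda>y. \<psi>' (W e y) * (1 / \<tau>))"
      using elim(2,3) False by (intro W_stein) (simp_all add: Ve \<psi>V)
    then show ?case using \<tau> by (simp add: Ve \<psi>V \<tau>_def)
  qed
  then have "(\<integral>x. (\<integral>y. ?f (x, y) \<partial>M) \<partial>M) = (\<integral>x. (\<integral>y. ?g (x, y) \<partial>M) \<partial>M)"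
    using I1 I2 by (intro integral_cong_AE) auto
  then have "integral\<^sup>L (M \<Otimes>\<^sub>M M) ?f = integral\<^sup>L (M \<Otimes>\<^sub>M M) ?g"
    using MM.integral_fst'[OF I1] MM.integral_fst'[OF I2] by simp
  then show ?thesis using tr[of "\<lambda>v. v e * \<Theta> v"] tr[of \<Theta>'] by simp
qed

end

section \<open>Random variables with moments of all orders\<close>

definition all_moments :: "'a measure \<Rightarrow> ('a \<Rightarrow> real) \<Rightarrow> bool" where
  "all_moments M X \<longleftrightarrow> X \<in> borel_measurable M \<and> (\<forall>k. integrable M (\<lambda>\<omega>. \<bar>X \<omega>\<bar> ^ k))"

lemma all_moments_measurable: "all_moments M X \<Longrightarrow> X \<in> borel_measurable M"
  by (simp add: all_moments_def)

lemma all_moments_integrable: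
  assumes "all_moments M X" shows "integrable M X"
proof (rule integrable_norm_cancel)
  have "integrable M (\<lambda>\<omega>. \<bar>X \<omega>\<bar> ^ 1)" using assms unfolding all_moments_def by blast
  then show "integrable M (\<lambda>\<omega>. norm (X \<omega>))" by simp
qed (rule all_moments_measurable[OF assms])

lemma all_moments_bound:
  assumes Y: "all_moments M Y" and [measurable]: "X \<in> borel_measurable M" and le: "\<And>\<omega>. \<bar>X \<omega>\<bar> \<le> \<bar>Y \<omega>\<bar>"
  shows "all_moments M X"
  unfolding all_moments_def
proof safe
  fix k
  have "integrable M (\<lambda>\<omega>. \<bar>Y \<omega>\<bar> ^ k)" using Y by (simp add: all_moments_def)
  then show "integrable M (\<lambda>\<omega>. \<bar>X \<omega>\<bar> ^ k)"
    by (rule Bochner_Integration.integrable_bound) (auto intro!: AE_I2 power_mono simp: le)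
qed fact

lemma all_moments_abs: "all_moments M X \<Longrightarrow> all_moments M (\<lambda>\<omega>. \<bar>X \<omega>\<bar>)"
  by (auto simp: all_moments_def)

lemma power_add_le_real: "(a + b) ^ k \<le> 2 ^ k * (a ^ k + b ^ k)" if "0 \<le> a" "0 \<le> b" for a b :: real
proof -
  have "(a + b) ^ k \<le> (2 * max a b) ^ k" using that by (intro power_mono) auto
  also have "\<dots> = 2 ^ k * max a b ^ k" by (simp add: power_mult_distrib)
  also have "max a b ^ k \<le> a ^ k + b ^ k" using that by (auto simp: max_def)
  finally show ?thesis by simp
qed

lemma all_moments_add:
  assumes X: "all_moments M X" and Y: "all_moments M Y"
  shows "all_moments M (\<lambda>\<omega>. X \<omega> + Y \<omega>)"
  unfolding all_moments_def
proof safe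
  note [measurable] = all_moments_measurable[OF X] all_moments_measurable[OF Y]
  show "(\<lambda>\<omega>. X \<omega> + Y \<omega>) \<in> borel_measurable M" by measurable
  fix k
  have "integrable M (\<lambda>\<omega>. 2 ^ k * (\<bar>X \<omega>\<bar> ^ k + \<bar>Y \<omega>\<bar> ^ k))"
    using X Y by (simp add: all_moments_def)
  then show "integrable M (\<lambda>\<omega>. \<bar>X \<omega> + Y \<omega>\<bar> ^ k)"
  proof (rule Bochner_Integration.integrable_bound)
    have "\<bar>x + y\<bar> ^ k \<le> 2 ^ k * (\<bar>x\<bar> ^ k + \<bar>y\<bar> ^ k)" for x y :: real
      using power_mono[OF abs_triangle_ineq[of x y], of k] power_add_le_real[of "\<bar>x\<bar>" "\<bar>y\<bar>" k] by simp
    then show "AE \<omega> in M. norm (\<bar>X \<omega> + Y \<omega>\<bar> ^ k) \<le> norm (2 ^ k * (\<bar>X \<omega>\<bar> ^ k + \<bar>Y \<omega>\<bar> ^ k))"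
      by auto
  qed measurable
qed

text \<open>Unlike square integrability, the property survives products, which settles the
  integrability of products of cylindrical functionals. Pointwise, |x y|^k is at most |x|^(2 k) +
  |y|^(2 k).\<close>

lemma all_moments_mult:
  assumes X: "all_moments M X" and Y: "all_moments M Y"
  shows "all_moments M (\<lambda>\<omega>. X \<omega> * Y \<omega>)"
  unfolding all_moments_def
proof safe
  note [measurable] = all_moments_measurable[OF X] all_moments_measurable[OF Y]
  show "(\<lambda>\<omega>. X \<omega> * Y \<omega>) \<in> borel_measurable M" by measurable
  fix k
  have "integrable M (\<lambda>\<omega>. \<bar>X \<omega>\<bar> ^ (2 * k) + \<bar>Y \<omega>\<bar> ^ (2 * k))"
    using X Y by (simp add: all_moments_def)
  then show "integrable M (\<lambda>\<omega>. \<bar>X \<omega> * Y \<omega>\<bar> ^ k)"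
  proof (rule Bochner_Integration.integrable_bound)
    have "\<bar>x * y\<bar> ^ k \<le> \<bar>x\<bar> ^ (2 * k) + \<bar>y\<bar> ^ (2 * k)" for x y :: real
      using sum_squares_bound[of "\<bar>x\<bar> ^ k" "\<bar>y\<bar> ^ k"] mult_nonneg_nonneg[OF zero_le_power[OF abs_ge_zero] zero_le_power[OF abs_ge_zero], of x k y k]
      unfolding abs_mult power_mult_distrib power_even_eq mult.assoc by linarith
    then show "AE \<omega> in M. norm (\<bar>X \<omega> * Y \<omega>\<bar> ^ k) \<le> norm (\<bar>X \<omega>\<bar> ^ (2 * k) + \<bar>Y \<omega>\<bar> ^ (2 * k))"
      by auto
  qed measurable
qed

context prob_space
begin

lemma all_moments_const: "all_moments M (\<lambda>_. c)"
  by (simp add: all_moments_def)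

lemma all_moments_bounded:
  assumes "X \<in> borel_measurable M" "\<And>\<omega>. \<bar>X \<omega>\<bar> \<le> C" shows "all_moments M X"
proof (rule all_moments_bound[OF all_moments_const[of C] assms(1)])
  show "\<bar>X \<omega>\<bar> \<le> \<bar>C\<bar>" for \<omega> using assms(2)[of \<omega>] by linarith
qed

lemma all_moments_power:
  assumes "all_moments M X" shows "all_moments M (\<lambda>\<omega>. X \<omega> ^ k)"
proof (induction k)
  case 0
  show ?case unfolding power_0 by (rule all_moments_const)
next
  case (Suc k)
  show ?case unfolding power_Suc by (rule all_moments_mult[OF assms Suc])
qed

lemma all_moments_uminus:
  assumes "all_moments M X" shows "all_moments M (\<lambda>\<omega>. - X \<omega>)"
proof -
  have "all_moments M (\<lambda>\<omega>. (- 1) * X \<omega>)" by (rule all_moments_mult[OF all_moments_const assms])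
  then show ?thesis by simp
qed

lemma all_moments_diff:
  assumes "all_moments M X" "all_moments M Y" shows "all_moments M (\<lambda>\<omega>. X \<omega> - Y \<omega>)"
  unfolding diff_conv_add_uminus by (rule all_moments_add[OF assms(1) all_moments_uminus[OF assms(2)]])

lemma all_moments_sum:
  assumes "\<And>i. i \<in> I \<Longrightarrow> all_moments M (X i)" shows "all_moments M (\<lambda>\<omega>. \<Sum>i\<in>I. X i \<omega>)"
  using assms
proof (induction I rule: infinite_finite_induct)
  case (insert i I)
  have "all_moments M (\<lambda>\<omega>. X i \<omega> + (\<Sum>i\<in>I. X i \<omega>))"
    by (rule all_moments_add[OF insert(4) insert(3)[OF insert(4)]]) simp_all
  then show ?case using insert(1,2) by simp
qed (simp_all add: all_moments_const)

lemma all_moments_square_integrable: "all_moments M X \<Longrightarrow> integrable M (\<lambda>\<omega>. (X \<omega>)\<^sup>2)"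
  by (intro all_moments_integrable all_moments_power)

lemmas all_moments_intros = all_moments_const all_moments_add all_moments_mult all_moments_power
  all_moments_uminus all_moments_diff all_moments_sum all_moments_abs

end

section \<open>Cylindrical functions and their derivatives along lines\<close>

lemma smooth_poly_growth_cong: "smooth_poly_growth n \<phi> \<Longrightarrow> (\<And>i. i < n \<Longrightarrow> x i = y i) \<Longrightarrow> \<phi> x = \<phi> y"
  by (simp add: smooth_poly_growth_def)

lemma smooth_poly_growthD:
  assumes "smooth_poly_growth n \<phi>"
  shows smooth_poly_growth_continuous: "continuous_on UNIV \<phi>"
    and smooth_poly_growth_differentiable: "i < n \<Longrightarrow> (\<lambda>s. \<phi> (x(i := s))) differentiable (at (x i))"
    and smooth_poly_growth_bound: "\<exists>C k. \<forall>x. \<bar>\<phi> x\<bar> \<le> C * (1 + (\<Sum>i<n. (x i)\<^sup>2)) ^ k"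
proof -
  have "set [] \<subseteq> {..<n} \<longrightarrow>
      continuous_on UNIV \<phi> \<and> (\<forall>i<n. \<forall>x. (\<lambda>s. \<phi> (x(i := s))) differentiable (at (x i))) \<and>
      (\<exists>C k. \<forall>x. \<bar>\<phi> x\<bar> \<le> C * (1 + (\<Sum>i<n. (x i)\<^sup>2)) ^ k)"
    using assms[unfolded smooth_poly_growth_def, THEN conjunct2, THEN spec[of _ "[]"]]
    unfolding foldr.simps id_apply Let_def .
  then have *: "continuous_on UNIV \<phi> \<and> (\<forall>i<n. \<forall>x. (\<lambda>s. \<phi> (x(i := s))) differentiable (at (x i))) \<and>
      (\<exists>C k. \<forall>x. \<bar>\<phi> x\<bar> \<le> C * (1 + (\<Sum>i<n. (x i)\<^sup>2)) ^ k)"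
    by (rule mp) simp
  from * show "continuous_on UNIV \<phi>" by (rule conjunct1)
  from * show "i < n \<Longrightarrow> (\<lambda>s. \<phi> (x(i := s))) differentiable (at (x i))" by blast
  from * show "\<exists>C k. \<forall>x. \<bar>\<phi> x\<bar> \<le> C * (1 + (\<Sum>i<n. (x i)\<^sup>2)) ^ k" by (elim conjE)
qed

lemma smooth_poly_growth_measurable: "smooth_poly_growth n \<phi> \<Longrightarrow> \<phi> \<in> borel_measurable borel"
  by (intro borel_measurable_continuous_onI smooth_poly_growth_continuous)

lemma smooth_poly_growth_has_partial_deriv:
  assumes "smooth_poly_growth n \<phi>" "i < n"
  shows "((\<lambda>s. \<phi> (x(i := s))) has_real_derivative partial_deriv i \<phi> x) (at (x i))"
  using smooth_poly_growth_differentiable[OF assms]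
  unfolding partial_deriv_def by (simp only: DERIV_deriv_iff_real_differentiable)

lemma smooth_poly_growth_partial_deriv:
  assumes \<phi>: "smooth_poly_growth n \<phi>" and i: "i < n"
  shows "smooth_poly_growth n (partial_deriv i \<phi>)"
  unfolding smooth_poly_growth_def
proof (intro conjI allI impI)
  fix x y :: "nat \<Rightarrow> real" assume xy: "\<forall>i<n. x i = y i"
  have "(\<lambda>s. \<phi> (x(i := s))) = (\<lambda>s. \<phi> (y(i := s)))"
    by (intro ext smooth_poly_growth_cong[OF \<phi>]) (use xy in auto)
  then show "partial_deriv i \<phi> x = partial_deriv i \<phi> y"
    using xy i by (simp add: partial_deriv_def)
next
  fix "is" :: "nat list" assume "set is \<subseteq> {..<n}"
  then have "set (is @ [i]) \<subseteq> {..<n}" using i by simp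
  then show "let \<psi> = foldr partial_deriv is (partial_deriv i \<phi>) in
           continuous_on UNIV \<psi> \<and>
           (\<forall>i<n. \<forall>x. (\<lambda>s. \<psi> (x(i := s))) differentiable (at (x i))) \<and>
           (\<exists>C k. \<forall>x. \<bar>\<psi> x\<bar> \<le> C * (1 + (\<Sum>i<n. (x i)\<^sup>2)) ^ k)"
    using \<phi>[unfolded smooth_poly_growth_def, THEN conjunct2, THEN spec[of _ "is @ [i]"]]
    unfolding foldr_append by (simp only: foldr.simps comp_def id_apply simp_thms)
qed

text \<open>Only derivatives along the axes are given, so the derivative along a line is assembled
  one coordinate at a time: the coordinates below \<open>m\<close> move, the others stay frozen.
  Continuity of the partial derivatives provides total differentiability in the pair formed by the
  line parameter and the next coordinate.\<close>

lemma partial_derivs_chain_rule_aux: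
  fixes \<phi> :: "(nat \<Rightarrow> real) \<Rightarrow> real"
  assumes d: "\<And>i x. i < n \<Longrightarrow> ((\<lambda>s. \<phi> (x(i := s))) has_real_derivative D i x) (at (x i))"
    and c: "\<And>i. i < n \<Longrightarrow> continuous_on UNIV (D i)"
    and "m \<le> n"
  shows "((\<lambda>s. \<phi> (\<lambda>i. if i < m then v i + s * a i else v i)) has_real_derivative
     (\<Sum>i<m. a i * D i (\<lambda>i. if i < m then v i + s * a i else v i))) (at s)"
  using \<open>m \<le> n\<close>
proof (induction m arbitrary: v s)
  case 0
  then show ?case by simp
next
  case (Suc m)
  \<comment> \<open>The coordinates below \<open>m\<close> follow the line with parameter
    \<open>x\<close>, while coordinate \<open>m\<close> is set free as \<open>t\<close>; the choice
    t = v m + x * a m returns to the line with one more moving coordinate.\<close>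
  define p where "p x t = (\<lambda>i. if i < m then v i + x * a i else if i = m then t else v i)" for x t
  have p: "p x t = (\<lambda>i. if i < m then (v(m := t)) i + x * a i else (v(m := t)) i)" for x t
    by (auto simp: p_def)
  let ?f = "\<lambda>x t. \<phi> (p x t)"
  have p1: "((\<lambda>x. ?f x t) has_real_derivative (\<Sum>i<m. a i * D i (p x t))) (at x)" for x t
    using Suc.IH[of "v(m := t)" x] Suc.prems unfolding p by simp
  have p2: "(?f x has_real_derivative D m (p x t)) (at t)" for x t
  proof -
    have e: "p x s = (p x t)(m := s)" for s by (auto simp: p_def)
    have "?f x = (\<lambda>s. \<phi> ((p x t)(m := s)))"
      by (rule ext, rule arg_cong[where f=\<phi>], rule e)
    moreover have "p x t m = t" by (simp add: p_def)
    ultimately show ?thesis using d[of m "p x t"] Suc.prems by (simp only: Suc_le_eq)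
  qed
  have pc: "continuous_on UNIV (\<lambda>z. p (fst z) (snd z))"
  proof (rule continuous_on_coordinatewise_then_product)
    fix i
    show "continuous_on UNIV (\<lambda>z. p (fst z) (snd z) i)"
      by (cases "i < m"; cases "i = m") (simp_all add: p_def continuous_intros)
  qed
  have "((\<lambda>(x, t). ?f x t) has_derivative
      (\<lambda>(dx, dt). (\<Sum>i<m. a i * D i (p x t)) * dx + blinfun_apply (D m (p x t) *\<^sub>R id_blinfun) dt)) (at (x, t) within UNIV \<times> UNIV)" for x t
  proof (rule has_derivative_partialsI)
    show "((\<lambda>x. ?f x t) has_derivative (*) (\<Sum>i<m. a i * D i (p x t))) (at x within UNIV)"
      using p1 by (simp add: has_field_derivative_def)
    show "(?f x has_derivative blinfun_apply (D m (p x t) *\<^sub>R id_blinfun)) (at t within UNIV)" for x t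
      using p2[of x t] by (simp add: has_field_derivative_def scaleR_blinfun.rep_eq)
    have "continuous_on UNIV (\<lambda>z. D m (p (fst z) (snd z)))"
      by (rule continuous_on_compose2[OF c pc]) (use Suc.prems in auto)
    then show "continuous (at (x, t) within UNIV \<times> UNIV) (\<lambda>(x, t). D m (p x t) *\<^sub>R id_blinfun)"
      unfolding case_prod_beta
      by (intro continuous_intros) (simp_all add: continuous_on_eq_continuous_at)
  qed auto
  then have F: "((\<lambda>z. ?f (fst z) (snd z)) has_derivative
      (\<lambda>z. (\<Sum>i<m. a i * D i (p x t)) * fst z + D m (p x t) * snd z)) (at (x, t))" for x t
    unfolding case_prod_beta by (simp only: UNIV_Times_UNIV scaleR_blinfun.rep_eq id_blinfun.rep_eq id_apply real_scaleR_def)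
  have "((\<lambda>s. (s, v m + s * a m)) has_derivative (\<lambda>h. (h, h * a m))) (at s)"
    by (auto intro!: derivative_eq_intros)
  from has_derivative_compose[OF this F[of s "v m + s * a m"]]
  have "((\<lambda>s. ?f s (v m + s * a m)) has_derivative
      (\<lambda>h. (\<Sum>i<m. a i * D i (p s (v m + s * a m))) * h + D m (p s (v m + s * a m)) * (h * a m))) (at s)"
    by simp
  moreover have "p s (v m + s * a m) = (\<lambda>i. if i < Suc m then v i + s * a i else v i)" for s
    by (auto simp: p_def less_Suc_eq)
  ultimately have "((\<lambda>s. \<phi> (\<lambda>i. if i < Suc m then v i + s * a i else v i)) has_derivative
      (\<lambda>h. (\<Sum>i<m. a i * D i (\<lambda>i. if i < Suc m then v i + s * a i else v i)) * h
        + D m (\<lambda>i. if i < Suc m then v i + s * a i else v i) * (h * a m))) (at s)"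
    by (simp only:)
  then show ?case
    unfolding has_field_derivative_def
    by (rule has_derivative_eq_rhs) (simp add: fun_eq_iff algebra_simps)
qed

text \<open>All coordinates may move, since \<phi> ignores those from \<open>n\<close> on.\<close>

lemma smooth_poly_growth_line_deriv:
  assumes \<phi>: "smooth_poly_growth n \<phi>"
  shows "((\<lambda>s. \<phi> (\<lambda>i. v i + s * a i)) has_real_derivative
     (\<Sum>i<n. a i * partial_deriv i \<phi> (\<lambda>i. v i + s * a i))) (at s)"
proof -
  let ?c = "\<lambda>s i. if i < n then v i + s * a i else v i" and ?d = "\<lambda>s i. v i + s * a i"
  have 1: "\<phi> (?c s) = \<phi> (?d s)" for s
    by (rule smooth_poly_growth_cong[OF \<phi>]) simp
  have 2: "partial_deriv j \<phi> (?c s) = partial_deriv j \<phi> (?d s)" if "j < n" for s j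
    by (rule smooth_poly_growth_cong[OF smooth_poly_growth_partial_deriv[OF \<phi> that]]) simp
  have 3: "((\<lambda>s. \<phi> (?c s)) has_real_derivative (\<Sum>i<n. a i * partial_deriv i \<phi> (?c s))) (at s)"
  proof (rule partial_derivs_chain_rule_aux[where n=n and D="\<lambda>i. partial_deriv i \<phi>"])
    show "((\<lambda>s. \<phi> (x(i := s))) has_real_derivative partial_deriv i \<phi> x) (at (x i))" if "i < n" for i x
      using that by (rule smooth_poly_growth_has_partial_deriv[OF \<phi>])
    show "continuous_on UNIV (partial_deriv i \<phi>)" if "i < n" for i
      using smooth_poly_growth_partial_deriv[OF \<phi> that] by (rule smooth_poly_growth_continuous)
  qed simp
  have 4: "(\<Sum>i<n. a i * partial_deriv i \<phi> (?c s)) = (\<Sum>i<n. a i * partial_deriv i \<phi> (?d s))"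
    by (intro sum.cong refl arg_cong2[where f="(*)"] 2) simp
  have 5: "(\<lambda>s. \<phi> (?c s)) = (\<lambda>s. \<phi> (?d s))" by (rule ext) (rule 1)
  show ?thesis by (rule 3[unfolded 4 5])
qed

context isonormal_gaussian_process
begin

lemma W_all_moments: "all_moments M (W h)"
proof (cases "h = 0")
  case True
  have "integrable M (\<lambda>\<omega>. \<bar>W h \<omega>\<bar> ^ k)" for k
    using W_zero True by (intro integrable_const_bound[where B=1]) (auto simp: power_0_left)
  then show ?thesis by (simp add: all_moments_def)
next
  case False
  have "integrable lborel (\<lambda>x. normal_density 0 (norm h) x * \<bar>x - 0\<bar> ^ k)" for k
    by (rule integrable_normal_moment_abs) (use False in simp)
  then have "integrable M (\<lambda>\<omega>. \<bar>W h \<omega>\<bar> ^ k)" for k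
    using distributed_integrable[OF W_distributed[OF False], of "\<lambda>x. \<bar>x\<bar> ^ k"] by simp
  then show ?thesis by (simp add: all_moments_def)
qed

lemma cylinder_measurable [measurable (raw)]:
  "(\<lambda>\<omega> i. W (h i) \<omega>) \<in> borel_measurable M" for h :: "nat \<Rightarrow> 'h"
  by (rule measurable_coordinatewise_then_product) measurable

lemma cylinder_all_moments:
  assumes \<phi>: "smooth_poly_growth n \<phi>"
  shows "all_moments M (\<lambda>\<omega>. \<phi> (\<lambda>i. W (h i) \<omega>))"
proof -
  obtain C k where b: "\<And>x. \<bar>\<phi> x\<bar> \<le> C * (1 + (\<Sum>i<n. (x i)\<^sup>2)) ^ k"
    using smooth_poly_growth_bound[OF \<phi>] by blast
  note [measurable] = smooth_poly_growth_measurable[OF \<phi>]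
  show ?thesis
  proof (rule all_moments_bound)
    show "all_moments M (\<lambda>\<omega>. C * (1 + (\<Sum>i<n. (W (h i) \<omega>)\<^sup>2)) ^ k)"
      by (intro all_moments_intros W_all_moments)
    show "\<bar>\<phi> (\<lambda>i. W (h i) \<omega>)\<bar> \<le> \<bar>C * (1 + (\<Sum>i<n. (W (h i) \<omega>)\<^sup>2)) ^ k\<bar>" for \<omega>
      using b[of "\<lambda>i. W (h i) \<omega>"] by linarith
  qed measurable
qed

text \<open>Adding s inner h e to every coordinate of a path is a Cameron-Martin shift; it moves the
  coordinate of \<open>h i\<close> by s inner (h i) e. The two factors keep separate families of
  vectors, so that the derivative can be moved from one functional onto the other.\<close>

lemma cylinder_integration_by_parts:
  assumes \<phi>: "smooth_poly_growth n \<phi>" and \<eta>: "smooth_poly_growth m \<eta>"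
  shows "expectation (\<lambda>\<omega>. W e \<omega> * (\<phi> (\<lambda>i. W (h i) \<omega>) * \<eta> (\<lambda>i. W (k i) \<omega>))) =
    expectation (\<lambda>\<omega>. (\<Sum>i<n. inner (h i) e * partial_deriv i \<phi> (\<lambda>i. W (h i) \<omega>)) * \<eta> (\<lambda>i. W (k i) \<omega>) +
      \<phi> (\<lambda>i. W (h i) \<omega>) * (\<Sum>j<m. inner (k j) e * partial_deriv j \<eta> (\<lambda>i. W (k i) \<omega>)))"
proof -
  let ?\<Theta> = "\<lambda>v. \<phi> (\<lambda>i. v (h i)) * \<eta> (\<lambda>i. v (k i))"
  let ?\<Theta>' = "\<lambda>v. (\<Sum>i<n. inner (h i) e * partial_deriv i \<phi> (\<lambda>i. v (h i))) * \<eta> (\<lambda>i. v (k i)) +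
      \<phi> (\<lambda>i. v (h i)) * (\<Sum>j<m. inner (k j) e * partial_deriv j \<eta> (\<lambda>i. v (k i)))"
  note s\<phi> = smooth_poly_growth_partial_deriv[OF \<phi>]
  note s\<eta> = smooth_poly_growth_partial_deriv[OF \<eta>]
  have co: "(\<lambda>(v :: 'h \<Rightarrow> real) i. v (g i)) \<in> borel_measurable paths" for g :: "nat \<Rightarrow> 'h"
    by (rule measurable_coordinatewise_then_product) measurable
  have me: "(\<lambda>v. f (\<lambda>i. v (g i))) \<in> borel_measurable paths"
    if "smooth_poly_growth l f" for l f and g :: "nat \<Rightarrow> 'h"
    using measurable_compose[OF co smooth_poly_growth_measurable[OF that]] .
  have m1: "(\<lambda>v. \<phi> (\<lambda>i. v (h i))) \<in> borel_measurable paths"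
    and m2: "(\<lambda>v. \<eta> (\<lambda>i. v (k i))) \<in> borel_measurable paths"
    by (rule me[OF \<phi>], rule me[OF \<eta>])
  have m3: "(\<lambda>v. \<Sum>i<n. inner (h i) e * partial_deriv i \<phi> (\<lambda>i. v (h i))) \<in> borel_measurable paths"
    by (rule borel_measurable_sum, rule borel_measurable_times[OF borel_measurable_const me[OF s\<phi>]]) simp
  have m4: "(\<lambda>v. \<Sum>j<m. inner (k j) e * partial_deriv j \<eta> (\<lambda>i. v (k i))) \<in> borel_measurable paths"
    by (rule borel_measurable_sum, rule borel_measurable_times[OF borel_measurable_const me[OF s\<eta>]]) simp
  have "expectation (\<lambda>\<omega>. W e \<omega> * ?\<Theta> (\<lambda>h. W h \<omega>)) = expectation (\<lambda>\<omega>. ?\<Theta>' (\<lambda>h. W h \<omega>))"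
  proof (rule gaussian_integration_by_parts)
    show "?\<Theta> \<in> borel_measurable paths" "?\<Theta>' \<in> borel_measurable paths"
      by (rule borel_measurable_times[OF m1 m2],
          rule borel_measurable_add[OF borel_measurable_times[OF m3 m2] borel_measurable_times[OF m1 m4]])
    fix v :: "'h \<Rightarrow> real" and s :: real
    let ?h = "\<lambda>s i. v (h i) + s * inner (h i) e" and ?k = "\<lambda>s i. v (k i) + s * inner (k i) e"
    have d\<phi>: "((\<lambda>s. \<phi> (?h s)) has_real_derivative (\<Sum>i<n. inner (h i) e * partial_deriv i \<phi> (?h s))) (at s)"
      by (rule smooth_poly_growth_line_deriv[OF \<phi>])
    have d\<eta>: "((\<lambda>s. \<eta> (?k s)) has_real_derivative (\<Sum>i<m. inner (k i) e * partial_deriv i \<eta> (?k s))) (at s)"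
      by (rule smooth_poly_growth_line_deriv[OF \<eta>])
    show "((\<lambda>s. ?\<Theta> (\<lambda>h. v h + s * inner h e)) has_real_derivative ?\<Theta>' (\<lambda>h. v h + s * inner h e)) (at s)"
      by (rule DERIV_cong[OF DERIV_mult[OF d\<phi> d\<eta>]]) (rule arg_cong2[where f="(+)", OF refl mult.commute])
    have c1: "isCont (\<lambda>s. partial_deriv i \<phi> (?h s)) s" if "i < n" for i
      by (rule DERIV_isCont[OF smooth_poly_growth_line_deriv[OF s\<phi>[OF that]]])
    have c2: "isCont (\<lambda>s. partial_deriv i \<eta> (?k s)) s" if "i < m" for i
      by (rule DERIV_isCont[OF smooth_poly_growth_line_deriv[OF s\<eta>[OF that]]])
    show "isCont (\<lambda>s. ?\<Theta>' (\<lambda>h. v h + s * inner h e)) s"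
      by (intro continuous_add continuous_mult continuous_sum continuous_const DERIV_isCont[OF d\<phi>] DERIV_isCont[OF d\<eta>] c1 c2)
        simp_all
  next
    show "integrable M (\<lambda>\<omega>. W e \<omega> * ?\<Theta> (\<lambda>h. W h \<omega>))"
      by (rule all_moments_integrable[OF all_moments_mult[OF W_all_moments
            all_moments_mult[OF cylinder_all_moments[OF \<phi>] cylinder_all_moments[OF \<eta>]]]])
    have a1: "all_moments M (\<lambda>\<omega>. \<Sum>i<n. inner (h i) e * partial_deriv i \<phi> (\<lambda>i. W (h i) \<omega>))"
      by (rule all_moments_sum, rule all_moments_mult[OF all_moments_const cylinder_all_moments[OF s\<phi>]]) simp
    have a2: "all_moments M (\<lambda>\<omega>. \<Sum>i<m. inner (k i) e * partial_deriv i \<eta> (\<lambda>i. W (k i) \<omega>))"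
      by (rule all_moments_sum, rule all_moments_mult[OF all_moments_const cylinder_all_moments[OF s\<eta>]]) simp
    show "integrable M (\<lambda>\<omega>. ?\<Theta>' (\<lambda>h. W h \<omega>))"
      by (rule all_moments_integrable[OF all_moments_add[OF all_moments_mult[OF a1 cylinder_all_moments[OF \<eta>]]
            all_moments_mult[OF cylinder_all_moments[OF \<phi>] a2]]])
  qed
  then show ?thesis .
qed

end

section \<open>Closability of the Malliavin derivative\<close>

lemma square_integrable_inner:
  fixes a b :: "'a \<Rightarrow> 'h::{real_inner, polish_space}"
  assumes [measurable]: "a \<in> borel_measurable M" "b \<in> borel_measurable M"
    and "integrable M (\<lambda>\<omega>. (norm (a \<omega>))\<^sup>2)" "integrable M (\<lambda>\<omega>. (norm (b \<omega>))\<^sup>2)"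
  shows "integrable M (\<lambda>\<omega>. inner (a \<omega>) (b \<omega>))"
proof (rule Bochner_Integration.integrable_bound)
  show "integrable M (\<lambda>\<omega>. (norm (a \<omega>))\<^sup>2 + (norm (b \<omega>))\<^sup>2)" using assms by simp
  have "\<bar>inner x y\<bar> \<le> (norm x)\<^sup>2 + (norm y)\<^sup>2" for x y :: 'h
    using Cauchy_Schwarz_ineq2[of x y] sum_squares_bound[of "norm x" "norm y"]
      mult_nonneg_nonneg[OF norm_ge_zero norm_ge_zero, of x y] unfolding mult.assoc by linarith
  then show "AE \<omega> in M. norm (inner (a \<omega>) (b \<omega>)) \<le> norm ((norm (a \<omega>))\<^sup>2 + (norm (b \<omega>))\<^sup>2)"
    by (intro AE_I2) simp
qed measurable

text \<open>Cauchy-Schwarz, carried out with extended nonnegative integrals because single members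
  of the sequence may fail to be square integrable.\<close>

lemma L2_inner_tendsto_0:
  fixes a :: "nat \<Rightarrow> 'a \<Rightarrow> 'h::{real_inner, polish_space}"
  assumes [measurable]: "\<And>n. a n \<in> borel_measurable M" "b \<in> borel_measurable M"
    and a: "(\<lambda>n. \<integral>\<^sup>+\<omega>. ennreal ((norm (a n \<omega>))\<^sup>2) \<partial>M) \<longlonglongrightarrow> 0"
    and b: "integrable M (\<lambda>\<omega>. (norm (b \<omega>))\<^sup>2)"
  shows "(\<lambda>n. \<integral>\<omega>. inner (a n \<omega>) (b \<omega>) \<partial>M) \<longlonglongrightarrow> 0"
proof -
  let ?I = "\<lambda>n. \<integral>\<omega>. inner (a n \<omega>) (b \<omega>) \<partial>M"
  let ?B = "\<integral>\<^sup>+\<omega>. ennreal ((norm (b \<omega>))\<^sup>2) \<partial>M"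
  have B: "?B < \<infinity>" using b by (simp add: integrable_iff_bounded)
  have le: "ennreal ((?I n)\<^sup>2) \<le> (\<integral>\<^sup>+\<omega>. ennreal ((norm (a n \<omega>))\<^sup>2) \<partial>M) * ?B" for n
  proof -
    have "ennreal \<bar>?I n\<bar> \<le> (\<integral>\<^sup>+\<omega>. ennreal (norm (inner (a n \<omega>) (b \<omega>))) \<partial>M)"
    \<comment> \<open>Without integrability the Bochner integral has the default value 0, and the
      bound is trivial.\<close>
    proof (cases "integrable M (\<lambda>\<omega>. inner (a n \<omega>) (b \<omega>))")
      case True
      then show ?thesis using integral_norm_bound_ennreal[OF True] by simp
    qed (simp add: not_integrable_integral_eq)
    also have "\<dots> \<le> (\<integral>\<^sup>+\<omega>. ennreal (norm (a n \<omega>)) * ennreal (norm (b \<omega>)) \<partial>M)"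
      using Cauchy_Schwarz_ineq2 by (intro nn_integral_mono) (simp add: ennreal_mult[symmetric] ennreal_leI)
    finally have "(ennreal \<bar>?I n\<bar>)\<^sup>2 \<le> (\<integral>\<^sup>+\<omega>. ennreal (norm (a n \<omega>)) * ennreal (norm (b \<omega>)) \<partial>M)\<^sup>2"
      by (rule power_mono) simp
    also have "\<dots> \<le> (\<integral>\<^sup>+\<omega>. (ennreal (norm (a n \<omega>)))\<^sup>2 \<partial>M) * (\<integral>\<^sup>+\<omega>. (ennreal (norm (b \<omega>)))\<^sup>2 \<partial>M)"
      by (rule Cauchy_Schwarz_nn_integral) measurable
    finally show ?thesis by (simp add: ennreal_power)
  qed
  have "(\<lambda>n. ?B * (\<integral>\<^sup>+\<omega>. ennreal ((norm (a n \<omega>))\<^sup>2) \<partial>M)) \<longlonglongrightarrow> ?B * 0"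
    by (rule ennreal_tendsto_cmult[OF _ a]) (use B in simp)
  then have lim: "(\<lambda>n. (\<integral>\<^sup>+\<omega>. ennreal ((norm (a n \<omega>))\<^sup>2) \<partial>M) * ?B) \<longlonglongrightarrow> ennreal 0"
    unfolding mult.commute[of ?B] by simp
  have "(\<lambda>n. ennreal ((?I n)\<^sup>2)) \<longlonglongrightarrow> ennreal 0"
    by (rule tendsto_sandwich[OF _ _ tendsto_const lim]) (simp_all add: le del: mult_eq_0_iff)
  then have "(\<lambda>n. (?I n)\<^sup>2) \<longlonglongrightarrow> 0"
    by (subst (asm) tendsto_ennreal_iff) simp_all
  then have "(\<lambda>n. sqrt ((?I n)\<^sup>2)) \<longlonglongrightarrow> sqrt 0" by (rule tendsto_real_sqrt)
  then have "(\<lambda>n. \<bar>?I n\<bar>) \<longlonglongrightarrow> 0" by simp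
  then show ?thesis by (rule tendsto_rabs_zero_cancel)
qed

lemma nn_integral_norm_square_add_le:
  fixes a b :: "'a \<Rightarrow> 'h::{real_inner, polish_space}"
  assumes [measurable]: "a \<in> borel_measurable M" "b \<in> borel_measurable M"
  shows "(\<integral>\<^sup>+\<omega>. ennreal ((norm (a \<omega> + b \<omega>))\<^sup>2) \<partial>M) \<le>
    2 * (\<integral>\<^sup>+\<omega>. ennreal ((norm (a \<omega>))\<^sup>2) \<partial>M) + 2 * (\<integral>\<^sup>+\<omega>. ennreal ((norm (b \<omega>))\<^sup>2) \<partial>M)"
proof -
  have "(norm (x + y))\<^sup>2 \<le> 2 * (norm x)\<^sup>2 + 2 * (norm y)\<^sup>2" for x y :: 'h
  proof -
    have "(norm (x + y))\<^sup>2 \<le> (norm x + norm y)\<^sup>2" by (intro power_mono norm_triangle_ineq) simp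
    also have "\<dots> \<le> 2 * (norm x)\<^sup>2 + 2 * (norm y)\<^sup>2"
      using sum_squares_bound[of "norm x" "norm y"] unfolding power2_sum by linarith
    finally show ?thesis .
  qed
  then have "(\<integral>\<^sup>+\<omega>. ennreal ((norm (a \<omega> + b \<omega>))\<^sup>2) \<partial>M) \<le>
      (\<integral>\<^sup>+\<omega>. 2 * ennreal ((norm (a \<omega>))\<^sup>2) + 2 * ennreal ((norm (b \<omega>))\<^sup>2) \<partial>M)"
    by (intro nn_integral_mono) (simp add: ennreal_mult'[symmetric] ennreal_plus[symmetric] ennreal_leI del: ennreal_plus flip: ennreal_numeral)
  also have "\<dots> = 2 * (\<integral>\<^sup>+\<omega>. ennreal ((norm (a \<omega>))\<^sup>2) \<partial>M) + 2 * (\<integral>\<^sup>+\<omega>. ennreal ((norm (b \<omega>))\<^sup>2) \<partial>M)"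
    by (subst nn_integral_add) (simp_all add: nn_integral_cmult)
  finally show ?thesis .
qed

lemma nn_integral_norm_square_diff_tendsto_0:
  fixes a b :: "nat \<Rightarrow> 'a \<Rightarrow> 'h::{real_inner, polish_space}"
  assumes [measurable]: "\<And>n. a n \<in> borel_measurable M" "\<And>n. b n \<in> borel_measurable M"
    and a: "(\<lambda>n. \<integral>\<^sup>+\<omega>. ennreal ((norm (a n \<omega>))\<^sup>2) \<partial>M) \<longlonglongrightarrow> 0"
    and b: "(\<lambda>n. \<integral>\<^sup>+\<omega>. ennreal ((norm (b n \<omega>))\<^sup>2) \<partial>M) \<longlonglongrightarrow> 0"
  shows "(\<lambda>n. \<integral>\<^sup>+\<omega>. ennreal ((norm (a n \<omega> - b n \<omega>))\<^sup>2) \<partial>M) \<longlonglongrightarrow> 0"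
proof (rule tendsto_sandwich[OF _ _ tendsto_const])
  have "(\<lambda>n. 2 * (\<integral>\<^sup>+\<omega>. ennreal ((norm (a n \<omega>))\<^sup>2) \<partial>M) + 2 * (\<integral>\<^sup>+\<omega>. ennreal ((norm (b n \<omega>))\<^sup>2) \<partial>M)) \<longlonglongrightarrow> 2 * 0 + 2 * 0"
    by (intro tendsto_add ennreal_tendsto_cmult a b) simp_all
  then show "(\<lambda>n. 2 * (\<integral>\<^sup>+\<omega>. ennreal ((norm (a n \<omega>))\<^sup>2) \<partial>M) + 2 * (\<integral>\<^sup>+\<omega>. ennreal ((norm (b n \<omega>))\<^sup>2) \<partial>M)) \<longlonglongrightarrow> 0"
    by simp
  show "\<forall>\<^sub>F n in sequentially. (\<integral>\<^sup>+\<omega>. ennreal ((norm (a n \<omega> - b n \<omega>))\<^sup>2) \<partial>M) \<le>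
    2 * (\<integral>\<^sup>+\<omega>. ennreal ((norm (a n \<omega>))\<^sup>2) \<partial>M) + 2 * (\<integral>\<^sup>+\<omega>. ennreal ((norm (b n \<omega>))\<^sup>2) \<partial>M)"
    using nn_integral_norm_square_add_le[of "a _" M "\<lambda>\<omega>. - b _ \<omega>"] by (intro always_eventually allI) simp
qed simp

context isonormal_gaussian_process
begin

lemma smooth_functional_all_moments:
  assumes "smooth_functional_deriv W F u"
  shows "all_moments M F"
  using assms unfolding smooth_functional_deriv_def by (auto intro: cylinder_all_moments)

lemma smooth_functional_deriv_measurable:
  assumes "smooth_functional_deriv W F u"
  shows "u \<in> borel_measurable M"
  using assms unfolding smooth_functional_deriv_def
proof (elim exE conjE)
  fix n \<phi> h assume \<phi>: "smooth_poly_growth n \<phi>" and u: "u = (\<lambda>\<omega>. \<Sum>i<n. partial_deriv i \<phi> (\<lambda>i. W (h i) \<omega>) *\<^sub>R h i)"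
  show ?thesis unfolding u
    by (rule borel_measurable_sum, rule borel_measurable_scaleR[OF all_moments_measurable borel_measurable_const],
        rule cylinder_all_moments[OF smooth_poly_growth_partial_deriv[OF \<phi>]]) simp
qed

lemma smooth_functional_deriv_square_integrable:
  assumes "smooth_functional_deriv W F u"
  shows "integrable M (\<lambda>\<omega>. (norm (u \<omega>))\<^sup>2)"
  using assms unfolding smooth_functional_deriv_def
proof (elim exE conjE)
  fix n \<phi> h assume \<phi>: "smooth_poly_growth n \<phi>" and u: "u = (\<lambda>\<omega>. \<Sum>i<n. partial_deriv i \<phi> (\<lambda>i. W (h i) \<omega>) *\<^sub>R h i)"
  note [measurable] = smooth_functional_deriv_measurable[OF assms]
  have "all_moments M (\<lambda>\<omega>. \<Sum>i<n. \<bar>partial_deriv i \<phi> (\<lambda>i. W (h i) \<omega>)\<bar> * norm (h i))"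
    by (rule all_moments_sum, rule all_moments_mult[OF all_moments_abs all_moments_const],
        rule cylinder_all_moments[OF smooth_poly_growth_partial_deriv[OF \<phi>]]) simp
  then have "all_moments M (\<lambda>\<omega>. norm (u \<omega>))"
  proof (rule all_moments_bound)
    show "\<bar>norm (u \<omega>)\<bar> \<le> \<bar>\<Sum>i<n. \<bar>partial_deriv i \<phi> (\<lambda>i. W (h i) \<omega>)\<bar> * norm (h i)\<bar>" for \<omega>
      unfolding u by (rule order_trans[OF _ abs_ge_self]) (simp, rule order_trans[OF norm_sum], simp)
  qed measurable
  then show ?thesis by (rule all_moments_square_integrable)
qed

text \<open>\<delta> is the divergence of the gradient \<open>v\<close>, that is - L G; it arises by
  integrating by parts once in each direction \<open>k j\<close>. It depends on \<open>v\<close>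
  alone and therefore serves all pairs (F, u), which is what passing to the limit in F
  requires.\<close>

lemma smooth_functional_deriv_adjoint:
  assumes "smooth_functional_deriv W G v"
  obtains \<delta> where "all_moments M \<delta>"
    "\<And>F u. smooth_functional_deriv W F u \<Longrightarrow> expectation (\<lambda>\<omega>. inner (u \<omega>) (v \<omega>)) = expectation (\<lambda>\<omega>. F \<omega> * \<delta> \<omega>)"
proof -
  obtain m \<psi> k where \<psi>: "smooth_poly_growth m \<psi>"
    and v: "v = (\<lambda>\<omega>. \<Sum>j<m. partial_deriv j \<psi> (\<lambda>i. W (k i) \<omega>) *\<^sub>R k j)"
    using assms unfolding smooth_functional_deriv_def by blast
  note d\<psi> = smooth_poly_growth_partial_deriv[OF \<psi>]
  let ?p = "\<lambda>j \<omega>. partial_deriv j \<psi> (\<lambda>i. W (k i) \<omega>)"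
  let ?q = "\<lambda>j \<omega>. \<Sum>l<m. inner (k l) (k j) * partial_deriv l (partial_deriv j \<psi>) (\<lambda>i. W (k i) \<omega>)"
  have p: "all_moments M (?p j)" if "j < m" for j
    by (rule cylinder_all_moments[OF d\<psi>[OF that]])
  have q: "all_moments M (?q j)" if "j < m" for j
    by (rule all_moments_sum, rule all_moments_mult[OF all_moments_const cylinder_all_moments[OF smooth_poly_growth_partial_deriv[OF d\<psi>[OF that]]]]) simp
  define \<delta> where "\<delta> \<omega> = (\<Sum>j<m. W (k j) \<omega> * ?p j \<omega> - ?q j \<omega>)" for \<omega>
  show thesis
  proof (rule that[of \<delta>])
    show "all_moments M \<delta>"
      unfolding \<delta>_def by (rule all_moments_sum, rule all_moments_diff[OF all_moments_mult[OF W_all_moments p] q]) simp_all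
    fix F u assume "smooth_functional_deriv W F u"
    then obtain n \<phi> h where \<phi>: "smooth_poly_growth n \<phi>" and F: "F = (\<lambda>\<omega>. \<phi> (\<lambda>i. W (h i) \<omega>))"
      and u: "u = (\<lambda>\<omega>. \<Sum>i<n. partial_deriv i \<phi> (\<lambda>i. W (h i) \<omega>) *\<^sub>R h i)"
      unfolding smooth_functional_deriv_def by blast
    have Fm: "all_moments M F" unfolding F by (rule cylinder_all_moments[OF \<phi>])
    let ?r = "\<lambda>j \<omega>. (\<Sum>i<n. inner (h i) (k j) * partial_deriv i \<phi> (\<lambda>i. W (h i) \<omega>))"
    have r: "all_moments M (?r j)" for j
      by (rule all_moments_sum, rule all_moments_mult[OF all_moments_const cylinder_all_moments[OF smooth_poly_growth_partial_deriv[OF \<phi>]]]) simp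
    have uv: "inner (u \<omega>) (v \<omega>) = (\<Sum>j<m. ?r j \<omega> * ?p j \<omega>)" for \<omega>
      unfolding u v inner_sum_right by (simp add: inner_sum_left sum_distrib_right algebra_simps)
    have j: "expectation (\<lambda>\<omega>. ?r j \<omega> * ?p j \<omega>) = expectation (\<lambda>\<omega>. F \<omega> * (W (k j) \<omega> * ?p j \<omega> - ?q j \<omega>))" if j: "j < m" for j
    proof -
      have i1: "integrable M (\<lambda>\<omega>. ?r j \<omega> * ?p j \<omega>)"
        by (rule all_moments_integrable[OF all_moments_mult[OF r p[OF j]]])
      have i2: "integrable M (\<lambda>\<omega>. F \<omega> * ?q j \<omega>)"
        by (rule all_moments_integrable[OF all_moments_mult[OF Fm q[OF j]]])
      have i3: "integrable M (\<lambda>\<omega>. W (k j) \<omega> * (F \<omega> * ?p j \<omega>))"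
        by (rule all_moments_integrable[OF all_moments_mult[OF W_all_moments all_moments_mult[OF Fm p[OF j]]]])
      have "expectation (\<lambda>\<omega>. W (k j) \<omega> * (F \<omega> * ?p j \<omega>)) = expectation (\<lambda>\<omega>. ?r j \<omega> * ?p j \<omega> + F \<omega> * ?q j \<omega>)"
        unfolding F by (rule cylinder_integration_by_parts[OF \<phi> d\<psi>[OF j]])
      also have "\<dots> = expectation (\<lambda>\<omega>. ?r j \<omega> * ?p j \<omega>) + expectation (\<lambda>\<omega>. F \<omega> * ?q j \<omega>)"
        by (rule Bochner_Integration.integral_add[OF i1 i2])
      finally have "expectation (\<lambda>\<omega>. ?r j \<omega> * ?p j \<omega>) =
          expectation (\<lambda>\<omega>. W (k j) \<omega> * (F \<omega> * ?p j \<omega>)) - expectation (\<lambda>\<omega>. F \<omega> * ?q j \<omega>)" by linarith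
      also have "\<dots> = expectation (\<lambda>\<omega>. W (k j) \<omega> * (F \<omega> * ?p j \<omega>) - F \<omega> * ?q j \<omega>)"
        by (rule Bochner_Integration.integral_diff[OF i3 i2, symmetric])
      also have "(\<lambda>\<omega>. W (k j) \<omega> * (F \<omega> * ?p j \<omega>) - F \<omega> * ?q j \<omega>) = (\<lambda>\<omega>. F \<omega> * (W (k j) \<omega> * ?p j \<omega> - ?q j \<omega>))"
        by (rule ext) (simp only: right_diff_distrib mult.left_commute)
      finally show ?thesis .
    qed
    have "expectation (\<lambda>\<omega>. inner (u \<omega>) (v \<omega>)) = (\<Sum>j<m. expectation (\<lambda>\<omega>. ?r j \<omega> * ?p j \<omega>))"
      unfolding uv by (rule Bochner_Integration.integral_sum, rule all_moments_integrable[OF all_moments_mult[OF r p]]) simp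
    also have "\<dots> = (\<Sum>j<m. expectation (\<lambda>\<omega>. F \<omega> * (W (k j) \<omega> * ?p j \<omega> - ?q j \<omega>)))"
      by (rule sum.cong[OF refl], rule j) simp
    also have "\<dots> = expectation (\<lambda>\<omega>. F \<omega> * \<delta> \<omega>)"
      unfolding \<delta>_def sum_distrib_left
      by (rule Bochner_Integration.integral_sum[symmetric],
          rule all_moments_integrable[OF all_moments_mult[OF Fm all_moments_diff[OF all_moments_mult[OF W_all_moments p] q]]]) simp_all
    finally show "expectation (\<lambda>\<omega>. inner (u \<omega>) (v \<omega>)) = expectation (\<lambda>\<omega>. F \<omega> * \<delta> \<omega>)" .
  qed
qed

text \<open>If \<open>(F\<^sub>n, u\<^sub>n)\<close> converges to \<open>(0, v)\<close>, then
  \<open>E |v|\<^sup>2 = lim\<^sub>m lim\<^sub>n E \<langle>u\<^sub>n, u\<^sub>m\<rangle> = lim\<^sub>m lim\<^sub>n E (F\<^sub>n \<delta>\<^sub>m) = 0\<close> with \<open>\<delta>\<^sub>m\<close> the divergence of \<open>u\<^sub>m\<close>,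
  so that no dense class of test functionals is needed.\<close>

proposition malliavin_deriv_unique:
  assumes u: "has_malliavin_deriv M W F u" and u': "has_malliavin_deriv M W F u'"
  shows "AE \<omega> in M. u \<omega> = u' \<omega>"
proof -
  obtain Fs us where s: "\<And>n. smooth_functional_deriv W (Fs n) (us n)"
    and Fs: "(\<lambda>n. \<integral>\<^sup>+\<omega>. ennreal ((Fs n \<omega> - F \<omega>)\<^sup>2) \<partial>M) \<longlonglongrightarrow> 0"
    and us: "(\<lambda>n. \<integral>\<^sup>+\<omega>. ennreal ((norm (us n \<omega> - u \<omega>))\<^sup>2) \<partial>M) \<longlonglongrightarrow> 0"
    using u unfolding has_malliavin_deriv_def by blast
  obtain Fs' us' where s': "\<And>n. smooth_functional_deriv W (Fs' n) (us' n)"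
    and Fs': "(\<lambda>n. \<integral>\<^sup>+\<omega>. ennreal ((Fs' n \<omega> - F \<omega>)\<^sup>2) \<partial>M) \<longlonglongrightarrow> 0"
    and us': "(\<lambda>n. \<integral>\<^sup>+\<omega>. ennreal ((norm (us' n \<omega> - u' \<omega>))\<^sup>2) \<partial>M) \<longlonglongrightarrow> 0"
    using u' unfolding has_malliavin_deriv_def by blast
  have [measurable]: "F \<in> borel_measurable M" "u \<in> borel_measurable M" "u' \<in> borel_measurable M"
    using u u' by (simp_all add: has_malliavin_deriv_def)
  have [measurable]: "us n \<in> borel_measurable M" "us' n \<in> borel_measurable M"
    "Fs n \<in> borel_measurable M" "Fs' n \<in> borel_measurable M" for n
    using s s' smooth_functional_deriv_measurable smooth_functional_all_moments all_moments_measurable by blast+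
  define v where "v \<omega> = u \<omega> - u' \<omega>" for \<omega>
  \<comment> \<open>\<open>d n\<close> is kept as a difference of two derivatives and treated by
    linearity; presenting it as one smooth functional would mean merging two families of
    vectors.\<close>
  define d where "d n \<omega> = us n \<omega> - us' n \<omega>" for n \<omega>
  have [measurable]: "v \<in> borel_measurable M" "d n \<in> borel_measurable M" for n
    by (simp_all add: v_def[abs_def] d_def[abs_def])
  have dv: "(\<lambda>n. \<integral>\<^sup>+\<omega>. ennreal ((norm (v \<omega> - d n \<omega>))\<^sup>2) \<partial>M) \<longlonglongrightarrow> 0"
    using nn_integral_norm_square_diff_tendsto_0[OF _ _ us us']
    by (subst norm_minus_commute) (simp add: v_def d_def algebra_simps)
  have G: "(\<lambda>n. \<integral>\<^sup>+\<omega>. ennreal ((norm (Fs n \<omega> - Fs' n \<omega>))\<^sup>2) \<partial>M) \<longlonglongrightarrow> 0"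
    using nn_integral_norm_square_diff_tendsto_0[of "\<lambda>n \<omega>. Fs n \<omega> - F \<omega>" M "\<lambda>n \<omega>. Fs' n \<omega> - F \<omega>"] Fs Fs'
    by simp
  have usL2: "integrable M (\<lambda>\<omega>. (norm (us n \<omega>))\<^sup>2)" "integrable M (\<lambda>\<omega>. (norm (us' n \<omega>))\<^sup>2)" for n
    using smooth_functional_deriv_square_integrable s s' by blast+
  have fin: "integrable M (\<lambda>\<omega>. (norm (a \<omega>))\<^sup>2) \<longleftrightarrow> (\<integral>\<^sup>+\<omega>. ennreal ((norm (a \<omega>))\<^sup>2) \<partial>M) < \<infinity>"
    if [measurable]: "a \<in> borel_measurable M" for a :: "'a \<Rightarrow> 'h"
    by (simp add: integrable_iff_bounded)
  have add: "integrable M (\<lambda>\<omega>. (norm (a \<omega> + b \<omega>))\<^sup>2)"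
    if [measurable]: "a \<in> borel_measurable M" "b \<in> borel_measurable M"
      and ab: "integrable M (\<lambda>\<omega>. (norm (a \<omega>))\<^sup>2)" "integrable M (\<lambda>\<omega>. (norm (b \<omega>))\<^sup>2)" for a b :: "'a \<Rightarrow> 'h"
  proof -
    have "2 * (\<integral>\<^sup>+\<omega>. ennreal ((norm (a \<omega>))\<^sup>2) \<partial>M) + 2 * (\<integral>\<^sup>+\<omega>. ennreal ((norm (b \<omega>))\<^sup>2) \<partial>M) < \<infinity>"
      using ab by (simp add: fin ennreal_mult_less_top)
    then show ?thesis using nn_integral_norm_square_add_le[of a M b] by (simp add: fin order.strict_trans1)
  qed
  have dL2: "integrable M (\<lambda>\<omega>. (norm (d n \<omega>))\<^sup>2)" for n
    using add[of "us n" "\<lambda>\<omega>. - us' n \<omega>"] usL2 by (simp add: d_def)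
  have "\<forall>\<^sub>F n in sequentially. (\<integral>\<^sup>+\<omega>. ennreal ((norm (v \<omega> - d n \<omega>))\<^sup>2) \<partial>M) < \<infinity>"
    using dv by (rule order_tendstoD) simp
  then obtain N where N: "(\<integral>\<^sup>+\<omega>. ennreal ((norm (v \<omega> - d N \<omega>))\<^sup>2) \<partial>M) < \<infinity>"
    by (auto simp: eventually_sequentially)
  \<comment> \<open>The graph of the closure only asks for measurability of u and u';
    \<open>v\<close> is square integrable because it lies at finite distance from some
    \<open>d N\<close>.\<close>
  have vL2: "integrable M (\<lambda>\<omega>. (norm (v \<omega>))\<^sup>2)"
    using add[of "\<lambda>\<omega>. v \<omega> - d N \<omega>" "d N"] N dL2 by (simp add: fin)
  have split: "expectation (\<lambda>\<omega>. inner (v \<omega> - d n \<omega>) (b \<omega>)) = expectation (\<lambda>\<omega>. inner (v \<omega>) (b \<omega>)) - expectation (\<lambda>\<omega>. inner (d n \<omega>) (b \<omega>))"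
    if "b \<in> borel_measurable M" "integrable M (\<lambda>\<omega>. (norm (b \<omega>))\<^sup>2)" for n b
    unfolding inner_diff_left using that vL2 dL2
    by (intro Bochner_Integration.integral_diff square_integrable_inner) simp_all
  have orth: "expectation (\<lambda>\<omega>. inner (v \<omega>) (w \<omega>)) = 0" if w: "smooth_functional_deriv W K w" for K w
  proof -
    note [measurable] = smooth_functional_deriv_measurable[OF w]
    note wL2 = smooth_functional_deriv_square_integrable[OF w]
    obtain \<delta> where \<delta>: "all_moments M \<delta>"
      and ad: "\<And>F u. smooth_functional_deriv W F u \<Longrightarrow> expectation (\<lambda>\<omega>. inner (u \<omega>) (w \<omega>)) = expectation (\<lambda>\<omega>. F \<omega> * \<delta> \<omega>)"
      using smooth_functional_deriv_adjoint[OF w] by blast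
    note [measurable] = all_moments_measurable[OF \<delta>]
    have "expectation (\<lambda>\<omega>. inner (d n \<omega>) (w \<omega>)) = expectation (\<lambda>\<omega>. inner (Fs n \<omega> - Fs' n \<omega>) (\<delta> \<omega>))" for n
    proof -
      have "expectation (\<lambda>\<omega>. inner (d n \<omega>) (w \<omega>)) = expectation (\<lambda>\<omega>. inner (us n \<omega>) (w \<omega>)) - expectation (\<lambda>\<omega>. inner (us' n \<omega>) (w \<omega>))"
        unfolding d_def inner_diff_left using usL2 wL2
        by (intro Bochner_Integration.integral_diff square_integrable_inner) simp_all
      also have "\<dots> = expectation (\<lambda>\<omega>. Fs n \<omega> * \<delta> \<omega>) - expectation (\<lambda>\<omega>. Fs' n \<omega> * \<delta> \<omega>)"
        by (simp only: ad[OF s] ad[OF s'])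
      also have "\<dots> = expectation (\<lambda>\<omega>. Fs n \<omega> * \<delta> \<omega> - Fs' n \<omega> * \<delta> \<omega>)"
        by (rule Bochner_Integration.integral_diff[symmetric];
            rule all_moments_integrable[OF all_moments_mult[OF smooth_functional_all_moments \<delta>]], rule s s')
      finally show ?thesis by (simp add: left_diff_distrib)
    qed
    moreover have "(\<lambda>n. expectation (\<lambda>\<omega>. inner (Fs n \<omega> - Fs' n \<omega>) (\<delta> \<omega>))) \<longlonglongrightarrow> 0"
      by (rule L2_inner_tendsto_0[OF _ _ G]) (use all_moments_square_integrable[OF \<delta>] in simp_all)
    ultimately have 1: "(\<lambda>n. expectation (\<lambda>\<omega>. inner (d n \<omega>) (w \<omega>))) \<longlonglongrightarrow> 0" by simp
    have "(\<lambda>n. expectation (\<lambda>\<omega>. inner (v \<omega> - d n \<omega>) (w \<omega>))) \<longlonglongrightarrow> 0"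
      by (rule L2_inner_tendsto_0[OF _ _ dv wL2]) simp_all
    from tendsto_add[OF this 1] have "(\<lambda>n. expectation (\<lambda>\<omega>. inner (v \<omega>) (w \<omega>))) \<longlonglongrightarrow> 0"
      by (simp add: split[OF _ wL2])
    then show ?thesis by (simp add: LIMSEQ_const_iff)
  qed
  \<comment> \<open>Orthogonal to the derivatives of all smooth functionals, \<open>v\<close> is
    orthogonal to the very sequence that converges to it.\<close>
  have "expectation (\<lambda>\<omega>. inner (d n \<omega>) (v \<omega>)) = 0" for n
  proof -
    have "expectation (\<lambda>\<omega>. inner (v \<omega>) (d n \<omega>)) = expectation (\<lambda>\<omega>. inner (v \<omega>) (us n \<omega>)) - expectation (\<lambda>\<omega>. inner (v \<omega>) (us' n \<omega>))"
      unfolding d_def inner_diff_right using usL2 vL2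
      by (intro Bochner_Integration.integral_diff square_integrable_inner) simp_all
    then show ?thesis using orth[OF s] orth[OF s'] by (simp add: inner_commute)
  qed
  moreover have "(\<lambda>n. expectation (\<lambda>\<omega>. inner (v \<omega> - d n \<omega>) (v \<omega>))) \<longlonglongrightarrow> 0"
    by (rule L2_inner_tendsto_0[OF _ _ dv vL2]) simp_all
  ultimately have "(\<lambda>n. expectation (\<lambda>\<omega>. inner (v \<omega>) (v \<omega>))) \<longlonglongrightarrow> 0"
    by (simp add: split[OF _ vL2])
  then have "expectation (\<lambda>\<omega>. (norm (v \<omega>))\<^sup>2) = 0" by (simp add: LIMSEQ_const_iff power2_norm_eq_inner)
  then have "AE \<omega> in M. (norm (v \<omega>))\<^sup>2 = 0"
    using vL2 by (subst (asm) integral_nonneg_eq_0_iff_AE) simp_all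
  then show ?thesis by (simp add: v_def)
qed

text \<open>The inverse of the generator is determined only up to null sets; this carries a
  derivative over to whichever version was picked.\<close>

lemma has_malliavin_deriv_cong_AE:
  assumes u: "has_malliavin_deriv M W F u" and [measurable]: "F' \<in> borel_measurable M" and eq: "AE \<omega> in M. F \<omega> = F' \<omega>"
  shows "has_malliavin_deriv M W F' u"
proof -
  have "(\<integral>\<^sup>+\<omega>. ennreal ((K \<omega> - F \<omega>)\<^sup>2) \<partial>M) = (\<integral>\<^sup>+\<omega>. ennreal ((K \<omega> - F' \<omega>)\<^sup>2) \<partial>M)" for K
    using eq by (intro nn_integral_cong_AE) auto
  then show ?thesis using u unfolding has_malliavin_deriv_def by simp
qed

lemma malliavin_deriv_eq:
  assumes "has_malliavin_deriv M W F u"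
  shows "AE \<omega> in M. malliavin_deriv M W F \<omega> = u \<omega>"
  unfolding malliavin_deriv_def
  by (rule malliavin_deriv_unique[OF _ assms]) (rule someI[where P="has_malliavin_deriv M W F", OF assms])

end

section \<open>Radial functionals\<close>

text \<open>A class that is closed under partial derivatives and has a polynomial bound, so that the
  conditions on all iterated derivatives in \<open>smooth_poly_growth\<close> follow by induction.
  With k = 0 it contains the polynomials, in particular the squared radius; the exponentials are the
  powers of exp (- r) used for approximation.\<close>

inductive poly_gauss :: "((nat \<Rightarrow> real) \<Rightarrow> real) \<Rightarrow> bool" where
  monomial: "poly_gauss (\<lambda>x. c * x 0 ^ i * x 1 ^ j * exp (- (real k * ((x 0)\<^sup>2 + (x 1)\<^sup>2))))"
| add: "poly_gauss f \<Longrightarrow> poly_gauss g \<Longrightarrow> poly_gauss (\<lambda>x. f x + g x)"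

lemma poly_gauss_sum:
  assumes "finite I" "\<And>i. i \<in> I \<Longrightarrow> poly_gauss (f i)"
  shows "poly_gauss (\<lambda>x. \<Sum>i\<in>I. f i x)"
  using assms
proof (induction I)
  case empty
  show ?case using poly_gauss.monomial[of 0 0 0 0] by simp
next
  case (insert i I)
  have "poly_gauss (\<lambda>x. f i x + (\<Sum>i\<in>I. f i x))"
    by (rule poly_gauss.add) (use insert in simp_all)
  then show ?case using insert by simp
qed

lemma poly_gauss_dependence: "poly_gauss f \<Longrightarrow> (\<And>i. i < 2 \<Longrightarrow> x i = y i) \<Longrightarrow> f x = f y"
  by (induction rule: poly_gauss.induct) auto

lemma poly_gauss_continuous: "poly_gauss f \<Longrightarrow> continuous_on UNIV f"
  by (induction rule: poly_gauss.induct) (intro continuous_intros continuous_on_product_coordinates; assumption?)+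

lemma poly_gauss_bound: "poly_gauss f \<Longrightarrow> \<exists>C k. \<forall>x. \<bar>f x\<bar> \<le> C * (1 + (\<Sum>i<2. (x i)\<^sup>2)) ^ k"
proof (induction rule: poly_gauss.induct)
  case (monomial c i j k)
  show ?case
  proof (intro exI allI)
    fix x :: "nat \<Rightarrow> real"
    let ?R = "1 + (\<Sum>i<2. (x i)\<^sup>2)"
    have R: "?R = 1 + (x 0)\<^sup>2 + (x 1)\<^sup>2" by (simp add: numeral_2_eq_2)
    have sq: "\<bar>t\<bar> \<le> 1 + t\<^sup>2" for t :: real
      using sum_squares_bound[of 1 "\<bar>t\<bar>"] abs_ge_zero[of t] by simp
    have "\<bar>x 0\<bar> \<le> ?R" "\<bar>x 1\<bar> \<le> ?R" unfolding R using sq[of "x 0"] sq[of "x 1"] zero_le_power2[of "x 0"] zero_le_power2[of "x 1"] by linarith+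
    then have "\<bar>x 0\<bar> ^ i \<le> ?R ^ i" "\<bar>x 1\<bar> ^ j \<le> ?R ^ j" by (auto intro: power_mono)
    moreover have "0 \<le> ?R" by (simp add: R)
    ultimately have "\<bar>x 0\<bar> ^ i * \<bar>x 1\<bar> ^ j \<le> ?R ^ i * ?R ^ j"
      by (intro mult_mono zero_le_power abs_ge_zero)
    then have "(\<bar>x 0\<bar> ^ i * \<bar>x 1\<bar> ^ j) * exp (- (real k * ((x 0)\<^sup>2 + (x 1)\<^sup>2))) \<le> ?R ^ i * ?R ^ j * 1"
      by (rule mult_mono) (simp_all add: R)
    then have "(\<bar>x 0\<bar> ^ i * \<bar>x 1\<bar> ^ j) * exp (- (real k * ((x 0)\<^sup>2 + (x 1)\<^sup>2))) \<le> ?R ^ (i + j)"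
      by (simp only: power_add mult_1_right)
    then have "\<bar>c\<bar> * ((\<bar>x 0\<bar> ^ i * \<bar>x 1\<bar> ^ j) * exp (- (real k * ((x 0)\<^sup>2 + (x 1)\<^sup>2)))) \<le> \<bar>c\<bar> * ?R ^ (i + j)"
      by (intro mult_left_mono) simp_all
    then show "\<bar>c * x 0 ^ i * x 1 ^ j * exp (- (real k * ((x 0)\<^sup>2 + (x 1)\<^sup>2)))\<bar> \<le> \<bar>c\<bar> * ?R ^ (i + j)"
      by (simp add: abs_mult power_abs mult.assoc)
  qed
next
  case (add f g)
  then obtain C k C' k' where 1: "\<And>x. \<bar>f x\<bar> \<le> C * (1 + (\<Sum>i<2. (x i)\<^sup>2)) ^ k"
    and 2: "\<And>x. \<bar>g x\<bar> \<le> C' * (1 + (\<Sum>i<2. (x i)\<^sup>2)) ^ k'" by blast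
  show ?case
  proof (intro exI allI)
    fix x :: "nat \<Rightarrow> real"
    let ?R = "1 + (\<Sum>i<2. (x i)\<^sup>2)"
    have R1: "1 \<le> ?R" by (simp add: sum_nonneg)
    have "C * ?R ^ k \<le> \<bar>C\<bar> * ?R ^ (k + k')"
      using R1 by (intro mult_mono power_increasing) auto
    moreover have "C' * ?R ^ k' \<le> \<bar>C'\<bar> * ?R ^ (k + k')"
      using R1 by (intro mult_mono power_increasing) auto
    ultimately show "\<bar>f x + g x\<bar> \<le> (\<bar>C\<bar> + \<bar>C'\<bar>) * ?R ^ (k + k')"
      using 1[of x] 2[of x] unfolding distrib_right by linarith
  qed
qed

text \<open>For i = 0 the truncated exponent \<open>i - 1\<close> does no harm, as its coefficient
  is 0.\<close>

lemma monomial_exp_deriv: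
  "((\<lambda>s. c * s ^ i * b ^ j * exp (- (real k * (s\<^sup>2 + b\<^sup>2)))) has_real_derivative
    (c * real i) * s ^ (i - 1) * b ^ j * exp (- (real k * (s\<^sup>2 + b\<^sup>2))) +
    (- 2 * real k * c) * s ^ (i + 1) * b ^ j * exp (- (real k * (s\<^sup>2 + b\<^sup>2)))) (at s)" for b c :: real
proof -
  define E where "E = exp (- (real k * (s\<^sup>2 + b\<^sup>2)))"
  have e: "((\<lambda>s. exp (- (real k * (s\<^sup>2 + b\<^sup>2)))) has_real_derivative E * (- 2 * real k * s)) (at s)"
    unfolding E_def by (auto intro!: derivative_eq_intros)
  have p: "((\<lambda>s. c * s ^ i * b ^ j) has_real_derivative c * real i * s ^ (i - 1) * b ^ j) (at s)"
    by (auto intro!: derivative_eq_intros)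
  show ?thesis
    unfolding E_def[symmetric]
    by (rule DERIV_cong[OF DERIV_mult[OF p e]], unfold E_def[symmetric]) (simp add: algebra_simps)
qed

lemma poly_gauss_has_partial_deriv:
  "poly_gauss f \<Longrightarrow> l < 2 \<Longrightarrow>
    \<exists>g. poly_gauss g \<and> (\<forall>x. ((\<lambda>s. f (x(l := s))) has_real_derivative g x) (at (x l)))"
proof (induction rule: poly_gauss.induct)
  case (monomial c i j k)
  let ?E = "\<lambda>x. exp (- (real k * ((x 0)\<^sup>2 + (x 1)\<^sup>2)))"
  consider "l = 0" | "l = 1" using monomial by linarith
  then show ?case
  proof cases
    case 1
    let ?g = "\<lambda>x. (c * real i) * x 0 ^ (i - 1) * x 1 ^ j * ?E x + (- 2 * real k * c) * x 0 ^ (i + 1) * x 1 ^ j * ?E x"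
    have "poly_gauss ?g" by (intro poly_gauss.add poly_gauss.monomial)
    moreover have "((\<lambda>s. c * (x(l := s)) 0 ^ i * (x(l := s)) 1 ^ j * ?E (x(l := s))) has_real_derivative ?g x) (at (x l))" for x :: "nat \<Rightarrow> real"
      unfolding 1 using monomial_exp_deriv[of c i "x 1" j k "x 0"] by simp
    ultimately show ?thesis by blast
  next
    case 2
    let ?g = "\<lambda>x. (c * real j) * x 0 ^ i * x 1 ^ (j - 1) * ?E x + (- 2 * real k * c) * x 0 ^ i * x 1 ^ (j + 1) * ?E x"
    have "poly_gauss ?g" by (intro poly_gauss.add poly_gauss.monomial)
    moreover have "((\<lambda>s. c * (x(l := s)) 0 ^ i * (x(l := s)) 1 ^ j * ?E (x(l := s))) has_real_derivative ?g x) (at (x l))" for x :: "nat \<Rightarrow> real"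
      unfolding 2 using monomial_exp_deriv[of c j "x 0" i k "x 1"] by (simp add: ac_simps)
    ultimately show ?thesis by blast
  qed
next
  case (add f g)
  then obtain f' g' where "poly_gauss f'" "poly_gauss g'"
    and f: "\<And>x. ((\<lambda>s. f (x(l := s))) has_real_derivative f' x) (at (x l))"
    and g: "\<And>x. ((\<lambda>s. g (x(l := s))) has_real_derivative g' x) (at (x l))" by blast
  then have "poly_gauss (\<lambda>x. f' x + g' x)" by (intro poly_gauss.add)
  moreover have "((\<lambda>s. f (x(l := s)) + g (x(l := s))) has_real_derivative f' x + g' x) (at (x l))" for x
    by (rule DERIV_add[OF f g])
  ultimately show ?case by blast
qed

lemma poly_gauss_partial_deriv:
  assumes "poly_gauss f" "l < 2"
  shows "poly_gauss (partial_deriv l f)"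
proof -
  obtain g where g: "poly_gauss g" "\<And>x. ((\<lambda>s. f (x(l := s))) has_real_derivative g x) (at (x l))"
    using poly_gauss_has_partial_deriv[OF assms] by blast
  have "partial_deriv l f = g"
    unfolding partial_deriv_def by (rule ext) (rule DERIV_imp_deriv[OF g(2)])
  then show ?thesis using g by simp
qed

lemma poly_gauss_smooth_poly_growth:
  assumes "poly_gauss f"
  shows "smooth_poly_growth 2 f"
  unfolding smooth_poly_growth_def Let_def
proof (intro conjI allI impI)
  fix x y :: "nat \<Rightarrow> real" assume "\<forall>i<2. x i = y i"
  then show "f x = f y" by (intro poly_gauss_dependence[OF assms]) simp
next
  fix "is" :: "nat list" assume "set is \<subseteq> {..<2}"
  then have p: "poly_gauss (foldr partial_deriv is f)"
    by (induction "is") (simp_all add: assms poly_gauss_partial_deriv)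
  show "continuous_on UNIV (foldr partial_deriv is f)" by (rule poly_gauss_continuous[OF p])
  show "\<exists>C k. \<forall>x. \<bar>foldr partial_deriv is f x\<bar> \<le> C * (1 + (\<Sum>i<2. (x i)\<^sup>2)) ^ k" by (rule poly_gauss_bound[OF p])
  fix i :: nat and x :: "nat \<Rightarrow> real" assume "i < 2"
  then show "(\<lambda>s. foldr partial_deriv is f (x(i := s))) differentiable at (x i)"
    using poly_gauss_has_partial_deriv[OF p] real_differentiable_def by blast
qed

text \<open>The substitution t = exp (- r) compactifies the half-line to [0, 1], and the limit of q
  at infinity is precisely continuity at t = 0. Weierstrass approximation in t does the
  rest.\<close>

lemma exp_polynomial_approximation:
  fixes q :: "real \<Rightarrow> real"
  assumes q: "\<And>r. isCont q r" and l: "(q \<longlongrightarrow> l) at_top" and e: "0 < e"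
  obtains a n where "\<And>r. 0 \<le> r \<Longrightarrow> \<bar>q r - (\<Sum>i\<le>n. a i * exp (- r) ^ i)\<bar> < e"
proof -
  define k where "k t = (if t \<le> 0 then l else q (- ln t))" for t
  have "continuous_on {0..1} k"
    unfolding continuous_on_eq_continuous_within
  proof
    fix t :: real assume t: "t \<in> {0..1}"
    show "continuous (at t within {0..1}) k"
    proof (cases "t = 0")
      case True
      have "filterlim (\<lambda>t::real. - ln t) at_top (at_right 0)"
        using ln_at_0 by (simp add: filterlim_uminus_at_bot)
      then have "((\<lambda>t. q (- ln t)) \<longlongrightarrow> l) (at_right 0)"
        by (rule filterlim_compose[OF l])
      then have "(k \<longlongrightarrow> l) (at_right 0)"
      proof (rule Lim_transform_eventually)
        show "\<forall>\<^sub>F x in at_right 0. q (- ln x) = k x"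
          using eventually_at_right_less[of 0] by eventually_elim (simp add: k_def)
      qed
      moreover have "at (0::real) within {0..1} \<le> at_right 0"
        unfolding at_within_def by (intro inf_mono order_refl) auto
      ultimately have "(k \<longlongrightarrow> l) (at 0 within {0..1})" by (rule tendsto_mono[rotated])
      then show ?thesis using True by (simp add: continuous_within k_def)
    next
      case False
      then have "0 < t" using t by simp
      have "isCont (\<lambda>t. q (- ln t)) t"
        using \<open>0 < t\<close> by (intro isCont_o2[OF _ q] continuous_intros) auto
      moreover have "\<forall>\<^sub>F x in nhds t. k x = q (- ln x)"
        using eventually_nhds_in_open[of "{0<..}" t] \<open>0 < t\<close> by (auto elim!: eventually_mono simp: k_def)
      ultimately have "isCont k t" by (simp add: isCont_cong)
      then show ?thesis by (rule continuous_at_imp_continuous_at_within)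
    qed
  qed
  from Stone_Weierstrass_real_polynomial_function[OF compact_Icc this e]
  obtain p where p: "real_polynomial_function p" and ap: "\<And>x. x \<in> {0..1} \<Longrightarrow> \<bar>k x - p x\<bar> < e" by blast
  obtain a n where pe: "p = (\<lambda>x. \<Sum>i\<le>n. a i * x ^ i)"
    using p unfolding real_polynomial_function_iff_sum by blast
  show thesis
  proof (rule that[of a n])
    fix r :: real assume "0 \<le> r"
    then show "\<bar>q r - (\<Sum>i\<le>n. a i * exp (- r) ^ i)\<bar> < e"
      using ap[of "exp (- r)"] by (simp add: pe k_def)
  qed
qed

context isonormal_gaussian_process
begin

abbreviation sq2 :: "'h \<Rightarrow> 'h \<Rightarrow> 'a \<Rightarrow> real" where
  "sq2 f g \<omega> \<equiv> (W f \<omega>)\<^sup>2 + (W g \<omega>)\<^sup>2"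

lemma smooth_functional_deriv_radial:
  assumes d: "\<And>r. (\<psi> has_real_derivative \<psi>' r) (at r)" and p: "poly_gauss (\<lambda>x. \<psi> ((x 0)\<^sup>2 + (x 1)\<^sup>2))"
  shows "smooth_functional_deriv W (\<lambda>\<omega>. \<psi> (sq2 f g \<omega>)) (\<lambda>\<omega>. (2 * \<psi>' (sq2 f g \<omega>)) *\<^sub>R (W f \<omega> *\<^sub>R f + W g \<omega> *\<^sub>R g))"
proof -
  let ?\<phi> = "\<lambda>x :: nat \<Rightarrow> real. \<psi> ((x 0)\<^sup>2 + (x 1)\<^sup>2)"
  let ?h = "\<lambda>i :: nat. if i = 0 then f else g"
  have c: "((\<lambda>s. \<psi> (s\<^sup>2 + b)) has_real_derivative \<psi>' (s\<^sup>2 + b) * (2 * s)) (at s)" for s b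
    by (rule DERIV_chain2[OF d]) (auto intro!: derivative_eq_intros)
  have "((\<lambda>s. ?\<phi> (x(0 := s))) has_real_derivative 2 * \<psi>' ((x 0)\<^sup>2 + (x 1)\<^sup>2) * x 0) (at (x 0))" for x :: "nat \<Rightarrow> real"
    using c[of "(x 1)\<^sup>2" "x 0"] by (simp add: ac_simps)
  then have 0: "partial_deriv 0 ?\<phi> x = 2 * \<psi>' ((x 0)\<^sup>2 + (x 1)\<^sup>2) * x 0" for x
    unfolding partial_deriv_def by (rule DERIV_imp_deriv)
  have "((\<lambda>s. ?\<phi> (x(Suc 0 := s))) has_real_derivative 2 * \<psi>' ((x 0)\<^sup>2 + (x 1)\<^sup>2) * x 1) (at (x (Suc 0)))" for x :: "nat \<Rightarrow> real"
    using c[of "(x 0)\<^sup>2" "x 1"] by (simp add: ac_simps)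
  then have 1: "partial_deriv (Suc 0) ?\<phi> x = 2 * \<psi>' ((x 0)\<^sup>2 + (x 1)\<^sup>2) * x 1" for x
    unfolding partial_deriv_def by (rule DERIV_imp_deriv)
  show ?thesis
    unfolding smooth_functional_deriv_def
  proof (intro exI conjI)
    show "smooth_poly_growth 2 ?\<phi>" by (rule poly_gauss_smooth_poly_growth[OF p])
    show "(\<lambda>\<omega>. \<psi> (sq2 f g \<omega>)) = (\<lambda>\<omega>. ?\<phi> (\<lambda>i. W (?h i) \<omega>))" by simp
    show "(\<lambda>\<omega>. (2 * \<psi>' (sq2 f g \<omega>)) *\<^sub>R (W f \<omega> *\<^sub>R f + W g \<omega> *\<^sub>R g)) =
      (\<lambda>\<omega>. \<Sum>i<2. partial_deriv i ?\<phi> (\<lambda>i. W (?h i) \<omega>) *\<^sub>R ?h i)"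
    proof (rule ext)
      have s: "{..<2} = {0, Suc 0}" by auto
      show "(2 * \<psi>' (sq2 f g \<omega>)) *\<^sub>R (W f \<omega> *\<^sub>R f + W g \<omega> *\<^sub>R g) =
        (\<Sum>i<2. partial_deriv i ?\<phi> (\<lambda>i. W (?h i) \<omega>) *\<^sub>R ?h i)" for \<omega>
        unfolding s by (simp add: 0[simplified] 1[simplified] scaleR_add_right)
    qed
  qed
qed

text \<open>As a function of \<open>exp (- r)\<close>, \<open>q\<close> is a uniform limit of polynomials on \<open>[0, 1]\<close>; their
  antiderivatives in \<open>r\<close> are admissible smooth functions.\<close>

proposition has_malliavin_deriv_radial:
  fixes \<phi> q :: "real \<Rightarrow> real"
  assumes d: "\<And>r. (\<phi> has_real_derivative q r) (at r)" and q: "\<And>r. isCont q r" and l: "(q \<longlongrightarrow> l) at_top"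
  shows "has_malliavin_deriv M W (\<lambda>\<omega>. \<phi> (sq2 f g \<omega>)) (\<lambda>\<omega>. (2 * q (sq2 f g \<omega>)) *\<^sub>R (W f \<omega> *\<^sub>R f + W g \<omega> *\<^sub>R g))"
    (is "has_malliavin_deriv M W ?F ?u")
proof -
  have [measurable]: "\<phi> \<in> borel_measurable borel" "q \<in> borel_measurable borel"
    by (auto intro!: borel_measurable_continuous_onI continuous_at_imp_continuous_on q DERIV_isCont[OF d])
  let ?v = "\<lambda>\<omega>. W f \<omega> *\<^sub>R f + W g \<omega> *\<^sub>R g"
  have approx: "\<exists>\<psi> \<psi>'. poly_gauss (\<lambda>x. \<psi> ((x 0)\<^sup>2 + (x 1)\<^sup>2)) \<and> (\<forall>r. (\<psi> has_real_derivative \<psi>' r) (at r)) \<and>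
     (\<forall>r\<ge>0. \<bar>\<psi>' r - q r\<bar> \<le> e \<and> \<bar>\<psi> r - \<phi> r\<bar> \<le> e * r)" if e: "0 < e" for e
  proof -
    obtain a n where a: "\<And>r. 0 \<le> r \<Longrightarrow> \<bar>q r - (\<Sum>i\<le>n. a i * exp (- r) ^ i)\<bar> < e"
      using exp_polynomial_approximation[OF q l e] by blast
    \<comment> \<open>The antiderivative of the i-th term that vanishes at 0. The constant term
      integrates to a multiple of r, which is where unbounded test functions enter.\<close>
    define t where "t i r = (if i = 0 then a 0 * r else (a i / real i) * (1 - exp (- (real i * r))))" for i r
    \<comment> \<open>Starting at \<phi> 0 makes the error vanish at 0, so that a uniform error e of
      the derivative yields an error of at most e r.\<close>
    define \<psi> where "\<psi> r = \<phi> 0 + (\<Sum>i\<le>n. t i r)" for r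
    define \<psi>' where "\<psi>' r = (\<Sum>i\<le>n. a i * exp (- r) ^ i)" for r
    have t: "(t i has_real_derivative a i * exp (- r) ^ i) (at r)" for i r
    proof (cases "i = 0")
      case True
      then show ?thesis unfolding t_def by (auto intro!: derivative_eq_intros)
    next
      case False
      then show ?thesis unfolding t_def
        by (auto intro!: derivative_eq_intros simp: exp_of_nat_mult[symmetric])
    qed
    have d\<psi>: "(\<psi> has_real_derivative \<psi>' r) (at r)" for r
      unfolding \<psi>_def \<psi>'_def by (auto intro!: derivative_eq_intros t)
    have c: "poly_gauss (\<lambda>x. c)" for c
      using poly_gauss.monomial[of c 0 0 0] by simp
    have "poly_gauss (\<lambda>x. t i ((x 0)\<^sup>2 + (x 1)\<^sup>2))" for i
    proof (cases "i = 0")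
      case True
      show ?thesis using poly_gauss.add[OF poly_gauss.monomial[of "a 0" 2 0 0] poly_gauss.monomial[of "a 0" 0 2 0]] True
        by (simp add: t_def distrib_left)
    next
      case False
      show ?thesis using poly_gauss.add[OF c[of "a i / real i"] poly_gauss.monomial[of "- (a i / real i)" 0 0 i]] False
        by (simp add: t_def algebra_simps)
    qed
    then have p: "poly_gauss (\<lambda>x. \<psi> ((x 0)\<^sup>2 + (x 1)\<^sup>2))"
      unfolding \<psi>_def by (intro poly_gauss.add[OF c] poly_gauss_sum) simp_all
    have b1: "\<bar>\<psi>' r - q r\<bar> \<le> e" if "0 \<le> r" for r
      using a[OF that] unfolding \<psi>'_def by linarith
    have b2: "\<bar>\<psi> r - \<phi> r\<bar> \<le> e * r" if r: "0 \<le> r" for r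
    proof -
      have "norm ((\<psi> r - \<phi> r) - (\<psi> 0 - \<phi> 0)) \<le> e * norm (r - 0)"
      proof (rule field_differentiable_bound[where S="{0..}"])
        show "((\<lambda>r. \<psi> r - \<phi> r) has_real_derivative \<psi>' z - q z) (at z within {0..})" for z
          by (rule has_field_derivative_at_within[OF DERIV_diff[OF d\<psi> d]])
        show "norm (\<psi>' z - q z) \<le> e" if "z \<in> {0..}" for z using b1[of z] that by simp
      qed (use r in auto)
      moreover have "\<psi> 0 = \<phi> 0" by (auto simp: \<psi>_def t_def intro!: sum.neutral)
      ultimately show ?thesis using r by simp
    qed
    show ?thesis using p d\<psi> b1 b2 by blast
  qed
  have "\<forall>n. \<exists>\<psi> \<psi>'. poly_gauss (\<lambda>x. \<psi> ((x 0)\<^sup>2 + (x 1)\<^sup>2)) \<and> (\<forall>r. (\<psi> has_real_derivative \<psi>' r) (at r)) \<and>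
     (\<forall>r\<ge>0. \<bar>\<psi>' r - q r\<bar> \<le> 1 / real (Suc n) \<and> \<bar>\<psi> r - \<phi> r\<bar> \<le> 1 / real (Suc n) * r)"
    by (rule allI, rule approx) simp
  from choice[OF this] obtain \<psi> where "\<forall>n. \<exists>\<psi>'. poly_gauss (\<lambda>x. \<psi> n ((x 0)\<^sup>2 + (x 1)\<^sup>2)) \<and>
     (\<forall>r. (\<psi> n has_real_derivative \<psi>' r) (at r)) \<and>
     (\<forall>r\<ge>0. \<bar>\<psi>' r - q r\<bar> \<le> 1 / real (Suc n) \<and> \<bar>\<psi> n r - \<phi> r\<bar> \<le> 1 / real (Suc n) * r)" ..
  from choice[OF this] obtain \<psi>' where ap: "\<forall>n. poly_gauss (\<lambda>x. \<psi> n ((x 0)\<^sup>2 + (x 1)\<^sup>2)) \<and>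
     (\<forall>r. (\<psi> n has_real_derivative \<psi>' n r) (at r)) \<and>
     (\<forall>r\<ge>0. \<bar>\<psi>' n r - q r\<bar> \<le> 1 / real (Suc n) \<and> \<bar>\<psi> n r - \<phi> r\<bar> \<le> 1 / real (Suc n) * r)" ..
  have p: "poly_gauss (\<lambda>x. \<psi> n ((x 0)\<^sup>2 + (x 1)\<^sup>2))"
    and d\<psi>: "(\<psi> n has_real_derivative \<psi>' n r) (at r)"
    and b1: "0 \<le> r \<Longrightarrow> \<bar>\<psi>' n r - q r\<bar> \<le> 1 / real (Suc n)"
    and b2: "0 \<le> r \<Longrightarrow> \<bar>\<psi> n r - \<phi> r\<bar> \<le> 1 / real (Suc n) * r" for n r
    using ap by blast+
  have sm: "smooth_functional_deriv W (\<lambda>\<omega>. \<psi> n (sq2 f g \<omega>)) (\<lambda>\<omega>. (2 * \<psi>' n (sq2 f g \<omega>)) *\<^sub>R ?v \<omega>)" for n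
    by (rule smooth_functional_deriv_radial[OF d\<psi> p])
  \<comment> \<open>Both approximation errors are at most 1 / (n + 1)^2 times a fixed integrable
    function: the square of the squared radius for the values, a quadratic expression in |W f| and
    |W g| for the derivatives.\<close>
  have null: "(\<lambda>n. \<integral>\<^sup>+\<omega>. ennreal (X n \<omega>) \<partial>M) \<longlonglongrightarrow> 0"
    if X: "\<And>n \<omega>. X n \<omega> \<le> (1 / real (Suc n))\<^sup>2 * Z \<omega>" and Z: "integrable M Z" "\<And>\<omega>. 0 \<le> Z \<omega>" for X Z
  proof (rule tendsto_sandwich[OF _ _ tendsto_const])
    show "\<forall>\<^sub>F n in sequentially. (\<integral>\<^sup>+\<omega>. ennreal (X n \<omega>) \<partial>M) \<le> ennreal ((1 / real (Suc n))\<^sup>2 * expectation Z)"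
    proof (intro always_eventually allI)
      fix n
      have "(\<integral>\<^sup>+\<omega>. ennreal (X n \<omega>) \<partial>M) \<le> (\<integral>\<^sup>+\<omega>. ennreal ((1 / real (Suc n))\<^sup>2 * Z \<omega>) \<partial>M)"
        by (intro nn_integral_mono ennreal_leI X)
      also have "\<dots> = ennreal (\<integral>\<omega>. (1 / real (Suc n))\<^sup>2 * Z \<omega> \<partial>M)"
        by (rule nn_integral_eq_integral) (use Z in auto)
      finally show "(\<integral>\<^sup>+\<omega>. ennreal (X n \<omega>) \<partial>M) \<le> ennreal ((1 / real (Suc n))\<^sup>2 * expectation Z)" by simp
    qed
    have "(\<lambda>n. (1 / real (Suc n))\<^sup>2 * expectation Z) \<longlonglongrightarrow> 0\<^sup>2 * expectation Z"
      by (intro tendsto_intros LIMSEQ_Suc[OF lim_1_over_n])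
    then show "(\<lambda>n. ennreal ((1 / real (Suc n))\<^sup>2 * expectation Z)) \<longlonglongrightarrow> 0"
      by (intro tendsto_ennreal_iff[THEN iffD2, of _ _ 0, simplified]) (auto intro!: tendsto_eq_intros always_eventually integral_nonneg_AE simp: Z)
  qed simp
  show ?thesis
    unfolding has_malliavin_deriv_def
  proof (intro conjI exI allI)
    show "?F \<in> borel_measurable M" "?u \<in> borel_measurable M" by measurable
    show "smooth_functional_deriv W (\<lambda>\<omega>. \<psi> n (sq2 f g \<omega>)) (\<lambda>\<omega>. (2 * \<psi>' n (sq2 f g \<omega>)) *\<^sub>R ?v \<omega>)" for n by (rule sm)
    show "(\<lambda>n. \<integral>\<^sup>+\<omega>. ennreal ((\<psi> n (sq2 f g \<omega>) - \<phi> (sq2 f g \<omega>))\<^sup>2) \<partial>M) \<longlonglongrightarrow> 0"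
    proof (rule null)
      show "(\<psi> n (sq2 f g \<omega>) - \<phi> (sq2 f g \<omega>))\<^sup>2 \<le> (1 / real (Suc n))\<^sup>2 * (sq2 f g \<omega>)\<^sup>2" for n \<omega>
        using power_mono[OF b2[of "sq2 f g \<omega>" n], of 2] unfolding power2_abs power_mult_distrib by simp
      show "integrable M (\<lambda>\<omega>. (sq2 f g \<omega>)\<^sup>2)"
        by (intro all_moments_square_integrable all_moments_add all_moments_power W_all_moments)
    qed simp
    show "(\<lambda>n. \<integral>\<^sup>+\<omega>. ennreal ((norm ((2 * \<psi>' n (sq2 f g \<omega>)) *\<^sub>R ?v \<omega> - ?u \<omega>))\<^sup>2) \<partial>M) \<longlonglongrightarrow> 0"
    proof (rule null)
      fix n \<omega>
      have n: "norm (?v \<omega>) \<le> \<bar>W f \<omega>\<bar> * norm f + \<bar>W g \<omega>\<bar> * norm g"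
        by (rule order_trans[OF norm_triangle_ineq]) simp
      have e: "(2 * \<psi>' n (sq2 f g \<omega>)) *\<^sub>R ?v \<omega> - ?u \<omega> = (2 * (\<psi>' n (sq2 f g \<omega>) - q (sq2 f g \<omega>))) *\<^sub>R ?v \<omega>"
        by (simp add: scaleR_left_diff_distrib right_diff_distrib)
      have "norm ((2 * \<psi>' n (sq2 f g \<omega>)) *\<^sub>R ?v \<omega> - ?u \<omega>) = 2 * (\<bar>\<psi>' n (sq2 f g \<omega>) - q (sq2 f g \<omega>)\<bar> * norm (?v \<omega>))"
        unfolding e norm_scaleR abs_mult by (simp only: abs_numeral mult.assoc)
      also have "\<dots> \<le> 2 * (1 / real (Suc n) * (\<bar>W f \<omega>\<bar> * norm f + \<bar>W g \<omega>\<bar> * norm g))"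
        by (intro mult_left_mono mult_mono b1 n) simp_all
      finally have "norm ((2 * \<psi>' n (sq2 f g \<omega>)) *\<^sub>R ?v \<omega> - ?u \<omega>) \<le>
         1 / real (Suc n) * (2 * (\<bar>W f \<omega>\<bar> * norm f + \<bar>W g \<omega>\<bar> * norm g))" by simp
      from power_mono[OF this norm_ge_zero, of 2]
      show "(norm ((2 * \<psi>' n (sq2 f g \<omega>)) *\<^sub>R ?v \<omega> - ?u \<omega>))\<^sup>2 \<le>
         (1 / real (Suc n))\<^sup>2 * (2 * (\<bar>W f \<omega>\<bar> * norm f + \<bar>W g \<omega>\<bar> * norm g))\<^sup>2"
        unfolding power_mult_distrib .
    next
      show "integrable M (\<lambda>\<omega>. (2 * (\<bar>W f \<omega>\<bar> * norm f + \<bar>W g \<omega>\<bar> * norm g))\<^sup>2)"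
        by (intro all_moments_square_integrable all_moments_mult[OF all_moments_const] all_moments_add
            all_moments_mult[OF _ all_moments_const] all_moments_abs W_all_moments)
    qed simp
  qed
qed

end

section \<open>Uniqueness of the pseudo-inverse\<close>

context isonormal_gaussian_process
begin

section \<open>Rotations of two independent copies and the semigroup\<close>

abbreviation mix :: "real \<Rightarrow> real \<Rightarrow> 'a \<times> 'a \<Rightarrow> 'h \<Rightarrow> real" where
  "mix a b z \<equiv> \<lambda>h. a * W h (fst z) + b * W h (snd z)"

lemma mix_measurable [measurable]: "mix a b \<in> measurable (M \<Otimes>\<^sub>M M) paths"
  by (rule measurable_PiM_single') auto

lemma mix_section_measurable: "\<Xi> \<in> borel_measurable paths \<Longrightarrow>
    (\<lambda>\<omega>'. \<Xi> (\<lambda>h. a * W h \<omega> + b * W h \<omega>')) \<in> borel_measurable M"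
  by (rule measurable_compose[where g=\<Xi> and N=paths], rule measurable_PiM_single') auto

lemma mix_law:
  assumes "a\<^sup>2 + b\<^sup>2 = 1"
  shows "distr (M \<Otimes>\<^sub>M M) paths (mix a b) = distr M paths (\<lambda>\<omega> h. W h \<omega>)"
proof (rule pair_process_law_eq_single)
  fix h k :: 'h
  have "a * a * inner h k + b * b * inner h k = (a\<^sup>2 + b\<^sup>2) * inner h k"
    by (simp add: power2_eq_square algebra_simps)
  then show "a * a * inner h k + b * b * inner h k = inner h k" using assms by simp
qed

lemma mix_integral:
  fixes \<Xi> :: "('h \<Rightarrow> real) \<Rightarrow> real"
  assumes "a\<^sup>2 + b\<^sup>2 = 1" and [measurable]: "\<Xi> \<in> borel_measurable paths"
  shows "(\<integral>z. \<Xi> (mix a b z) \<partial>(M \<Otimes>\<^sub>M M)) = expectation (\<lambda>\<omega>. \<Xi> (\<lambda>h. W h \<omega>))"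
    and "integrable (M \<Otimes>\<^sub>M M) (\<lambda>z. \<Xi> (mix a b z)) \<longleftrightarrow> integrable M (\<lambda>\<omega>. \<Xi> (\<lambda>h. W h \<omega>))"
  using integral_distr[OF mix_measurable assms(2), of a b] integral_distr[OF W_process_measurable assms(2)]
    integrable_distr_eq[OF mix_measurable assms(2), of a b] integrable_distr_eq[OF W_process_measurable assms(2)]
    mix_law[OF assms(1)] by simp_all

lemma mix_AE:
  assumes "a\<^sup>2 + b\<^sup>2 = 1" and [measurable]: "Measurable.pred paths P"
    and "AE \<omega> in M. P (\<lambda>h. W h \<omega>)"
  shows "AE \<omega> in M. AE \<omega>' in M. P (\<lambda>h. a * W h \<omega> + b * W h \<omega>')"
proof -
  have "AE v in distr M paths (\<lambda>\<omega> h. W h \<omega>). P v"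
    by (subst AE_distr_iff) (use assms(3) in auto)
  then have "AE z in M \<Otimes>\<^sub>M M. P (mix a b z)"
    unfolding mix_law[OF assms(1), symmetric] by (subst (asm) AE_distr_iff) auto
  then show ?thesis by (auto dest: MM.AE_pair)
qed

text \<open>The Mehler weights are the cosine and sine of an angle, so the semigroup averages a
  rotated path over the second copy.\<close>

lemma exp_cos_sin: "(exp (- t))\<^sup>2 + (sqrt (1 - exp (- 2 * t)))\<^sup>2 = 1" if "0 \<le> t"
  using that by (simp add: power2_eq_square[of "exp _"] exp_add[symmetric])

text \<open>The semigroup with an explicit representative in place of the one chosen inside
  \<open>OU_semigroup\<close>.\<close>

definition mehler :: "real \<Rightarrow> (('h \<Rightarrow> real) \<Rightarrow> real) \<Rightarrow> 'a \<Rightarrow> real" where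
  "mehler t \<Phi> \<omega> = (\<integral>\<omega>'. \<Phi> (\<lambda>h. exp (- t) * W h \<omega> + sqrt (1 - exp (- 2 * t)) * W h \<omega>') \<partial>M)"

lemma mehler_measurable [measurable (raw)]:
  assumes [measurable]: "\<Phi> \<in> borel_measurable paths"
  shows "mehler t \<Phi> \<in> borel_measurable M"
proof -
  have "(\<lambda>z. \<Phi> (mix (exp (- t)) (sqrt (1 - exp (- 2 * t))) z)) \<in> borel_measurable (M \<Otimes>\<^sub>M M)" by measurable
  then have "(\<lambda>(\<omega>, \<omega>'). \<Phi> (\<lambda>h. exp (- t) * W h \<omega> + sqrt (1 - exp (- 2 * t)) * W h \<omega>')) \<in> borel_measurable (M \<Otimes>\<^sub>M M)"
    by (simp add: case_prod_beta)
  from borel_measurable_lebesgue_integral[OF this] show ?thesis unfolding mehler_def[abs_def] .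
qed

lemma OU_semigroup_mehler: "OU_semigroup M W t F = mehler t (SOME \<Phi>. represents M W F \<Phi>)"
  by (rule ext) (simp add: OU_semigroup_def mehler_def)

lemma mehler_cong_AE:
  assumes "represents M W F \<Phi>" "represents M W F \<Psi>" "0 \<le> t"
  shows "AE \<omega> in M. mehler t \<Phi> \<omega> = mehler t \<Psi> \<omega>"
proof -
  have [measurable]: "\<Phi> \<in> borel_measurable paths" "\<Psi> \<in> borel_measurable paths"
    using assms by (simp_all add: represents_def)
  have "AE \<omega> in M. \<Phi> (\<lambda>h. W h \<omega>) = \<Psi> (\<lambda>h. W h \<omega>)"
    using assms(1,2) unfolding represents_def by auto
  then have "AE \<omega> in M. AE \<omega>' in M. \<Phi> (\<lambda>h. exp (- t) * W h \<omega> + sqrt (1 - exp (- 2 * t)) * W h \<omega>') =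
      \<Psi> (\<lambda>h. exp (- t) * W h \<omega> + sqrt (1 - exp (- 2 * t)) * W h \<omega>')"
  proof (rule mix_AE[OF exp_cos_sin[OF assms(3)], rotated])
    have "{v \<in> space paths. \<Phi> v = \<Psi> v} \<in> sets paths"
      by (rule borel_measurable_eq) fact+
    then show "Measurable.pred paths (\<lambda>v. \<Phi> v = \<Psi> v)" by (simp add: pred_def)
  qed
  then show ?thesis
  proof eventually_elim
    case (elim \<omega>)
    then show ?case unfolding mehler_def
      by (intro integral_cong_AE mix_section_measurable) auto
  qed
qed

lemma OU_semigroup_eq_mehler:
  assumes "represents M W F \<Phi>" "0 \<le> t"
  shows "AE \<omega> in M. OU_semigroup M W t F \<omega> = mehler t \<Phi> \<omega>"
  unfolding OU_semigroup_mehler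
  by (rule mehler_cong_AE[OF _ assms]) (rule someI[where P="represents M W F", OF assms(1)])

text \<open>The covariance between copies rotated by two angles depends only on the difference of
  the angles. Indexing by \<open>bool \<times> 'h\<close> turns the two rotated processes into one
  Gaussian family, so that their joint law is compared.\<close>

lemma rotation_increment:
  fixes \<Phi> :: "('h \<Rightarrow> real) \<Rightarrow> real"
  assumes [measurable]: "\<Phi> \<in> borel_measurable paths"
  shows "(\<integral>z. (\<Phi> (mix (cos (\<alpha> + \<gamma>)) (sin (\<alpha> + \<gamma>)) z) - \<Phi> (mix (cos (\<beta> + \<gamma>)) (sin (\<beta> + \<gamma>)) z))\<^sup>2 \<partial>(M \<Otimes>\<^sub>M M)) =
    (\<integral>z. (\<Phi> (mix (cos \<alpha>) (sin \<alpha>) z) - \<Phi> (mix (cos \<beta>) (sin \<beta>) z))\<^sup>2 \<partial>(M \<Otimes>\<^sub>M M))"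
proof -
  define A where "A x y i = (if fst i then x else y)" for x y :: real and i :: "bool \<times> 'h"
  define V where "V x y z i = cos (A x y i) * W (snd i) (fst z) + sin (A x y i) * W (snd i) (snd z)" for x y z i
  have [measurable]: "V x y \<in> measurable (M \<Otimes>\<^sub>M M) paths" for x y
    by (rule measurable_PiM_single') (auto simp: V_def)
  have co: "(\<lambda>v h. v (b, h)) \<in> measurable paths paths" for b :: bool
    by (rule measurable_PiM_single') auto
  define \<Xi> where "\<Xi> v = (\<Phi> (\<lambda>h. v (True, h)) - \<Phi> (\<lambda>h. v (False, h)))\<^sup>2" for v
  have [measurable]: "\<Xi> \<in> borel_measurable paths"
    unfolding \<Xi>_def[abs_def] using measurable_compose[OF co assms]
    by (intro borel_measurable_power borel_measurable_diff) simp_all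
  have law: "distr (M \<Otimes>\<^sub>M M) paths (V (\<alpha> + \<gamma>) (\<beta> + \<gamma>)) = distr (M \<Otimes>\<^sub>M M) paths (V \<alpha> \<beta>)"
    unfolding V_def[abs_def]
  proof (rule pair_process_law_eqI)
    fix i j :: "bool \<times> 'h"
    have e: "cos x * cos y * c + sin x * sin y * c = cos (x - y) * c" for x y c :: real
      by (simp add: cos_diff algebra_simps)
    have "A (\<alpha> + \<gamma>) (\<beta> + \<gamma>) i - A (\<alpha> + \<gamma>) (\<beta> + \<gamma>) j = A \<alpha> \<beta> i - A \<alpha> \<beta> j" by (simp add: A_def)
    then show "cos (A (\<alpha> + \<gamma>) (\<beta> + \<gamma>) i) * cos (A (\<alpha> + \<gamma>) (\<beta> + \<gamma>) j) * inner (snd i) (snd j) +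
        sin (A (\<alpha> + \<gamma>) (\<beta> + \<gamma>) i) * sin (A (\<alpha> + \<gamma>) (\<beta> + \<gamma>) j) * inner (snd i) (snd j) =
        cos (A \<alpha> \<beta> i) * cos (A \<alpha> \<beta> j) * inner (snd i) (snd j) +
        sin (A \<alpha> \<beta> i) * sin (A \<alpha> \<beta> j) * inner (snd i) (snd j)"
      unfolding e by simp
  qed
  have "(\<integral>z. \<Xi> (V (\<alpha> + \<gamma>) (\<beta> + \<gamma>) z) \<partial>(M \<Otimes>\<^sub>M M)) = (\<integral>z. \<Xi> (V \<alpha> \<beta> z) \<partial>(M \<Otimes>\<^sub>M M))"
    by (subst (1 2) integral_distr[symmetric, where N=paths]) (simp_all add: law)
  then show ?thesis by (simp add: \<Xi>_def V_def A_def)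
qed

text \<open>The arc is cut into \<open>N\<close> equal steps. By rotation invariance all increments
  have the same mean square, and the square of a sum of \<open>N\<close> terms is at most
  \<open>N\<close> times the sum of the squares; together this gives the factor N^2.\<close>

lemma rotation_chain_le:
  fixes \<Phi> :: "('h \<Rightarrow> real) \<Rightarrow> real"
  assumes [measurable]: "\<Phi> \<in> borel_measurable paths"
    and sq: "integrable M (\<lambda>\<omega>. (\<Phi> (\<lambda>h. W h \<omega>))\<^sup>2)"
  shows "(\<integral>z. (\<Phi> (mix (cos (real N * \<theta>)) (sin (real N * \<theta>)) z) - \<Phi> (mix 1 0 z))\<^sup>2 \<partial>(M \<Otimes>\<^sub>M M)) \<le>
    (real N)\<^sup>2 * (\<integral>z. (\<Phi> (mix (cos \<theta>) (sin \<theta>) z) - \<Phi> (mix 1 0 z))\<^sup>2 \<partial>(M \<Otimes>\<^sub>M M))"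
proof -
  define P where "P x z = \<Phi> (mix (cos x) (sin x) z)" for x z
  have [measurable]: "P x \<in> borel_measurable (M \<Otimes>\<^sub>M M)" for x
    unfolding P_def[abs_def] by measurable
  have P2: "integrable (M \<Otimes>\<^sub>M M) (\<lambda>z. (P x z)\<^sup>2)" for x
    unfolding P_def by (subst mix_integral(2)[of _ _ "\<lambda>v. (\<Phi> v)\<^sup>2"]) (use sq in simp_all)
  have PP: "integrable (M \<Otimes>\<^sub>M M) (\<lambda>z. (P x z - P y z)\<^sup>2)" for x y
  proof (rule Bochner_Integration.integrable_bound)
    show "integrable (M \<Otimes>\<^sub>M M) (\<lambda>z. 2 * (P x z)\<^sup>2 + 2 * (P y z)\<^sup>2)" using P2 by simp
    have "(a - b)\<^sup>2 \<le> 2 * a\<^sup>2 + 2 * b\<^sup>2" for a b :: real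
      using sum_squares_bound[of a "- b"] by (simp add: power2_diff)
    then show "AE z in M \<Otimes>\<^sub>M M. norm ((P x z - P y z)\<^sup>2) \<le> norm (2 * (P x z)\<^sup>2 + 2 * (P y z)\<^sup>2)"
      by (intro AE_I2) simp
  qed measurable
  have step: "(\<integral>z. (P (real (Suc k) * \<theta>) z - P (real k * \<theta>) z)\<^sup>2 \<partial>(M \<Otimes>\<^sub>M M)) = (\<integral>z. (P \<theta> z - P 0 z)\<^sup>2 \<partial>(M \<Otimes>\<^sub>M M))" for k
    using rotation_increment[OF assms(1), of \<theta> "real k * \<theta>" 0] unfolding P_def by (simp add: algebra_simps)
  have "(\<integral>z. (P (real N * \<theta>) z - P (real 0 * \<theta>) z)\<^sup>2 \<partial>(M \<Otimes>\<^sub>M M)) \<le>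
     (\<integral>z. (\<Sum>k<N. (P (real (Suc k) * \<theta>) z - P (real k * \<theta>) z)\<^sup>2) * real N \<partial>(M \<Otimes>\<^sub>M M))"
  proof (rule integral_mono)
    show "integrable (M \<Otimes>\<^sub>M M) (\<lambda>z. (P (real N * \<theta>) z - P (real 0 * \<theta>) z)\<^sup>2)" by (rule PP)
    show "integrable (M \<Otimes>\<^sub>M M) (\<lambda>z. (\<Sum>k<N. (P (real (Suc k) * \<theta>) z - P (real k * \<theta>) z)\<^sup>2) * real N)"
      by (intro integrable_mult_left Bochner_Integration.integrable_sum PP)
    fix z
    have "P (real N * \<theta>) z - P (real 0 * \<theta>) z = (\<Sum>k<N. P (real (Suc k) * \<theta>) z - P (real k * \<theta>) z)"
      by (rule sum_lessThan_telescope[symmetric])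
    then show "(P (real N * \<theta>) z - P (real 0 * \<theta>) z)\<^sup>2 \<le> (\<Sum>k<N. (P (real (Suc k) * \<theta>) z - P (real k * \<theta>) z)\<^sup>2) * real N"
      using sum_squared_le_sum_of_squares[of "\<lambda>k. P (real (Suc k) * \<theta>) z - P (real k * \<theta>) z" "{..<N}"] by simp
  qed
  also have "\<dots> = (\<Sum>k<N. (\<integral>z. (P \<theta> z - P 0 z)\<^sup>2 \<partial>(M \<Otimes>\<^sub>M M))) * real N"
    unfolding integral_mult_left_zero
    by (subst Bochner_Integration.integral_sum[OF PP]) (simp only: step)
  also have "\<dots> = (real N)\<^sup>2 * (\<integral>z. (P \<theta> z - P 0 z)\<^sup>2 \<partial>(M \<Otimes>\<^sub>M M))"
    by (simp add: power2_eq_square)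
  finally show ?thesis by (simp add: P_def)
qed

text \<open>Expanding the square, both pure terms have the mean of the squared functional by
  invariance of the law, and integrating the mixed term over the second copy leaves
  \<open>mehler t \<Phi>\<close>. This is the link between rotations and the generator.\<close>

lemma rotation_increment_mehler:
  fixes \<Phi> :: "('h \<Rightarrow> real) \<Rightarrow> real"
  assumes [measurable]: "\<Phi> \<in> borel_measurable paths"
    and sq: "integrable M (\<lambda>\<omega>. (\<Phi> (\<lambda>h. W h \<omega>))\<^sup>2)" and t: "0 \<le> t"
  shows "(\<integral>z. (\<Phi> (mix (exp (- t)) (sqrt (1 - exp (- 2 * t))) z) - \<Phi> (mix 1 0 z))\<^sup>2 \<partial>(M \<Otimes>\<^sub>M M)) =
    2 * expectation (\<lambda>\<omega>. (\<Phi> (\<lambda>h. W h \<omega>) - mehler t \<Phi> \<omega>) * \<Phi> (\<lambda>h. W h \<omega>))"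
proof -
  define V where "V z = \<Phi> (mix (exp (- t)) (sqrt (1 - exp (- 2 * t))) z)" for z
  define U where "U z = \<Phi> (mix 1 0 z)" for z
  define Z where "Z \<omega> = \<Phi> (\<lambda>h. W h \<omega>)" for \<omega>
  have [measurable]: "V \<in> borel_measurable (M \<Otimes>\<^sub>M M)" "U \<in> borel_measurable (M \<Otimes>\<^sub>M M)"
    unfolding V_def[abs_def] U_def[abs_def] by measurable
  have sq: "integrable M (\<lambda>\<omega>. (Z \<omega>)\<^sup>2)" using sq unfolding Z_def .
  have V2: "integrable (M \<Otimes>\<^sub>M M) (\<lambda>z. (V z)\<^sup>2)" "(\<integral>z. (V z)\<^sup>2 \<partial>(M \<Otimes>\<^sub>M M)) = expectation (\<lambda>\<omega>. (Z \<omega>)\<^sup>2)"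
    using mix_integral[OF exp_cos_sin[OF t], of "\<lambda>v. (\<Phi> v)\<^sup>2"] sq unfolding V_def Z_def by simp_all
  have U2: "integrable (M \<Otimes>\<^sub>M M) (\<lambda>z. (U z)\<^sup>2)" "(\<integral>z. (U z)\<^sup>2 \<partial>(M \<Otimes>\<^sub>M M)) = expectation (\<lambda>\<omega>. (Z \<omega>)\<^sup>2)"
    using mix_integral[of 1 0 "\<lambda>v. (\<Phi> v)\<^sup>2"] sq unfolding U_def Z_def by simp_all
  have UV: "integrable (M \<Otimes>\<^sub>M M) (\<lambda>z. V z * U z)"
    using square_integrable_inner[of V "M \<Otimes>\<^sub>M M" U] V2 U2 by simp
  have sec: "(\<lambda>\<omega>. \<integral>\<omega>'. V (\<omega>, \<omega>') * U (\<omega>, \<omega>') \<partial>M) = (\<lambda>\<omega>. mehler t \<Phi> \<omega> * Z \<omega>)"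
    by (rule ext) (simp add: mehler_def U_def V_def Z_def)
  have c: "(\<integral>z. V z * U z \<partial>(M \<Otimes>\<^sub>M M)) = expectation (\<lambda>\<omega>. mehler t \<Phi> \<omega> * Z \<omega>)"
    using MM.integral_fst'[OF UV] unfolding sec by simp
  have ci: "integrable M (\<lambda>\<omega>. mehler t \<Phi> \<omega> * Z \<omega>)"
    using MM.integrable_fst'[OF UV] unfolding sec .
  have "(\<integral>z. (V z - U z)\<^sup>2 \<partial>(M \<Otimes>\<^sub>M M)) = (\<integral>z. (V z)\<^sup>2 + (U z)\<^sup>2 - 2 * (V z * U z) \<partial>(M \<Otimes>\<^sub>M M))"
    by (simp add: power2_diff mult.assoc)
  also have "\<dots> = 2 * (expectation (\<lambda>\<omega>. (Z \<omega>)\<^sup>2) - expectation (\<lambda>\<omega>. mehler t \<Phi> \<omega> * Z \<omega>))"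
    using V2 U2 UV c by simp
  also have "expectation (\<lambda>\<omega>. (Z \<omega>)\<^sup>2) - expectation (\<lambda>\<omega>. mehler t \<Phi> \<omega> * Z \<omega>) =
      expectation (\<lambda>\<omega>. (Z \<omega>)\<^sup>2 - mehler t \<Phi> \<omega> * Z \<omega>)"
    by (rule Bochner_Integration.integral_diff[OF sq ci, symmetric])
  also have "(\<lambda>\<omega>. (Z \<omega>)\<^sup>2 - mehler t \<Phi> \<omega> * Z \<omega>) = (\<lambda>\<omega>. (Z \<omega> - mehler t \<Phi> \<omega>) * Z \<omega>)"
    by (rule ext) (simp add: power2_eq_square algebra_simps)
  finally show ?thesis unfolding V_def U_def Z_def .
qed

text \<open>Only almost everywhere, because Fubini gives integrable sections for almost every
  \<omega>.\<close>

lemma mehler_diff: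
  fixes \<Phi> \<Psi> :: "('h \<Rightarrow> real) \<Rightarrow> real"
  assumes [measurable]: "\<Phi> \<in> borel_measurable paths" "\<Psi> \<in> borel_measurable paths"
    and i: "integrable M (\<lambda>\<omega>. \<Phi> (\<lambda>h. W h \<omega>))" "integrable M (\<lambda>\<omega>. \<Psi> (\<lambda>h. W h \<omega>))" and t: "0 \<le> t"
  shows "AE \<omega> in M. mehler t (\<lambda>v. \<Phi> v - \<Psi> v) \<omega> = mehler t \<Phi> \<omega> - mehler t \<Psi> \<omega>"
proof -
  let ?a = "exp (- t)" and ?b = "sqrt (1 - exp (- 2 * t))"
  have "integrable (M \<Otimes>\<^sub>M M) (\<lambda>z. \<Phi> (mix ?a ?b z))" "integrable (M \<Otimes>\<^sub>M M) (\<lambda>z. \<Psi> (mix ?a ?b z))"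
    by (subst mix_integral(2)[OF exp_cos_sin[OF t]]; use i in simp)+
  from this[THEN MM.AE_integrable_fst'] show ?thesis
    by eventually_elim (simp add: mehler_def)
qed

lemma L2_functional_represented:
  assumes "L2_functional M W F" "represents M W F \<Phi>"
  shows "integrable M (\<lambda>\<omega>. (\<Phi> (\<lambda>h. W h \<omega>))\<^sup>2)" "integrable M (\<lambda>\<omega>. \<Phi> (\<lambda>h. W h \<omega>))"
proof -
  have [measurable]: "\<Phi> \<in> borel_measurable paths" "F \<in> borel_measurable M"
    using assms by (simp_all add: represents_def L2_functional_def)
  have e: "AE \<omega> in M. F \<omega> = \<Phi> (\<lambda>h. W h \<omega>)" using assms by (simp add: represents_def)
  show sq: "integrable M (\<lambda>\<omega>. (\<Phi> (\<lambda>h. W h \<omega>))\<^sup>2)"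
    by (rule integrable_cong_AE_imp[where g="\<lambda>\<omega>. (F \<omega>)\<^sup>2"]) (use assms e in \<open>auto simp: L2_functional_def\<close>)
  show "integrable M (\<lambda>\<omega>. \<Phi> (\<lambda>h. W h \<omega>))"
    by (rule square_integrable_imp_integrable[OF _ sq]) simp
qed

text \<open>If \<open>Z = \<Phi> (W)\<close> satisfies \<open>L Z = 0\<close>, then rotating \<open>(W, W')\<close> by a small angle \<open>\<theta>\<close> changes \<open>\<Phi> (W)\<close>
  by \<open>o(\<theta>)\<close> in \<open>L\<^sup>2\<close>. As the law of \<open>(W, W')\<close> is rotation invariant, \<open>n\<close> such steps show that the quarter
  turn changes nothing: \<open>\<Phi> (W') = \<Phi> (W)\<close> with independent sides, hence \<open>Z\<close> is constant.\<close>

proposition neg_OU_inverse_unique: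
  assumes Y: "has_neg_OU_inverse M W F Y" and Y': "has_neg_OU_inverse M W F Y'"
  shows "AE \<omega> in M. Y \<omega> = Y' \<omega>"
proof -
  have L2: "L2_functional M W Y" "L2_functional M W Y'" and EY: "expectation Y = 0" "expectation Y' = 0"
    using Y Y' by (simp_all add: has_neg_OU_inverse_def has_OU_generator_def)
  define \<Phi>1 where "\<Phi>1 = (SOME \<Phi>. represents M W Y \<Phi>)"
  define \<Phi>2 where "\<Phi>2 = (SOME \<Phi>. represents M W Y' \<Phi>)"
  have r1: "represents M W Y \<Phi>1" and r2: "represents M W Y' \<Phi>2"
    unfolding \<Phi>1_def \<Phi>2_def
    using someI_ex[where P="represents M W Y"] someI_ex[where P="represents M W Y'"] L2
    unfolding L2_functional_def by blast+
  have [measurable]: "\<Phi>1 \<in> borel_measurable paths" "\<Phi>2 \<in> borel_measurable paths"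
    using r1 r2 by (simp_all add: represents_def)
  have [measurable]: "F \<in> borel_measurable M" "Y \<in> borel_measurable M" "Y' \<in> borel_measurable M"
    using Y L2 by (simp_all add: has_neg_OU_inverse_def L2_functional_def)
  note i1 = L2_functional_represented[OF L2(1) r1] and i2 = L2_functional_represented[OF L2(2) r2]
  define \<Phi> where "\<Phi> v = \<Phi>1 v - \<Phi>2 v" for v
  have [measurable]: "\<Phi> \<in> borel_measurable paths" unfolding \<Phi>_def[abs_def] by measurable
  let ?Z = "\<lambda>\<omega>. \<Phi> (\<lambda>h. W h \<omega>)"
  have ZY: "AE \<omega> in M. ?Z \<omega> = Y \<omega> - Y' \<omega>"
    using r1 r2 unfolding represents_def \<Phi>_def by auto
  have Zi: "integrable M ?Z" unfolding \<Phi>_def using i1 i2 by simp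
  have Z2: "integrable M (\<lambda>\<omega>. (?Z \<omega>)\<^sup>2)"
  proof (rule Bochner_Integration.integrable_bound)
    show "integrable M (\<lambda>\<omega>. 2 * (\<Phi>1 (\<lambda>h. W h \<omega>))\<^sup>2 + 2 * (\<Phi>2 (\<lambda>h. W h \<omega>))\<^sup>2)" using i1 i2 by simp
    have "(a - b)\<^sup>2 \<le> 2 * a\<^sup>2 + 2 * b\<^sup>2" for a b :: real
      using sum_squares_bound[of a "- b"] by (simp add: power2_diff)
    then show "AE \<omega> in M. norm ((?Z \<omega>)\<^sup>2) \<le> norm (2 * (\<Phi>1 (\<lambda>h. W h \<omega>))\<^sup>2 + 2 * (\<Phi>2 (\<lambda>h. W h \<omega>))\<^sup>2)"
      unfolding \<Phi>_def by (intro AE_I2) simp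
  qed measurable
  have EZ: "expectation ?Z = 0"
  proof -
    have "expectation (\<lambda>\<omega>. \<Phi>1 (\<lambda>h. W h \<omega>)) = expectation Y" "expectation (\<lambda>\<omega>. \<Phi>2 (\<lambda>h. W h \<omega>)) = expectation Y'"
      using r1 r2 by (auto intro!: integral_cong_AE simp: represents_def)
    then show ?thesis unfolding \<Phi>_def using i1 i2 EY by simp
  qed
  \<comment> \<open>n + 2 steps of this angle make a quarter turn; the 2 keeps the angle below pi /
    2 for n = 0 too, so that the cosine stays positive and its logarithm makes sense.\<close>
  define \<theta> where "\<theta> n = pi / (2 * (real n + 2))" for n :: nat
  define t where "t n = - ln (cos (\<theta> n))" for n
  have tlim: "filterlim t (at_right 0) sequentially" unfolding t_def \<theta>_def by real_asymp
  \<comment> \<open>- ln (cos \<theta>) behaves like \<theta>^2 / 2, whence the limit (pi / 2)^2 /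
    2. The factor N^2 of the chain estimate is thus balanced by the time t n, and any gain from L Z
    = 0 survives in the limit.\<close>
  have tN: "(\<lambda>n. (real n + 2)\<^sup>2 * t n) \<longlonglongrightarrow> pi * pi / 8" unfolding t_def \<theta>_def by real_asymp
  have \<theta>: "0 < \<theta> n" "\<theta> n < pi / 2" for n using pi_gt_zero by (auto simp: \<theta>_def field_simps intro!: add_pos_nonneg)
  have cos0: "0 < cos (\<theta> n)" "cos (\<theta> n) < 1" "0 < sin (\<theta> n)" for n
    using \<theta>[of n] cos_gt_zero[of "\<theta> n"] cos_monotone_0_pi[of 0 "\<theta> n"] sin_gt_zero[of "\<theta> n"] pi_gt_zero by auto
  have et: "exp (- t n) = cos (\<theta> n)" for n using cos0[of n] by (simp add: t_def)
  have st: "sqrt (1 - exp (- 2 * t n)) = sin (\<theta> n)" for n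
  proof -
    have "exp (- 2 * t n) = (cos (\<theta> n))\<^sup>2" unfolding et[symmetric] power2_eq_square exp_add[symmetric] by simp
    then have "1 - exp (- 2 * t n) = (sin (\<theta> n))\<^sup>2" by (simp add: sin_squared_eq)
    then show ?thesis using cos0[of n] by simp
  qed
  have t0: "0 < t n" for n using cos0[of n] by (simp add: t_def)
  let ?q = "\<lambda>n \<omega>. (mehler (t n) \<Phi> \<omega> - ?Z \<omega>) / t n"
  have L: "(\<lambda>n. \<integral>\<^sup>+\<omega>. ennreal ((norm (((OU_semigroup M W (t n) H \<omega> - H \<omega>) / t n - - F \<omega>)))\<^sup>2) \<partial>M) \<longlonglongrightarrow> 0"
    if "has_neg_OU_inverse M W F H" for H
  proof -
    have "((\<lambda>s. \<integral>\<^sup>+\<omega>. ennreal (((OU_semigroup M W s H \<omega> - H \<omega>) / s - - F \<omega>)\<^sup>2) \<partial>M) \<longlongrightarrow> 0) (at_right 0)"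
      using that by (simp add: has_neg_OU_inverse_def has_OU_generator_def)
    from filterlim_compose[OF this tlim] show ?thesis by simp
  qed
  have "(\<lambda>n. \<integral>\<^sup>+\<omega>. ennreal ((norm (((OU_semigroup M W (t n) Y \<omega> - Y \<omega>) / t n - - F \<omega>) -
      ((OU_semigroup M W (t n) Y' \<omega> - Y' \<omega>) / t n - - F \<omega>)))\<^sup>2) \<partial>M) \<longlonglongrightarrow> 0"
    by (rule nn_integral_norm_square_diff_tendsto_0[OF _ _ L[OF Y] L[OF Y']])
       (simp_all add: OU_semigroup_mehler \<Phi>1_def[symmetric] \<Phi>2_def[symmetric])
  moreover have "(\<integral>\<^sup>+\<omega>. ennreal ((norm (((OU_semigroup M W (t n) Y \<omega> - Y \<omega>) / t n - - F \<omega>) -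
      ((OU_semigroup M W (t n) Y' \<omega> - Y' \<omega>) / t n - - F \<omega>)))\<^sup>2) \<partial>M) = (\<integral>\<^sup>+\<omega>. ennreal ((norm (?q n \<omega>))\<^sup>2) \<partial>M)" for n
  proof (rule nn_integral_cong_AE)
    have "AE \<omega> in M. mehler (t n) \<Phi> \<omega> = mehler (t n) \<Phi>1 \<omega> - mehler (t n) \<Phi>2 \<omega>"
      unfolding \<Phi>_def by (rule mehler_diff) (use i1 i2 t0[of n] in auto)
    then show "AE \<omega> in M. ennreal ((norm (((OU_semigroup M W (t n) Y \<omega> - Y \<omega>) / t n - - F \<omega>) -
      ((OU_semigroup M W (t n) Y' \<omega> - Y' \<omega>) / t n - - F \<omega>)))\<^sup>2) = ennreal ((norm (?q n \<omega>))\<^sup>2)"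
      using ZY
    proof eventually_elim
      case (elim \<omega>)
      have "((OU_semigroup M W (t n) Y \<omega> - Y \<omega>) / t n - - F \<omega>) -
        ((OU_semigroup M W (t n) Y' \<omega> - Y' \<omega>) / t n - - F \<omega>) = ?q n \<omega>"
        unfolding elim OU_semigroup_mehler \<Phi>1_def[symmetric] \<Phi>2_def[symmetric]
        by (simp add: diff_divide_distrib)
      then show ?case by simp
    qed
  qed
  \<comment> \<open>The common limit - F has cancelled; this is L Z = 0 along the times t n.\<close>
  ultimately have q: "(\<lambda>n. \<integral>\<^sup>+\<omega>. ennreal ((norm (?q n \<omega>))\<^sup>2) \<partial>M) \<longlonglongrightarrow> 0" by simp
  have \<epsilon>: "(\<lambda>n. expectation (\<lambda>\<omega>. inner (?q n \<omega>) (?Z \<omega>))) \<longlonglongrightarrow> 0"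
    by (rule L2_inner_tendsto_0[OF _ _ q]) (use Z2 in simp_all)
  define D where "D = (\<integral>z. (\<Phi> (mix 0 1 z) - \<Phi> (mix 1 0 z))\<^sup>2 \<partial>(M \<Otimes>\<^sub>M M))"
  have "D \<le> ((real n + 2)\<^sup>2 * t n) * (- 2 * expectation (\<lambda>\<omega>. inner (?q n \<omega>) (?Z \<omega>)))" for n
  proof -
    have N: "real (n + 2) * \<theta> n = pi / 2" by (simp add: \<theta>_def field_simps)
    have "(\<integral>z. (\<Phi> (mix (cos (\<theta> n)) (sin (\<theta> n)) z) - \<Phi> (mix 1 0 z))\<^sup>2 \<partial>(M \<Otimes>\<^sub>M M)) =
        2 * expectation (\<lambda>\<omega>. (?Z \<omega> - mehler (t n) \<Phi> \<omega>) * ?Z \<omega>)"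
      using rotation_increment_mehler[OF _ Z2, of "t n"] t0[of n] unfolding et st by simp
    also have "(\<lambda>\<omega>. (?Z \<omega> - mehler (t n) \<Phi> \<omega>) * ?Z \<omega>) = (\<lambda>\<omega>. - t n * inner (?q n \<omega>) (?Z \<omega>))"
      using t0[of n] by (intro ext) (simp add: field_simps)
    also have "expectation \<dots> = - t n * expectation (\<lambda>\<omega>. inner (?q n \<omega>) (?Z \<omega>))" by simp
    finally have eq: "(\<integral>z. (\<Phi> (mix (cos (\<theta> n)) (sin (\<theta> n)) z) - \<Phi> (mix 1 0 z))\<^sup>2 \<partial>(M \<Otimes>\<^sub>M M)) =
        2 * (- t n * expectation (\<lambda>\<omega>. inner (?q n \<omega>) (?Z \<omega>)))" .
    have "D \<le> (real (n + 2))\<^sup>2 * (2 * (- t n * expectation (\<lambda>\<omega>. inner (?q n \<omega>) (?Z \<omega>))))"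
      unfolding D_def eq[symmetric]
      using rotation_chain_le[OF \<open>\<Phi> \<in> borel_measurable _\<close> Z2, of "n + 2" "\<theta> n"]
      unfolding N cos_pi_half sin_pi_half .
    also have "\<dots> = ((real n + 2)\<^sup>2 * t n) * (- 2 * expectation (\<lambda>\<omega>. inner (?q n \<omega>) (?Z \<omega>)))"
      by (simp only: of_nat_add of_nat_numeral mult_minus_left mult_minus_right mult.assoc mult.left_commute)
    finally show ?thesis .
  qed
  moreover have "(\<lambda>n. ((real n + 2)\<^sup>2 * t n) * (- 2 * expectation (\<lambda>\<omega>. inner (?q n \<omega>) (?Z \<omega>)))) \<longlonglongrightarrow> pi * pi / 8 * (- 2 * 0)"
    by (intro tendsto_mult tN \<epsilon> tendsto_const)
  ultimately have "D \<le> 0"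
    by (intro LIMSEQ_le_const[where X="\<lambda>n. ((real n + 2)\<^sup>2 * t n) * (- 2 * expectation (\<lambda>\<omega>. inner (?q n \<omega>) (?Z \<omega>)))"]) auto
  define P where "P z = \<Phi> (mix 0 1 z)" for z
  define Q where "Q z = \<Phi> (mix 1 0 z)" for z
  have [measurable]: "P \<in> borel_measurable (M \<Otimes>\<^sub>M M)" "Q \<in> borel_measurable (M \<Otimes>\<^sub>M M)"
    unfolding P_def[abs_def] Q_def[abs_def] by measurable
  have P2: "integrable (M \<Otimes>\<^sub>M M) (\<lambda>z. (P z)\<^sup>2)" "(\<integral>z. (P z)\<^sup>2 \<partial>(M \<Otimes>\<^sub>M M)) = expectation (\<lambda>\<omega>. (?Z \<omega>)\<^sup>2)"
    using mix_integral[of 0 1 "\<lambda>v. (\<Phi> v)\<^sup>2"] Z2 unfolding P_def by simp_all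
  have Q2: "integrable (M \<Otimes>\<^sub>M M) (\<lambda>z. (Q z)\<^sup>2)" "(\<integral>z. (Q z)\<^sup>2 \<partial>(M \<Otimes>\<^sub>M M)) = expectation (\<lambda>\<omega>. (?Z \<omega>)\<^sup>2)"
    using mix_integral[of 1 0 "\<lambda>v. (\<Phi> v)\<^sup>2"] Z2 unfolding Q_def by simp_all
  have prod: "integrable (M \<Otimes>\<^sub>M M) (\<lambda>z. P z * Q z)"
    using square_integrable_inner[of P "M \<Otimes>\<^sub>M M" Q] P2 Q2 by simp
  \<comment> \<open>\<open>P\<close> depends only on the second copy and \<open>Q\<close> only on
    the first, so the inner integral contains the factor E Z = 0. Hence the quarter turn moves Z by
    twice E Z^2 in mean square.\<close>
  have sec: "(\<lambda>\<omega>. \<integral>\<omega>'. P (\<omega>, \<omega>') * Q (\<omega>, \<omega>') \<partial>M) = (\<lambda>\<omega>. 0)"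
    using EZ by (intro ext) (simp add: P_def Q_def)
  have p0: "(\<integral>z. P z * Q z \<partial>(M \<Otimes>\<^sub>M M)) = 0"
    using MM.integral_fst'[OF prod] unfolding sec by simp
  have "D = (\<integral>z. (P z)\<^sup>2 + (Q z)\<^sup>2 - 2 * (P z * Q z) \<partial>(M \<Otimes>\<^sub>M M))"
    unfolding D_def P_def[symmetric] Q_def[symmetric] by (simp add: power2_diff mult.assoc)
  also have "\<dots> = 2 * expectation (\<lambda>\<omega>. (?Z \<omega>)\<^sup>2)"
    using P2 Q2 prod p0 by simp
  finally have "expectation (\<lambda>\<omega>. (?Z \<omega>)\<^sup>2) \<le> 0" using \<open>D \<le> 0\<close> by simp
  then have "expectation (\<lambda>\<omega>. (?Z \<omega>)\<^sup>2) = 0"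
    by (rule antisym) simp
  then have "AE \<omega> in M. (?Z \<omega>)\<^sup>2 = 0"
    using Z2 by (subst (asm) integral_nonneg_eq_0_iff_AE) simp_all
  then show ?thesis using ZY by eventually_elim simp
qed

end

section \<open>Inverting the generator on radial functionals\<close>

lemma has_real_derivative_Re:
  fixes G :: "complex \<Rightarrow> complex"
  assumes "(G has_field_derivative G') (at (of_real r))"
  shows "((\<lambda>r. Re (G (of_real r))) has_real_derivative Re G') (at r)"
  unfolding has_real_derivative_iff_has_vector_derivative
  by (rule bounded_linear.has_vector_derivative[OF bounded_linear_Re has_vector_derivative_real_field[OF assms]])

text \<open>In terms of \<open>u = exp (- r / 2)\<close> and \<open>F u = \<phi> r\<close>, the equations say that \<open>\<phi>\<close> inverts \<open>-L\<close>:
  the radial part of \<open>L\<close> is \<open>F \<mapsto> - (2 u\<^sup>2 ln u F')'\<close>, and the antiderivative of \<open>cos (\<tau> u) - sin \<tau> / \<tau>\<close>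
  vanishes both at \<open>u = 0\<close> and at \<open>u = 1\<close>, which makes the singularity at \<open>r = 0\<close> removable.\<close>

lemma radial_poisson_solution:
  fixes \<tau> :: real
  assumes \<tau>: "0 < \<tau>"
  obtains \<phi> q q' :: "real \<Rightarrow> real" where
    "\<And>r. (\<phi> has_real_derivative q r) (at r)" "\<And>r. (q has_real_derivative q' r) (at r)" "\<And>r. isCont q' r"
    "\<phi> 0 = 0" "(q \<longlongrightarrow> 0) at_top"
    "\<And>r. 2 * \<tau> * exp (- r / 2) * r * q r = sin (\<tau> * exp (- r / 2)) - exp (- r / 2) * sin \<tau>"
    "\<And>r. 4 * r * q' r + (4 - 2 * r) * q r = - (cos (\<tau> * exp (- r / 2)) - sin \<tau> / \<tau>)"
proof -
  \<comment> \<open>K is the complex extension of \<open>m\<close> below. It is entire with K 0 = 0,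
    so K z / z extends to an entire function; this supplies q, its derivatives and a primitive
    across r = 0 without any expansion at the singularity.\<close>
  define K :: "complex \<Rightarrow> complex" where "K z = exp (z / 2) * sin (of_real \<tau> * exp (- z / 2)) - sin (of_real \<tau>)" for z
  define G where "G z = (if z = 0 then deriv K 0 else (K z - K 0) / (z - 0))" for z
  have K0: "K 0 = 0" by (simp add: K_def)
  have "K holomorphic_on UNIV" unfolding K_def by (intro holomorphic_intros) auto
  then have hG: "G holomorphic_on UNIV" unfolding G_def by (rule pole_lemma_open) simp
  have zG: "z * G z = K z" for z by (simp add: G_def K0)
  have dG: "(G has_field_derivative deriv G z) (at z)" for z
    using hG by (rule holomorphic_derivI) auto
  have hG': "deriv G holomorphic_on UNIV" using hG by (rule holomorphic_deriv) simp
  then have dG': "(deriv G has_field_derivative deriv (deriv G) z) (at z)" for z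
    by (rule holomorphic_derivI) auto
  obtain P where dP: "\<And>z. (P has_field_derivative G z) (at z)"
    using holomorphic_convex_primitive'[of UNIV G] hG by auto
  \<comment> \<open>Normalised at 0, so that a bound on q gives |\<phi> r| \<le> C r for r \<ge>
    0.\<close>
  define \<phi> where "\<phi> r = Re (P (of_real r)) / (2 * \<tau>) - Re (P 0) / (2 * \<tau>)" for r
  define q where "q r = Re (G (of_real r)) / (2 * \<tau>)" for r
  define q' where "q' r = Re (deriv G (of_real r)) / (2 * \<tau>)" for r
  define m where "m r = exp (r / 2) * sin (\<tau> * exp (- r / 2)) - sin \<tau>" for r
  have Km: "K (of_real r) = of_real (m r)" for r
    by (simp add: K_def m_def exp_of_real[symmetric] sin_of_real[symmetric])
  have rq: "2 * \<tau> * (r * q r) = m r" for r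
  proof -
    have "Re (of_real r * G (of_real r)) = m r" unfolding zG Km by simp
    then show ?thesis using \<tau> by (simp add: q_def)
  qed
  have 1: "(\<phi> has_real_derivative q r) (at r)" for r
    unfolding \<phi>_def q_def
    by (rule DERIV_cong[OF DERIV_diff[OF DERIV_cdivide[OF has_real_derivative_Re[OF dP]] DERIV_const]]) simp
  have 2: "(q has_real_derivative q' r) (at r)" for r
    unfolding q_def q'_def by (rule DERIV_cdivide[OF has_real_derivative_Re[OF dG]])
  have 3: "isCont q' r" for r
    unfolding q'_def by (rule DERIV_isCont[OF DERIV_cdivide[OF has_real_derivative_Re[OF dG']]])
  have 4: "\<phi> 0 = 0" by (simp add: \<phi>_def)
  have ee: "exp (r / 2) * exp (- r / 2) = 1" for r :: real by (simp add: exp_add[symmetric])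
  \<comment> \<open>The growth of exp (r / 2) is absorbed by |sin y| \<le> |y|. A bounded
    \<open>m\<close> forces q to decay like 1 / r.\<close>
  have mb: "\<bar>m r\<bar> \<le> 2 * \<tau>" for r
  proof -
    have "\<bar>exp (r / 2) * sin (\<tau> * exp (- r / 2))\<bar> \<le> exp (r / 2) * (\<tau> * exp (- r / 2))"
      using abs_sin_x_le_abs_x[of "\<tau> * exp (- r / 2)"] \<tau> by (simp add: abs_mult)
    also have "\<dots> = \<tau>" using ee[of r] by (simp add: mult.left_commute)
    finally show ?thesis unfolding m_def
      using abs_sin_x_le_abs_x[of \<tau>] \<tau> abs_triangle_ineq4[of "exp (r / 2) * sin (\<tau> * exp (- r / 2))" "sin \<tau>"] by linarith
  qed
  have 5: "(q \<longlongrightarrow> 0) at_top"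
  proof (rule Lim_null_comparison)
    show "\<forall>\<^sub>F r in at_top. norm (q r) \<le> 1 / r"
      using eventually_gt_at_top[of 0]
    proof eventually_elim
      case (elim r)
      have "2 * \<tau> * (r * \<bar>q r\<bar>) = \<bar>m r\<bar>" using rq[of r] elim \<tau> by (metis abs_mult abs_of_pos abs_numeral)
      then have "2 * \<tau> * (r * \<bar>q r\<bar>) \<le> 2 * \<tau> * 1" using mb[of r] by simp
      then have "r * \<bar>q r\<bar> \<le> 1" using \<tau> by (simp add: mult_le_cancel_left_pos)
      then show ?case using elim by (simp add: field_simps)
    qed
    show "((\<lambda>r::real. 1 / r) \<longlongrightarrow> 0) at_top" by real_asymp
  qed
  have 6: "2 * \<tau> * exp (- r / 2) * r * q r = sin (\<tau> * exp (- r / 2)) - exp (- r / 2) * sin \<tau>" for r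
  proof -
    have "2 * \<tau> * exp (- r / 2) * r * q r = exp (- r / 2) * m r" unfolding rq[symmetric] by simp
    also have "\<dots> = (exp (r / 2) * exp (- r / 2)) * sin (\<tau> * exp (- r / 2)) - exp (- r / 2) * sin \<tau>"
      by (simp add: m_def algebra_simps)
    finally show ?thesis unfolding ee by simp
  qed
  have 7: "4 * r * q' r + (4 - 2 * r) * q r = - (cos (\<tau> * exp (- r / 2)) - sin \<tau> / \<tau>)" for r
  proof -
    \<comment> \<open>The equation results from differentiating 2 \<tau> r q = m in two ways and
      eliminating s = m + sin \<tau>.\<close>
    define c where "c = cos (\<tau> * exp (- r / 2))"
    define s where "s = exp (r / 2) * sin (\<tau> * exp (- r / 2))"
    have "(m has_real_derivative s / 2 - (exp (r / 2) * exp (- r / 2)) * (\<tau> / 2 * c)) (at r)"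
      unfolding m_def s_def c_def by (auto intro!: derivative_eq_intros)
    then have "(m has_real_derivative s / 2 - \<tau> / 2 * c) (at r)" unfolding ee by simp
    moreover have "((\<lambda>r. 2 * \<tau> * (r * q r)) has_real_derivative 2 * \<tau> * (q r + r * q' r)) (at r)"
      by (rule DERIV_cong[OF DERIV_cmult[OF DERIV_mult[OF DERIV_ident 2]]]) simp
    then have "(m has_real_derivative 2 * \<tau> * (q r + r * q' r)) (at r)" unfolding rq .
    ultimately have "2 * \<tau> * (q r + r * q' r) = s / 2 - \<tau> / 2 * c" by (rule DERIV_unique[rotated])
    moreover have "s = 2 * \<tau> * (r * q r) + sin \<tau>" unfolding rq by (simp add: m_def s_def)
    ultimately have "\<tau> * (4 * r * q' r + (4 - 2 * r) * q r) = - (\<tau> * c - sin \<tau>)" by (simp add: algebra_simps)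
    then show ?thesis using \<tau> unfolding c_def[symmetric] by (simp add: field_simps)
  qed
  show thesis by (rule that[OF 1 2 3 4 5 6 7])
qed

lemma abs_integral_le:
  fixes u v :: "'b \<Rightarrow> real"
  assumes "integrable N u" "integrable N v" "\<And>z. z \<in> space N \<Longrightarrow> \<bar>u z\<bar> \<le> v z"
  shows "\<bar>\<integral>z. u z \<partial>N\<bar> \<le> (\<integral>z. v z \<partial>N)"
  using integral_abs_bound[of N u] integral_mono[OF integrable_abs[OF assms(1)] assms(2,3)] by linarith

section \<open>Radial functionals along the rotation\<close>

context isonormal_gaussian_process
begin

context
  fixes f g :: 'h and \<phi> q q' x :: "real \<Rightarrow> real" and C K :: real
  assumes orthonormal: "inner f f = 1" "inner g g = 1" "inner f g = 0"
    and d\<phi>: "\<And>r. (\<phi> has_real_derivative q r) (at r)" and \<phi>0: "\<phi> 0 = 0"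
    and dq: "\<And>r. (q has_real_derivative q' r) (at r)" and cq': "\<And>r. isCont q' r"
    and bq: "\<And>r. 0 \<le> r \<Longrightarrow> \<bar>q r\<bar> \<le> C" and bx: "\<And>r. \<bar>x r\<bar> \<le> C"
    and ode: "\<And>r. 4 * r * q' r + (4 - 2 * r) * q r = - x r"
    and lip: "\<And>a b c d. \<bar>x (a\<^sup>2 + b\<^sup>2) - x (c\<^sup>2 + d\<^sup>2)\<bar> \<le> K * (\<bar>a - c\<bar> + \<bar>b - d\<bar>)"
begin

lemma radial_measurable: "\<phi> \<in> borel_measurable borel" "q \<in> borel_measurable borel"
    "q' \<in> borel_measurable borel" "x \<in> borel_measurable borel"
proof -
  show 1 [measurable]: "\<phi> \<in> borel_measurable borel" "q \<in> borel_measurable borel" "q' \<in> borel_measurable borel"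
    by (auto intro!: borel_measurable_continuous_onI continuous_at_imp_continuous_on cq' DERIV_isCont[OF d\<phi>] DERIV_isCont[OF dq])
  have "x = (\<lambda>r. - (4 * r * q' r + (4 - 2 * r) * q r))" by (simp add: ode)
  also have "\<dots> \<in> borel_measurable borel" by measurable
  finally show "x \<in> borel_measurable borel" .
qed

text \<open>The hypotheses bound q and x but not q'. The product R q' (R) is read off the
  differential equation, and A^2 \<le> R passes its moments on to A^2 q' (R). For \<phi>, the
  normalisation at 0 and the bound on q give |\<phi> R| \<le> C R.\<close>

lemma radial_all_moments:
  assumes A: "all_moments M A" and B: "all_moments M B"
  shows "all_moments M (\<lambda>\<omega>. q ((A \<omega>)\<^sup>2 + (B \<omega>)\<^sup>2))"
    and "all_moments M (\<lambda>\<omega>. x ((A \<omega>)\<^sup>2 + (B \<omega>)\<^sup>2))"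
    and "all_moments M (\<lambda>\<omega>. (A \<omega>)\<^sup>2 * q' ((A \<omega>)\<^sup>2 + (B \<omega>)\<^sup>2))"
    and "all_moments M (\<lambda>\<omega>. \<phi> ((A \<omega>)\<^sup>2 + (B \<omega>)\<^sup>2))"
proof -
  note [measurable] = radial_measurable all_moments_measurable[OF A] all_moments_measurable[OF B]
  let ?R = "\<lambda>\<omega>. (A \<omega>)\<^sup>2 + (B \<omega>)\<^sup>2"
  have R: "all_moments M ?R" by (rule all_moments_add[OF all_moments_power[OF A] all_moments_power[OF B]])
  show 1: "all_moments M (\<lambda>\<omega>. q (?R \<omega>))"
    by (rule all_moments_bounded[where C=C]) (auto intro: bq)
  show 2: "all_moments M (\<lambda>\<omega>. x (?R \<omega>))"
    by (rule all_moments_bounded[where C=C]) (auto intro: bx)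
  have "all_moments M (\<lambda>\<omega>. (- x (?R \<omega>) - (4 - 2 * ?R \<omega>) * q (?R \<omega>)) * (1 / 4))"
    by (rule all_moments_mult[OF all_moments_diff[OF all_moments_uminus[OF 2] all_moments_mult[OF
        all_moments_diff[OF all_moments_const all_moments_mult[OF all_moments_const R]] 1]] all_moments_const])
  then show "all_moments M (\<lambda>\<omega>. (A \<omega>)\<^sup>2 * q' (?R \<omega>))"
  proof (rule all_moments_bound)
    fix \<omega>
    have "(- x (?R \<omega>) - (4 - 2 * ?R \<omega>) * q (?R \<omega>)) * (1 / 4) = ?R \<omega> * q' (?R \<omega>)"
      unfolding ode[symmetric] by simp
    moreover have "\<bar>(A \<omega>)\<^sup>2 * q' (?R \<omega>)\<bar> \<le> \<bar>?R \<omega> * q' (?R \<omega>)\<bar>"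
      unfolding abs_mult by (intro mult_right_mono) simp_all
    ultimately show "\<bar>(A \<omega>)\<^sup>2 * q' (?R \<omega>)\<bar> \<le> \<bar>(- x (?R \<omega>) - (4 - 2 * ?R \<omega>) * q (?R \<omega>)) * (1 / 4)\<bar>" by simp
  qed measurable
  show "all_moments M (\<lambda>\<omega>. \<phi> (?R \<omega>))"
  proof (rule all_moments_bound[OF all_moments_mult[OF all_moments_const[of C] R]])
    fix \<omega>
    have "norm (\<phi> (?R \<omega>) - \<phi> 0) \<le> C * norm (?R \<omega> - 0)"
    proof (rule field_differentiable_bound[where S="{0..}"])
      show "(\<phi> has_real_derivative q z) (at z within {0..})" for z
        by (rule has_field_derivative_at_within[OF d\<phi>])
      show "norm (q z) \<le> C" if "z \<in> {0..}" for z using bq[of z] that by simp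
    qed auto
    then show "\<bar>\<phi> (?R \<omega>)\<bar> \<le> \<bar>C * ?R \<omega>\<bar>" using \<phi>0 bq[of 0] by (simp add: abs_mult)
  qed measurable
qed

text \<open>As e' is orthogonal to e, a shift along e moves only the first coordinate, at speed
  \<open>s\<close>; the right-hand side is the resulting derivative of 2 q A.\<close>

lemma radial_stein:
  assumes "inner e e = 1" "inner e' e = 0"
  shows "expectation (\<lambda>\<omega>. W e \<omega> * (2 * q ((\<alpha> + s * W e \<omega>)\<^sup>2 + (\<beta> + s * W e' \<omega>)\<^sup>2) * (\<alpha> + s * W e \<omega>))) =
    s * expectation (\<lambda>\<omega>. 2 * q ((\<alpha> + s * W e \<omega>)\<^sup>2 + (\<beta> + s * W e' \<omega>)\<^sup>2) +
      4 * ((\<alpha> + s * W e \<omega>)\<^sup>2 * q' ((\<alpha> + s * W e \<omega>)\<^sup>2 + (\<beta> + s * W e' \<omega>)\<^sup>2)))"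
proof -
  note [measurable] = radial_measurable
  define A where "A v = \<alpha> + s * v e" for v :: "'h \<Rightarrow> real"
  define B where "B v = \<beta> + s * v e'" for v :: "'h \<Rightarrow> real"
  define \<Theta> where "\<Theta> v = 2 * q ((A v)\<^sup>2 + (B v)\<^sup>2) * A v" for v
  define \<Theta>' where "\<Theta>' v = s * (2 * q ((A v)\<^sup>2 + (B v)\<^sup>2) + 4 * ((A v)\<^sup>2 * q' ((A v)\<^sup>2 + (B v)\<^sup>2)))" for v
  have [measurable]: "A \<in> borel_measurable paths" "B \<in> borel_measurable paths"
    unfolding A_def[abs_def] B_def[abs_def] by measurable
  have Am: "all_moments M (\<lambda>\<omega>. A (\<lambda>h. W h \<omega>))" "all_moments M (\<lambda>\<omega>. B (\<lambda>h. W h \<omega>))"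
    unfolding A_def B_def by (rule all_moments_add[OF all_moments_const all_moments_mult[OF all_moments_const W_all_moments]])+
  note am = radial_all_moments[OF Am]
  have Al: "A (\<lambda>h. v h + t * inner h e) = A v + s * t" "B (\<lambda>h. v h + t * inner h e) = B v" for v t
    using assms by (simp_all add: A_def B_def algebra_simps)
  have "expectation (\<lambda>\<omega>. W e \<omega> * \<Theta> (\<lambda>h. W h \<omega>)) = expectation (\<lambda>\<omega>. \<Theta>' (\<lambda>h. W h \<omega>))"
  proof (rule gaussian_integration_by_parts)
    show "\<Theta> \<in> borel_measurable paths" "\<Theta>' \<in> borel_measurable paths"
      unfolding \<Theta>_def[abs_def] \<Theta>'_def[abs_def] by measurable
    show "integrable M (\<lambda>\<omega>. W e \<omega> * \<Theta> (\<lambda>h. W h \<omega>))"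
      unfolding \<Theta>_def
      by (rule all_moments_integrable[OF all_moments_mult[OF W_all_moments all_moments_mult[OF
          all_moments_mult[OF all_moments_const am(1)] Am(1)]]])
    show "integrable M (\<lambda>\<omega>. \<Theta>' (\<lambda>h. W h \<omega>))"
      unfolding \<Theta>'_def
      by (rule all_moments_integrable[OF all_moments_mult[OF all_moments_const all_moments_add[OF
          all_moments_mult[OF all_moments_const am(1)] all_moments_mult[OF all_moments_const am(3)]]]])
    fix v :: "'h \<Rightarrow> real" and t :: real
    let ?a = "\<lambda>t. A v + s * t"
    let ?R = "\<lambda>t. (?a t)\<^sup>2 + (B v)\<^sup>2"
    have dR: "(?R has_real_derivative 2 * ?a t * s) (at t)" for t
      by (auto intro!: derivative_eq_intros)
    have dqR: "((\<lambda>t. q (?R t)) has_real_derivative q' (?R t) * (2 * ?a t * s)) (at t)" for t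
      by (rule DERIV_chain2[OF dq dR])
    have da: "(?a has_real_derivative s) (at t)" for t by (auto intro!: derivative_eq_intros)
    show "((\<lambda>t. \<Theta> (\<lambda>h. v h + t * inner h e)) has_real_derivative \<Theta>' (\<lambda>h. v h + t * inner h e)) (at t)"
      unfolding \<Theta>_def \<Theta>'_def Al
      by (rule DERIV_cong[OF DERIV_mult[OF DERIV_cmult[OF dqR] da]]) (simp add: power2_eq_square algebra_simps)
    show "isCont (\<lambda>t. \<Theta>' (\<lambda>h. v h + t * inner h e)) t"
      unfolding \<Theta>'_def Al
      by (intro continuous_intros DERIV_isCont[OF dqR] isCont_o2[OF DERIV_isCont[OF dR] cq'])
  qed
  then show ?thesis
    unfolding \<Theta>_def \<Theta>'_def A_def B_def by simp
qed

text \<open>A' and B' are the derivatives of A and B in the angle, so the left expectation is that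
  of the derivative of \<phi> along the rotation. From cos \<tau> A' = W f - sin \<tau> A, and
  likewise for g, integration by parts on the Gaussian factors produces sin \<tau> times the
  differential expression in the equation. The factor cos \<tau> is not divided out, so that the
  quarter turn stays included.\<close>

lemma radial_rotation_derivative:
  fixes a b \<tau> :: real
  defines "A \<equiv> \<lambda>\<omega>. cos \<tau> * a + sin \<tau> * W f \<omega>" and "B \<equiv> \<lambda>\<omega>. cos \<tau> * b + sin \<tau> * W g \<omega>"
    and "A' \<equiv> \<lambda>\<omega>. cos \<tau> * W f \<omega> - sin \<tau> * a" and "B' \<equiv> \<lambda>\<omega>. cos \<tau> * W g \<omega> - sin \<tau> * b"
  shows "cos \<tau> * expectation (\<lambda>\<omega>. q ((A \<omega>)\<^sup>2 + (B \<omega>)\<^sup>2) * (2 * (A \<omega> * A' \<omega> + B \<omega> * B' \<omega>))) =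
    - sin \<tau> * expectation (\<lambda>\<omega>. x ((A \<omega>)\<^sup>2 + (B \<omega>)\<^sup>2))"
proof -
  have Am: "all_moments M A" "all_moments M B"
    unfolding A_def B_def by (rule all_moments_add[OF all_moments_const all_moments_mult[OF all_moments_const W_all_moments]])+
  have Am': "all_moments M A'" "all_moments M B'"
    unfolding A'_def B'_def by (rule all_moments_diff[OF all_moments_mult[OF all_moments_const W_all_moments] all_moments_const])+
  note am = radial_all_moments[OF Am] and am' = radial_all_moments[OF Am(2) Am(1)]
  let ?R = "\<lambda>\<omega>. (A \<omega>)\<^sup>2 + (B \<omega>)\<^sup>2"
  let ?H = "\<lambda>\<omega>. q (?R \<omega>) * (2 * (A \<omega> * A' \<omega> + B \<omega> * B' \<omega>))"
  have sf: "expectation (\<lambda>\<omega>. W f \<omega> * (2 * q (?R \<omega>) * A \<omega>)) = sin \<tau> * expectation (\<lambda>\<omega>. 2 * q (?R \<omega>) + 4 * ((A \<omega>)\<^sup>2 * q' (?R \<omega>)))"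
    unfolding A_def B_def by (rule radial_stein) (use orthonormal in \<open>simp_all add: inner_commute\<close>)
  have "expectation (\<lambda>\<omega>. W g \<omega> * (2 * q ((B \<omega>)\<^sup>2 + (A \<omega>)\<^sup>2) * B \<omega>)) = sin \<tau> * expectation (\<lambda>\<omega>. 2 * q ((B \<omega>)\<^sup>2 + (A \<omega>)\<^sup>2) + 4 * ((B \<omega>)\<^sup>2 * q' ((B \<omega>)\<^sup>2 + (A \<omega>)\<^sup>2)))"
    unfolding A_def B_def by (rule radial_stein) (use orthonormal in \<open>simp_all add: inner_commute\<close>)
  then have sg: "expectation (\<lambda>\<omega>. W g \<omega> * (2 * q (?R \<omega>) * B \<omega>)) = sin \<tau> * expectation (\<lambda>\<omega>. 2 * q (?R \<omega>) + 4 * ((B \<omega>)\<^sup>2 * q' (?R \<omega>)))"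
    by (simp only: add.commute[of "(B _)\<^sup>2"])
  have iH: "integrable M ?H"
    by (rule all_moments_integrable[OF all_moments_mult[OF am(1) all_moments_mult[OF all_moments_const
        all_moments_add[OF all_moments_mult[OF Am(1) Am'(1)] all_moments_mult[OF Am(2) Am'(2)]]]]])
  have if': "integrable M (\<lambda>\<omega>. W f \<omega> * (2 * q (?R \<omega>) * A \<omega>))"
    by (rule all_moments_integrable[OF all_moments_mult[OF W_all_moments all_moments_mult[OF all_moments_mult[OF all_moments_const am(1)] Am(1)]]])
  have ig: "integrable M (\<lambda>\<omega>. W g \<omega> * (2 * q (?R \<omega>) * B \<omega>))"
    by (rule all_moments_integrable[OF all_moments_mult[OF W_all_moments all_moments_mult[OF all_moments_mult[OF all_moments_const am(1)] Am(2)]]])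
  have iA: "integrable M (\<lambda>\<omega>. 2 * q (?R \<omega>) + 4 * ((A \<omega>)\<^sup>2 * q' (?R \<omega>)))"
    by (rule all_moments_integrable[OF all_moments_add[OF all_moments_mult[OF all_moments_const am(1)] all_moments_mult[OF all_moments_const am(3)]]])
  have iB: "integrable M (\<lambda>\<omega>. 2 * q (?R \<omega>) + 4 * ((B \<omega>)\<^sup>2 * q' (?R \<omega>)))"
    using all_moments_integrable[OF all_moments_add[OF all_moments_mult[OF all_moments_const[of 2] am'(1)] all_moments_mult[OF all_moments_const[of 4] am'(3)]]]
    by (simp only: add.commute[of "(B _)\<^sup>2"])
  have iR: "integrable M (\<lambda>\<omega>. sin \<tau> * (2 * q (?R \<omega>) * ?R \<omega>))"
    by (rule all_moments_integrable[OF all_moments_mult[OF all_moments_const all_moments_mult[OF all_moments_mult[OF all_moments_const am(1)]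
        all_moments_add[OF all_moments_power[OF Am(1)] all_moments_power[OF Am(2)]]]]])
  have W': "W f \<omega> = sin \<tau> * A \<omega> + cos \<tau> * A' \<omega>" "W g \<omega> = sin \<tau> * B \<omega> + cos \<tau> * B' \<omega>" for \<omega>
  proof -
    have e: "w = sin \<tau> * (cos \<tau> * a + sin \<tau> * w) + cos \<tau> * (cos \<tau> * w - sin \<tau> * a)" for w a
    proof -
      have "sin \<tau> * (cos \<tau> * a + sin \<tau> * w) + cos \<tau> * (cos \<tau> * w - sin \<tau> * a) =
          (cos \<tau> * cos \<tau> + sin \<tau> * sin \<tau>) * w" by algebra
      then show ?thesis unfolding sin_cos_squared_add3 by simp
    qed
    show "W f \<omega> = sin \<tau> * A \<omega> + cos \<tau> * A' \<omega>" "W g \<omega> = sin \<tau> * B \<omega> + cos \<tau> * B' \<omega>"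
      unfolding A_def A'_def B_def B'_def by (rule e)+
  qed
  have pw: "cos \<tau> * ?H \<omega> = (W f \<omega> * (2 * q (?R \<omega>) * A \<omega>) + W g \<omega> * (2 * q (?R \<omega>) * B \<omega>)) - sin \<tau> * (2 * q (?R \<omega>) * ?R \<omega>)" for \<omega>
  proof -
    have alg: "c * (Q * (2 * (a * a' + b * b'))) = ((s * a + c * a') * (2 * Q * a) + (s * b + c * b') * (2 * Q * b)) - s * (2 * Q * (a\<^sup>2 + b\<^sup>2))"
      for c Q a a' b b' s :: real by (simp add: power2_eq_square algebra_simps)
    show ?thesis
      unfolding W'(1)[of \<omega>] W'(2)[of \<omega>] by (rule alg)
  qed
  have pw': "sin \<tau> * (2 * q (?R \<omega>) + 4 * ((A \<omega>)\<^sup>2 * q' (?R \<omega>))) + sin \<tau> * (2 * q (?R \<omega>) + 4 * ((B \<omega>)\<^sup>2 * q' (?R \<omega>)))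
      - sin \<tau> * (2 * q (?R \<omega>) * ?R \<omega>) = - sin \<tau> * x (?R \<omega>)" for \<omega>
  proof -
    have alg: "s * (2 * Q + 4 * (a * Q')) + s * (2 * Q + 4 * (b * Q')) - s * (2 * Q * (a + b)) = s * (4 * (a + b) * Q' + (4 - 2 * (a + b)) * Q)"
      for s Q Q' a b :: real by (simp add: algebra_simps)
    show ?thesis unfolding alg ode by simp
  qed
  have "cos \<tau> * expectation ?H = expectation (\<lambda>\<omega>. cos \<tau> * ?H \<omega>)" by simp
  also have "\<dots> = expectation (\<lambda>\<omega>. W f \<omega> * (2 * q (?R \<omega>) * A \<omega>)) + expectation (\<lambda>\<omega>. W g \<omega> * (2 * q (?R \<omega>) * B \<omega>))
      - expectation (\<lambda>\<omega>. sin \<tau> * (2 * q (?R \<omega>) * ?R \<omega>))"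
    unfolding pw
    by (simp only: Bochner_Integration.integral_diff[OF Bochner_Integration.integrable_add[OF if' ig] iR] Bochner_Integration.integral_add[OF if' ig])
  also have "\<dots> = expectation (\<lambda>\<omega>. sin \<tau> * (2 * q (?R \<omega>) + 4 * ((A \<omega>)\<^sup>2 * q' (?R \<omega>)))) +
      expectation (\<lambda>\<omega>. sin \<tau> * (2 * q (?R \<omega>) + 4 * ((B \<omega>)\<^sup>2 * q' (?R \<omega>)))) - expectation (\<lambda>\<omega>. sin \<tau> * (2 * q (?R \<omega>) * ?R \<omega>))"
    unfolding sf sg integral_mult_right_zero ..
  also have "\<dots> = expectation (\<lambda>\<omega>. - sin \<tau> * x (?R \<omega>))"
    unfolding pw'[symmetric]
    by (simp only: Bochner_Integration.integral_diff[OF Bochner_Integration.integrable_add[OF integrable_mult_right[OF iA] integrable_mult_right[OF iB]] iR]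
        Bochner_Integration.integral_add[OF integrable_mult_right[OF iA] integrable_mult_right[OF iB]])
  finally show ?thesis unfolding integral_mult_right_zero .
qed

text \<open>At the quarter turn the left side of the rotation formula vanishes together with the
  cosine, and the right side is the negative of this mean.\<close>

lemma radial_centered: "expectation (\<lambda>\<omega>. x (sq2 f g \<omega>)) = 0"
  using radial_rotation_derivative[of "pi / 2" 0 0] by simp

text \<open>Along the rotation the radial functional satisfies \<open>d/d\<tau> E \<phi> = tan \<tau> E (L \<phi>) = - tan \<tau> E x\<close>, and
  \<open>\<integral>\<^sub>0\<^sup>\<theta> tan \<tau> d\<tau> = - ln (cos \<theta>)\<close> is the Ornstein--Uhlenbeck time that belongs to the angle \<open>\<theta>\<close>.\<close>

lemma radial_increment_bound:
  assumes \<theta>: "0 < \<theta>" "\<theta> < pi / 2"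
  shows "\<bar>expectation (\<lambda>\<omega>. \<phi> ((cos \<theta> * a + sin \<theta> * W f \<omega>)\<^sup>2 + (cos \<theta> * b + sin \<theta> * W g \<omega>)\<^sup>2)) - \<phi> (a\<^sup>2 + b\<^sup>2)
      - ln (cos \<theta>) * x (a\<^sup>2 + b\<^sup>2)\<bar> \<le>
    - ln (cos \<theta>) * (K * \<theta> * (\<bar>a\<bar> + \<bar>b\<bar> + expectation (\<lambda>\<omega>. \<bar>W f \<omega>\<bar> + \<bar>W g \<omega>\<bar>)))"
proof -
  note [measurable] = radial_measurable
  define A where "A \<tau> \<omega> = cos \<tau> * a + sin \<tau> * W f \<omega>" for \<tau> \<omega>
  define B where "B \<tau> \<omega> = cos \<tau> * b + sin \<tau> * W g \<omega>" for \<tau> \<omega>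
  define A' where "A' \<tau> \<omega> = cos \<tau> * W f \<omega> - sin \<tau> * a" for \<tau> \<omega>
  define B' where "B' \<tau> \<omega> = cos \<tau> * W g \<omega> - sin \<tau> * b" for \<tau> \<omega>
  define H where "H \<tau> \<omega> = q ((A \<tau> \<omega>)\<^sup>2 + (B \<tau> \<omega>)\<^sup>2) * (2 * (A \<tau> \<omega> * A' \<tau> \<omega> + B \<tau> \<omega> * B' \<tau> \<omega>))" for \<tau> \<omega>
  \<comment> \<open>H is the derivative of the rotated functional in the angle. Differentiation
    under the expectation is avoided: the fundamental theorem is applied for each \<omega> and
    Fubini exchanges the integrals over [0, \<theta>] and the probability space.\<close>
  define F where "F z = H (fst z) (snd z) * indicator {0..\<theta>} (fst z)" for z
  define S where "S \<omega> = C * (2 * ((\<bar>a\<bar> + \<bar>W f \<omega>\<bar>)\<^sup>2 + (\<bar>b\<bar> + \<bar>W g \<omega>\<bar>)\<^sup>2))" for \<omega>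
  define m where "m = expectation (\<lambda>\<omega>. \<bar>W f \<omega>\<bar> + \<bar>W g \<omega>\<bar>)"
  let ?D = "K * \<theta> * (\<bar>a\<bar> + \<bar>b\<bar> + m)"
  interpret LM: pair_sigma_finite lborel M ..
  have C0: "0 \<le> C" using bq[of 0] by simp
  have Kn: "0 \<le> K" using lip[of 1 0 0 0] by simp
  have Am: "all_moments M (A \<tau>)" "all_moments M (B \<tau>)" for \<tau>
    unfolding A_def[abs_def] B_def[abs_def] by (rule all_moments_add[OF all_moments_const all_moments_mult[OF all_moments_const W_all_moments]])+
  have Am': "all_moments M (A' \<tau>)" "all_moments M (B' \<tau>)" for \<tau>
    unfolding A'_def[abs_def] B'_def[abs_def] by (rule all_moments_diff[OF all_moments_mult[OF all_moments_const W_all_moments] all_moments_const])+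
  have Hm: "all_moments M (H \<tau>)" for \<tau>
    unfolding H_def[abs_def]
    by (rule all_moments_mult[OF radial_all_moments(1)[OF Am] all_moments_mult[OF all_moments_const
        all_moments_add[OF all_moments_mult[OF Am(1) Am'(1)] all_moments_mult[OF Am(2) Am'(2)]]]])
  have Fm [measurable]: "F \<in> borel_measurable (lborel \<Otimes>\<^sub>M M)"
    unfolding F_def[abs_def] H_def A_def B_def A'_def B'_def by measurable
  have lin: "\<bar>cos \<tau> * u + sin \<tau> * w\<bar> \<le> \<bar>u\<bar> + \<bar>w\<bar>" "\<bar>cos \<tau> * w - sin \<tau> * u\<bar> \<le> \<bar>u\<bar> + \<bar>w\<bar>" for u w \<tau> :: real
  proof -
    have "\<bar>cos \<tau> * u\<bar> \<le> \<bar>u\<bar>" "\<bar>sin \<tau> * w\<bar> \<le> \<bar>w\<bar>" "\<bar>cos \<tau> * w\<bar> \<le> \<bar>w\<bar>" "\<bar>sin \<tau> * u\<bar> \<le> \<bar>u\<bar>"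
      unfolding abs_mult by (rule mult_left_le_one_le; simp)+
    then show "\<bar>cos \<tau> * u + sin \<tau> * w\<bar> \<le> \<bar>u\<bar> + \<bar>w\<bar>" "\<bar>cos \<tau> * w - sin \<tau> * u\<bar> \<le> \<bar>u\<bar> + \<bar>w\<bar>"
      by linarith+
  qed
  have HS: "\<bar>H \<tau> \<omega>\<bar> \<le> S \<omega>" for \<tau> \<omega>
  proof -
    have "\<bar>A \<tau> \<omega> * A' \<tau> \<omega>\<bar> \<le> (\<bar>a\<bar> + \<bar>W f \<omega>\<bar>)\<^sup>2" "\<bar>B \<tau> \<omega> * B' \<tau> \<omega>\<bar> \<le> (\<bar>b\<bar> + \<bar>W g \<omega>\<bar>)\<^sup>2"
      unfolding A_def A'_def B_def B'_def abs_mult power2_eq_square by (intro mult_mono lin; simp)+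
    moreover have "\<bar>2 * (p + r)\<bar> \<le> 2 * (s + t)" if "\<bar>p\<bar> \<le> s" "\<bar>r\<bar> \<le> t" for p r s t :: real
      using that abs_triangle_ineq[of p r] by (simp add: abs_mult)
    ultimately have "\<bar>2 * (A \<tau> \<omega> * A' \<tau> \<omega> + B \<tau> \<omega> * B' \<tau> \<omega>)\<bar> \<le> 2 * ((\<bar>a\<bar> + \<bar>W f \<omega>\<bar>)\<^sup>2 + (\<bar>b\<bar> + \<bar>W g \<omega>\<bar>)\<^sup>2)"
      by blast
    then show ?thesis unfolding H_def S_def abs_mult[of "q _"] by (intro mult_mono bq C0) simp_all
  qed
  have Si: "integrable M S"
    unfolding S_def
    by (rule all_moments_integrable[OF all_moments_mult[OF all_moments_const all_moments_mult[OF all_moments_const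
        all_moments_add[OF all_moments_power[OF all_moments_add[OF all_moments_const all_moments_abs[OF W_all_moments]]]
          all_moments_power[OF all_moments_add[OF all_moments_const all_moments_abs[OF W_all_moments]]]]]]])
  have Fi: "integrable (lborel \<Otimes>\<^sub>M M) F"
  proof (rule LM.Fubini_integrable[OF Fm])
    show "AE \<tau> in lborel. integrable M (\<lambda>\<omega>. F (\<tau>, \<omega>))"
      unfolding F_def using all_moments_integrable[OF Hm] by simp
    show "integrable lborel (\<lambda>\<tau>. \<integral>\<omega>. norm (F (\<tau>, \<omega>)) \<partial>M)"
    proof (rule Bochner_Integration.integrable_bound[where f="\<lambda>\<tau>. expectation S * indicator {0..\<theta>} \<tau>"])
      show "integrable lborel (\<lambda>\<tau>. expectation S * indicator {0..\<theta>} \<tau>)"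
        by (intro integrable_mult_right integrable_real_indicator) (simp_all add: emeasure_lborel_Icc_eq)
      show "(\<lambda>\<tau>. \<integral>\<omega>. norm (F (\<tau>, \<omega>)) \<partial>M) \<in> borel_measurable lborel" by measurable
      show "AE \<tau> in lborel. norm (\<integral>\<omega>. norm (F (\<tau>, \<omega>)) \<partial>M) \<le> norm (expectation S * indicator {0..\<theta>} \<tau>)"
      proof (rule AE_I2)
        fix \<tau>
        have "(\<integral>\<omega>. norm (F (\<tau>, \<omega>)) \<partial>M) \<le> (\<integral>\<omega>. S \<omega> * indicator {0..\<theta>} \<tau> \<partial>M)"
        proof (rule integral_mono)
          show "integrable M (\<lambda>\<omega>. norm (F (\<tau>, \<omega>)))"
            unfolding F_def using all_moments_integrable[OF Hm] by simp
          show "integrable M (\<lambda>\<omega>. S \<omega> * indicator {0..\<theta>} \<tau>)" using Si by simp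
          show "norm (F (\<tau>, \<omega>)) \<le> S \<omega> * indicator {0..\<theta>} \<tau>" for \<omega>
            using HS[of \<tau> \<omega>] by (simp add: F_def abs_mult mult_right_mono)
        qed
        also have "\<dots> = expectation S * indicator {0..\<theta>} \<tau>" by simp
        finally have "(\<integral>\<omega>. norm (F (\<tau>, \<omega>)) \<partial>M) \<le> expectation S * indicator {0..\<theta>} \<tau>" .
        moreover have "0 \<le> (\<integral>\<omega>. norm (F (\<tau>, \<omega>)) \<partial>M)" by (rule integral_nonneg_AE) simp
        ultimately show "norm (\<integral>\<omega>. norm (F (\<tau>, \<omega>)) \<partial>M) \<le> norm (expectation S * indicator {0..\<theta>} \<tau>)"
          by simp
      qed
    qed
  qed
  define G where "G \<tau> = expectation (H \<tau>) * indicator {0..\<theta>} \<tau>" for \<tau>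
  have GF: "G \<tau> = (\<integral>\<omega>. F (\<tau>, \<omega>) \<partial>M)" for \<tau> unfolding G_def F_def by simp
  have Gi: "integrable lborel G" unfolding GF by (rule LM.integrable_fst'[OF Fi])
  have inner: "(\<integral>\<tau>. F (\<tau>, \<omega>) \<partial>lborel) = \<phi> ((A \<theta> \<omega>)\<^sup>2 + (B \<theta> \<omega>)\<^sup>2) - \<phi> (a\<^sup>2 + b\<^sup>2)" for \<omega>
  proof -
    have dA: "((\<lambda>\<tau>. A \<tau> \<omega>) has_real_derivative A' \<tau> \<omega>) (at \<tau>)" "((\<lambda>\<tau>. B \<tau> \<omega>) has_real_derivative B' \<tau> \<omega>) (at \<tau>)" for \<tau>
      unfolding A_def A'_def B_def B'_def by (auto intro!: derivative_eq_intros)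
    have dA': "((\<lambda>\<tau>. A' \<tau> \<omega>) has_real_derivative - A \<tau> \<omega>) (at \<tau>)" "((\<lambda>\<tau>. B' \<tau> \<omega>) has_real_derivative - B \<tau> \<omega>) (at \<tau>)" for \<tau>
      unfolding A_def A'_def B_def B'_def by (auto intro!: derivative_eq_intros)
    have dR: "((\<lambda>\<tau>. (A \<tau> \<omega>)\<^sup>2 + (B \<tau> \<omega>)\<^sup>2) has_real_derivative 2 * (A \<tau> \<omega> * A' \<tau> \<omega> + B \<tau> \<omega> * B' \<tau> \<omega>)) (at \<tau>)" for \<tau>
      by (auto intro!: derivative_eq_intros dA)
    have "(\<integral>\<tau>. H \<tau> \<omega> * indicator {0..\<theta>} \<tau> \<partial>lborel) = \<phi> ((A \<theta> \<omega>)\<^sup>2 + (B \<theta> \<omega>)\<^sup>2) - \<phi> ((A 0 \<omega>)\<^sup>2 + (B 0 \<omega>)\<^sup>2)"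
    proof (rule integral_FTC_Icc_real)
      show "0 \<le> \<theta>" using \<theta> by simp
      show "((\<lambda>\<tau>. \<phi> ((A \<tau> \<omega>)\<^sup>2 + (B \<tau> \<omega>)\<^sup>2)) has_real_derivative H \<tau> \<omega>) (at \<tau>)" for \<tau>
        unfolding H_def by (rule DERIV_chain2[OF d\<phi> dR])
      show "isCont (\<lambda>\<tau>. H \<tau> \<omega>) \<tau>" for \<tau>
        unfolding H_def
        by (intro continuous_intros isCont_o2[OF DERIV_isCont[OF dR] DERIV_isCont[OF dq]]
            DERIV_isCont[OF dA(1)] DERIV_isCont[OF dA(2)] DERIV_isCont[OF dA'(1)] DERIV_isCont[OF dA'(2)])
    qed
    then show ?thesis by (simp add: F_def A_def B_def)
  qed
  have "(\<integral>\<tau>. G \<tau> \<partial>lborel) = expectation (\<lambda>\<omega>. \<phi> ((A \<theta> \<omega>)\<^sup>2 + (B \<theta> \<omega>)\<^sup>2) - \<phi> (a\<^sup>2 + b\<^sup>2))"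
    using LM.Fubini_integral[of "\<lambda>\<tau> \<omega>. F (\<tau>, \<omega>)"] Fi unfolding GF inner by simp
  also have "\<dots> = expectation (\<lambda>\<omega>. \<phi> ((A \<theta> \<omega>)\<^sup>2 + (B \<theta> \<omega>)\<^sup>2)) - \<phi> (a\<^sup>2 + b\<^sup>2)"
    using all_moments_integrable[OF radial_all_moments(4)[OF Am(1)[of \<theta>] Am(2)[of \<theta>]]] by (simp add: prob_space)
  finally have incr: "(\<integral>\<tau>. G \<tau> \<partial>lborel) = expectation (\<lambda>\<omega>. \<phi> ((A \<theta> \<omega>)\<^sup>2 + (B \<theta> \<omega>)\<^sup>2)) - \<phi> (a\<^sup>2 + b\<^sup>2)" .
  have cospos: "0 < cos \<tau>" if "\<tau> \<in> {0..\<theta>}" for \<tau>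
    using that \<theta> by (intro cos_gt_zero_pi) auto
  have T: "has_bochner_integral lborel (\<lambda>\<tau>. tan \<tau> * indicator {0..\<theta>} \<tau>) (- ln (cos \<theta>) - (- ln (cos 0)))"
  proof (rule has_bochner_integral_FTC_Icc_real)
    show "0 \<le> \<theta>" using \<theta> by simp
    fix \<tau> :: real assume "0 \<le> \<tau>" "\<tau> \<le> \<theta>"
    then have c: "0 < cos \<tau>" using cospos by simp
    show "((\<lambda>\<tau>. - ln (cos \<tau>)) has_real_derivative tan \<tau>) (at \<tau>)"
      using c by (auto intro!: derivative_eq_intros simp: tan_def)
    show "isCont tan \<tau>" using c by (intro isCont_tan) simp
  qed
  have Ti: "integrable lborel (\<lambda>\<tau>. tan \<tau> * indicator {0..\<theta>} \<tau>)" and Te: "(\<integral>\<tau>. tan \<tau> * indicator {0..\<theta>} \<tau> \<partial>lborel) = - ln (cos \<theta>)"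
    using T by (simp_all add: has_bochner_integral_iff)
  \<comment> \<open>By the rotation formula G is - tan \<tau> times the mean of x at the rotated
    point. Replacing this mean by the value at the starting point costs the Lipschitz error, which
    the small angle keeps of order \<theta>.\<close>
  have bound: "\<bar>G \<tau> + tan \<tau> * indicator {0..\<theta>} \<tau> * x (a\<^sup>2 + b\<^sup>2)\<bar> \<le> tan \<tau> * indicator {0..\<theta>} \<tau> * ?D" for \<tau>
  proof (cases "\<tau> \<in> {0..\<theta>}")
    case True
    let ?X = "\<lambda>\<omega>. x ((A \<tau> \<omega>)\<^sup>2 + (B \<tau> \<omega>)\<^sup>2)"
    have Xi: "integrable M ?X" by (rule all_moments_integrable[OF radial_all_moments(2)[OF Am]])
    have cs: "0 < cos \<tau>" by (rule cospos[OF True])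
    have tp: "0 \<le> tan \<tau>" using True \<theta> cs by (auto simp: tan_def intro!: divide_nonneg_pos sin_ge_zero)
    have "cos \<tau> * expectation (H \<tau>) = - sin \<tau> * expectation ?X"
      unfolding H_def A_def B_def A'_def B'_def by (rule radial_rotation_derivative)
    then have "expectation (H \<tau>) = - tan \<tau> * expectation ?X"
      using cs by (simp add: tan_def field_simps)
    then have e: "G \<tau> + tan \<tau> * indicator {0..\<theta>} \<tau> * x (a\<^sup>2 + b\<^sup>2) = tan \<tau> * (x (a\<^sup>2 + b\<^sup>2) - expectation ?X)"
      using True by (simp add: G_def algebra_simps)
    have "\<bar>x (a\<^sup>2 + b\<^sup>2) - expectation ?X\<bar> = \<bar>expectation (\<lambda>\<omega>. x (a\<^sup>2 + b\<^sup>2) - ?X \<omega>)\<bar>"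
      using Xi by (simp add: prob_space)
    also have "\<dots> \<le> expectation (\<lambda>\<omega>. (K * \<theta>) * (\<bar>a\<bar> + \<bar>b\<bar> + (\<bar>W f \<omega>\<bar> + \<bar>W g \<omega>\<bar>)))"
    proof (rule abs_integral_le)
      show "integrable M (\<lambda>\<omega>. x (a\<^sup>2 + b\<^sup>2) - ?X \<omega>)" using Xi by simp
      show "integrable M (\<lambda>\<omega>. (K * \<theta>) * (\<bar>a\<bar> + \<bar>b\<bar> + (\<bar>W f \<omega>\<bar> + \<bar>W g \<omega>\<bar>)))"
        using W_integrable by simp
      fix \<omega>
      have close: "\<bar>u - (cos \<tau> * u + sin \<tau> * w)\<bar> \<le> \<theta> * (\<bar>u\<bar> + \<bar>w\<bar>)" for u w :: real
      proof -
        \<comment> \<open>The linear bound on 1 - cos \<tau> is enough, since the sine term is of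
          first order as well.\<close>
        have "1 - cos \<tau> = 2 * (sin (\<tau> / 2))\<^sup>2" using cos_double_sin[of "\<tau> / 2"] by simp
        also have "\<dots> \<le> 2 * \<bar>sin (\<tau> / 2)\<bar>" using abs_sin_le_one[of "\<tau> / 2"]
          by (simp add: power2_eq_square abs_mult_self_eq[symmetric, of "sin (\<tau> / 2)"] mult_left_le_one_le del: abs_mult_self_eq)
        also have "\<dots> \<le> \<tau>" using abs_sin_x_le_abs_x[of "\<tau> / 2"] True by simp
        finally have "\<bar>1 - cos \<tau>\<bar> \<le> \<theta>" using True by (simp add: abs_le_iff)
        moreover have "\<bar>sin \<tau>\<bar> \<le> \<theta>" using abs_sin_x_le_abs_x[of \<tau>] True by simp
        ultimately have "\<bar>(1 - cos \<tau>) * u\<bar> \<le> \<theta> * \<bar>u\<bar>" "\<bar>sin \<tau> * w\<bar> \<le> \<theta> * \<bar>w\<bar>"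
          unfolding abs_mult by (simp_all only: mult_right_mono abs_ge_zero)
        moreover have "u - (cos \<tau> * u + sin \<tau> * w) = (1 - cos \<tau>) * u - sin \<tau> * w" by (simp add: algebra_simps)
        ultimately show ?thesis unfolding distrib_left by linarith
      qed
      have "\<bar>x (a\<^sup>2 + b\<^sup>2) - ?X \<omega>\<bar> \<le> K * (\<bar>a - A \<tau> \<omega>\<bar> + \<bar>b - B \<tau> \<omega>\<bar>)" by (rule lip)
      also have "\<dots> \<le> K * (\<theta> * (\<bar>a\<bar> + \<bar>W f \<omega>\<bar>) + \<theta> * (\<bar>b\<bar> + \<bar>W g \<omega>\<bar>))"
        unfolding A_def B_def by (intro mult_left_mono add_mono close Kn)
      also have "\<dots> = (K * \<theta>) * (\<bar>a\<bar> + \<bar>b\<bar> + (\<bar>W f \<omega>\<bar> + \<bar>W g \<omega>\<bar>))" by (simp add: algebra_simps)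
      finally show "\<bar>x (a\<^sup>2 + b\<^sup>2) - ?X \<omega>\<bar> \<le> (K * \<theta>) * (\<bar>a\<bar> + \<bar>b\<bar> + (\<bar>W f \<omega>\<bar> + \<bar>W g \<omega>\<bar>))" .
    qed
    also have "\<dots> = ?D" using W_integrable unfolding m_def by (simp add: prob_space)
    finally have "tan \<tau> * \<bar>x (a\<^sup>2 + b\<^sup>2) - expectation ?X\<bar> \<le> tan \<tau> * ?D" by (rule mult_left_mono[OF _ tp])
    then show ?thesis unfolding e using True tp by (simp add: abs_mult)
  qed (simp add: G_def)
  have "\<bar>\<integral>\<tau>. G \<tau> + tan \<tau> * indicator {0..\<theta>} \<tau> * x (a\<^sup>2 + b\<^sup>2) \<partial>lborel\<bar> \<le> (\<integral>\<tau>. tan \<tau> * indicator {0..\<theta>} \<tau> * ?D \<partial>lborel)"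
    by (rule abs_integral_le) (use Gi Ti bound in \<open>simp_all add: integrable_mult_left\<close>)
  also have "\<dots> = - ln (cos \<theta>) * ?D" unfolding integral_mult_left_zero Te ..
  also have "(\<integral>\<tau>. G \<tau> + tan \<tau> * indicator {0..\<theta>} \<tau> * x (a\<^sup>2 + b\<^sup>2) \<partial>lborel) =
      expectation (\<lambda>\<omega>. \<phi> ((A \<theta> \<omega>)\<^sup>2 + (B \<theta> \<omega>)\<^sup>2)) - \<phi> (a\<^sup>2 + b\<^sup>2) + - ln (cos \<theta>) * x (a\<^sup>2 + b\<^sup>2)"
    by (subst Bochner_Integration.integral_add[OF Gi integrable_mult_left[OF Ti]]) (simp only: incr integral_mult_left_zero Te)
  finally show ?thesis unfolding A_def B_def m_def by simp
qed

lemma L2_functional_radial: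
  fixes k :: "real \<Rightarrow> real"
  assumes k [measurable]: "k \<in> borel_measurable borel" and am: "all_moments M (\<lambda>\<omega>. k (sq2 f g \<omega>))"
  shows "represents M W (\<lambda>\<omega>. k (sq2 f g \<omega>)) (\<lambda>v. k ((v f)\<^sup>2 + (v g)\<^sup>2))"
    and "L2_functional M W (\<lambda>\<omega>. k (sq2 f g \<omega>))"
proof -
  show r: "represents M W (\<lambda>\<omega>. k (sq2 f g \<omega>)) (\<lambda>v. k ((v f)\<^sup>2 + (v g)\<^sup>2))"
    unfolding represents_def by simp
  show "L2_functional M W (\<lambda>\<omega>. k (sq2 f g \<omega>))"
    unfolding L2_functional_def
    using r all_moments_square_integrable[OF am] all_moments_measurable[OF am] by blast
qed

text \<open>At the angle arccos (exp (- t)) the factor - ln (cos \<theta>) equals t. Dividing the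
  increment bound by t leaves K \<theta> S with S square integrable, and \<theta> tends to 0 with t;
  this is convergence of the difference quotient in mean square.\<close>

proposition radial_neg_OU_inverse:
  "has_neg_OU_inverse M W (\<lambda>\<omega>. x (sq2 f g \<omega>)) (\<lambda>\<omega>. \<phi> (sq2 f g \<omega>) - expectation (\<lambda>\<omega>. \<phi> (sq2 f g \<omega>)))"
proof -
  note [measurable] = radial_measurable
  define c where "c = expectation (\<lambda>\<omega>. \<phi> (sq2 f g \<omega>))"
  define Y where "Y \<omega> = \<phi> (sq2 f g \<omega>) - c" for \<omega>
  define \<Psi> where "\<Psi> v = \<phi> ((v f)\<^sup>2 + (v g)\<^sup>2) - c" for v :: "'h \<Rightarrow> real"
  define m where "m = expectation (\<lambda>\<omega>. \<bar>W f \<omega>\<bar> + \<bar>W g \<omega>\<bar>)"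
  define S where "S \<omega> = \<bar>W f \<omega>\<bar> + \<bar>W g \<omega>\<bar> + m" for \<omega>
  note am = radial_all_moments[OF W_all_moments W_all_moments, of f g]
  have Sm: "all_moments M S"
    unfolding S_def[abs_def]
    by (rule all_moments_add[OF all_moments_add[OF all_moments_abs[OF W_all_moments] all_moments_abs[OF W_all_moments]] all_moments_const])
  have Ym: "all_moments M Y" unfolding Y_def[abs_def] by (rule all_moments_diff[OF am(4) all_moments_const])
  have rep: "represents M W Y \<Psi>" and L2Y: "L2_functional M W Y"
    using L2_functional_radial[of "\<lambda>r. \<phi> r - c"] Ym unfolding Y_def[abs_def] \<Psi>_def[abs_def] by simp_all
  have L2x: "L2_functional M W (\<lambda>\<omega>. x (sq2 f g \<omega>))"
    by (rule L2_functional_radial(2)[OF radial_measurable(4) am(2)])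
  have L2x': "L2_functional M W (\<lambda>\<omega>. - x (sq2 f g \<omega>))"
    using L2_functional_radial(2)[of "\<lambda>r. - x r"] all_moments_uminus[OF am(2)] by simp
  have EY: "expectation Y = 0"
    unfolding Y_def using all_moments_integrable[OF am(4)] by (simp add: prob_space c_def)
  have pointwise: "\<bar>(mehler t \<Psi> \<omega> - Y \<omega>) / t - - x (sq2 f g \<omega>)\<bar> \<le> K * arccos (exp (- t)) * S \<omega>" if t: "0 < t" for t \<omega>
  proof -
    define \<theta> where "\<theta> = arccos (exp (- t))"
    have e: "0 < exp (- t)" "exp (- t) < 1" using t by simp_all
    have c: "cos \<theta> = exp (- t)" unfolding \<theta>_def using e by (intro cos_arccos) linarith+
    have \<theta>: "0 < \<theta>" "\<theta> < pi / 2"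
      using arccos_less_arccos[of 0 "exp (- t)"] arccos_less_arccos[OF order_trans[OF _ less_imp_le[OF e(1)]] e(2)] e
      unfolding \<theta>_def by simp_all
    have s: "sin \<theta> = sqrt (1 - exp (- 2 * t))"
    proof -
      have "(exp (- t))\<^sup>2 = exp (- 2 * t)" by (simp add: power2_eq_square exp_add[symmetric])
      then have "(sin \<theta>)\<^sup>2 = 1 - exp (- 2 * t)" unfolding sin_squared_eq c by simp
      moreover have "0 \<le> sin \<theta>" using \<theta> by (intro sin_ge_zero) auto
      ultimately show ?thesis by (metis real_sqrt_unique)
    qed
    have i: "integrable M (\<lambda>\<omega>'. \<phi> ((cos \<theta> * W f \<omega> + sin \<theta> * W f \<omega>')\<^sup>2 + (cos \<theta> * W g \<omega> + sin \<theta> * W g \<omega>')\<^sup>2))"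
      by (rule all_moments_integrable[OF radial_all_moments(4)]; rule all_moments_add[OF all_moments_const all_moments_mult[OF all_moments_const W_all_moments]])
    define E where "E = expectation (\<lambda>\<omega>'. \<phi> ((cos \<theta> * W f \<omega> + sin \<theta> * W f \<omega>')\<^sup>2 + (cos \<theta> * W g \<omega> + sin \<theta> * W g \<omega>')\<^sup>2))"
    have me: "mehler t \<Psi> \<omega> = E - c"
      unfolding mehler_def \<Psi>_def E_def c[symmetric] s[symmetric] using i by (simp add: prob_space)
    have "\<bar>E - \<phi> (sq2 f g \<omega>) - ln (cos \<theta>) * x (sq2 f g \<omega>)\<bar> \<le> - ln (cos \<theta>) * (K * \<theta> * S \<omega>)"
      using radial_increment_bound[OF \<theta>, of "W f \<omega>" "W g \<omega>"] unfolding E_def S_def m_def .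
    then have "\<bar>E - \<phi> (sq2 f g \<omega>) + t * x (sq2 f g \<omega>)\<bar> \<le> t * (K * \<theta> * S \<omega>)" unfolding c by simp
    then have "\<bar>E - \<phi> (sq2 f g \<omega>) + t * x (sq2 f g \<omega>)\<bar> / t \<le> K * \<theta> * S \<omega>"
      using t by (simp add: pos_divide_le_eq mult.commute)
    moreover have "(mehler t \<Psi> \<omega> - Y \<omega>) / t - - x (sq2 f g \<omega>) = (E - \<phi> (sq2 f g \<omega>) + t * x (sq2 f g \<omega>)) / t"
      unfolding me Y_def using t by (simp add: add_divide_distrib diff_divide_distrib)
    ultimately show ?thesis unfolding \<theta>_def using t by (simp add: abs_divide)
  qed
  have lim: "((\<lambda>t. \<integral>\<^sup>+\<omega>. ennreal (((OU_semigroup M W t Y \<omega> - Y \<omega>) / t - - x (sq2 f g \<omega>))\<^sup>2) \<partial>M) \<longlongrightarrow> 0) (at_right 0)"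
  proof (rule tendsto_sandwich[OF _ _ tendsto_const])
    show "\<forall>\<^sub>F t in at_right 0. (\<integral>\<^sup>+\<omega>. ennreal (((OU_semigroup M W t Y \<omega> - Y \<omega>) / t - - x (sq2 f g \<omega>))\<^sup>2) \<partial>M) \<le>
        ennreal ((K * arccos (exp (- t)))\<^sup>2 * expectation (\<lambda>\<omega>. (S \<omega>)\<^sup>2))"
      using eventually_at_right_less[of 0]
    proof eventually_elim
      case (elim t)
      have "AE \<omega> in M. OU_semigroup M W t Y \<omega> = mehler t \<Psi> \<omega>"
        using elim by (intro OU_semigroup_eq_mehler[OF rep]) simp
      then have "(\<integral>\<^sup>+\<omega>. ennreal (((OU_semigroup M W t Y \<omega> - Y \<omega>) / t - - x (sq2 f g \<omega>))\<^sup>2) \<partial>M) =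
          (\<integral>\<^sup>+\<omega>. ennreal (((mehler t \<Psi> \<omega> - Y \<omega>) / t - - x (sq2 f g \<omega>))\<^sup>2) \<partial>M)"
        by (intro nn_integral_cong_AE) auto
      also have "\<dots> \<le> (\<integral>\<^sup>+\<omega>. ennreal ((K * arccos (exp (- t)))\<^sup>2 * (S \<omega>)\<^sup>2) \<partial>M)"
      proof (intro nn_integral_mono ennreal_leI)
        fix \<omega>
        show "((mehler t \<Psi> \<omega> - Y \<omega>) / t - - x (sq2 f g \<omega>))\<^sup>2 \<le> (K * arccos (exp (- t)))\<^sup>2 * (S \<omega>)\<^sup>2"
          using power_mono[OF pointwise[OF elim, of \<omega>] abs_ge_zero, of 2] unfolding power2_abs power_mult_distrib .
      qed
      also have "\<dots> = ennreal (\<integral>\<omega>. (K * arccos (exp (- t)))\<^sup>2 * (S \<omega>)\<^sup>2 \<partial>M)"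
        by (rule nn_integral_eq_integral) (use all_moments_square_integrable[OF Sm] in auto)
      finally show ?case by simp
    qed
    have "continuous_on {0..} (\<lambda>t::real. arccos (exp (- t)))"
    proof (rule continuous_on_arccos)
      show "continuous_on {0..} (\<lambda>t::real. exp (- t))" by (intro continuous_intros)
      show "\<forall>t\<in>{0..}. - 1 \<le> exp (- t) \<and> exp (- t) \<le> (1::real)"
      proof
        fix t :: real assume "t \<in> {0..}"
        then show "- 1 \<le> exp (- t) \<and> exp (- t) \<le> 1" using order_trans[of "- 1" 0 "exp (- t)"] by simp
      qed
    qed
    then have "((\<lambda>t::real. arccos (exp (- t))) \<longlongrightarrow> arccos (exp (- 0))) (at 0 within {0..})"
      unfolding continuous_on_def by (rule bspec) simp
    then have "((\<lambda>t::real. arccos (exp (- t))) \<longlongrightarrow> arccos (exp (- 0))) (at_right 0)"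
      by (rule tendsto_within_subset) auto
    then have "((\<lambda>t::real. arccos (exp (- t))) \<longlongrightarrow> 0) (at_right 0)" by simp
    then have "((\<lambda>t. (K * arccos (exp (- t)))\<^sup>2 * expectation (\<lambda>\<omega>. (S \<omega>)\<^sup>2)) \<longlongrightarrow> (K * 0)\<^sup>2 * expectation (\<lambda>\<omega>. (S \<omega>)\<^sup>2)) (at_right 0)"
      by (intro tendsto_intros)
    then have "((\<lambda>t. ennreal ((K * arccos (exp (- t)))\<^sup>2 * expectation (\<lambda>\<omega>. (S \<omega>)\<^sup>2))) \<longlongrightarrow> ennreal ((K * 0)\<^sup>2 * expectation (\<lambda>\<omega>. (S \<omega>)\<^sup>2))) (at_right 0)"
      by (rule tendsto_ennrealI)
    then show "((\<lambda>t. ennreal ((K * arccos (exp (- t)))\<^sup>2 * expectation (\<lambda>\<omega>. (S \<omega>)\<^sup>2))) \<longlongrightarrow> 0) (at_right 0)"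
      by simp
  qed simp
  have "has_neg_OU_inverse M W (\<lambda>\<omega>. x (sq2 f g \<omega>)) Y"
    unfolding has_neg_OU_inverse_def has_OU_generator_def
    using L2x radial_centered EY L2Y L2x' lim by blast
  then show ?thesis unfolding Y_def c_def .
qed

end

end

section \<open>The sum over primes\<close>

lemma bounded_on_halfline:
  fixes q :: "real \<Rightarrow> real"
  assumes q: "\<And>r. isCont q r" and l: "(q \<longlongrightarrow> l) at_top"
  obtains C where "\<And>r. 0 \<le> r \<Longrightarrow> \<bar>q r\<bar> \<le> C"
proof -
  have "\<forall>\<^sub>F r in at_top. dist (q r) l < 1" using l by (rule tendstoD) simp
  then obtain N where N: "\<And>r. N \<le> r \<Longrightarrow> dist (q r) l < 1" by (auto simp: eventually_at_top_linorder)
  have "compact (q ` {0..N})"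
    by (intro compact_continuous_image continuous_at_imp_continuous_on ballI q compact_Icc)
  then have "bounded (q ` {0..N})" by (rule compact_imp_bounded)
  then obtain B where "\<forall>z\<in>q ` {0..N}. norm z \<le> B" unfolding bounded_iff by blast
  then have B: "norm (q r) \<le> B" if "r \<in> {0..N}" for r using that by blast
  show thesis
  proof (rule that[of "max B (\<bar>l\<bar> + 1)"])
    fix r :: real assume "0 \<le> r"
    show "\<bar>q r\<bar> \<le> max B (\<bar>l\<bar> + 1)"
    proof (cases "r \<le> N")
      case True
      then show ?thesis using B[of r] \<open>0 \<le> r\<close> by simp
    next
      case False
      then have "\<bar>q r - l\<bar> < 1" using N[of r] by (simp add: dist_real_def)
      then show ?thesis using abs_triangle_ineq2[of "q r" l] by linarith
    qed
  qed
qed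

lemma abs_cos_diff_le: "\<bar>cos u - cos v\<bar> \<le> \<bar>u - v\<bar>" for u v :: real
proof -
  have "norm (cos u - cos v) \<le> 1 * norm (u - v)"
    by (rule field_differentiable_bound[where S=UNIV and f'="\<lambda>z. - sin z"])
       (auto intro!: derivative_eq_intros)
  then show ?thesis by simp
qed

text \<open>The derivative is at most 1 in absolute value because |z| \<le> 1 + z^2 / 2 \<le> exp
  (z^2 / 2).\<close>

lemma abs_exp_square_diff_le: "\<bar>exp (- u\<^sup>2 / 2) - exp (- v\<^sup>2 / 2)\<bar> \<le> \<bar>u - v\<bar>" for u v :: real
proof -
  have "norm (exp (- u\<^sup>2 / 2) - exp (- v\<^sup>2 / 2)) \<le> 1 * norm (u - v)"
  proof (rule field_differentiable_bound[where S=UNIV and f'="\<lambda>z. - z * exp (- z\<^sup>2 / 2)"])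
    show "((\<lambda>z. exp (- z\<^sup>2 / 2)) has_real_derivative - z * exp (- z\<^sup>2 / 2)) (at z within UNIV)" for z :: real
      by (auto intro!: derivative_eq_intros)
    fix z :: real
    have "2 * (1 * \<bar>z\<bar>) \<le> 1\<^sup>2 + \<bar>z\<bar>\<^sup>2" using sum_squares_bound[of 1 "\<bar>z\<bar>"] by simp
    then have "\<bar>z\<bar> \<le> 1 + z\<^sup>2 / 2" by simp
    also have "\<dots> \<le> exp (z\<^sup>2 / 2)" by (rule exp_ge_add_one_self)
    finally have "\<bar>z\<bar> * exp (- (z\<^sup>2 / 2)) \<le> exp (z\<^sup>2 / 2) * exp (- (z\<^sup>2 / 2))" by (rule mult_right_mono) simp
    then show "norm (- z * exp (- z\<^sup>2 / 2)) \<le> 1" by (simp add: abs_mult exp_add[symmetric])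
  qed auto
  then show ?thesis by simp
qed

text \<open>The increment estimate wants a Lipschitz bound in the two plane coordinates; the
  exponential splits into a factor for each, both bounded by 1.\<close>

lemma abs_exp_radius_diff_le:
  "\<bar>exp (- (a\<^sup>2 + b\<^sup>2) / 2) - exp (- (c\<^sup>2 + d\<^sup>2) / 2)\<bar> \<le> \<bar>a - c\<bar> + \<bar>b - d\<bar>" for a b c d :: real
proof -
  define E where "E z = exp (- z\<^sup>2 / 2)" for z :: real
  have E1: "\<bar>E z\<bar> \<le> 1" for z by (simp add: E_def)
  have Ed: "\<bar>E z - E z'\<bar> \<le> \<bar>z - z'\<bar>" for z z'
    unfolding E_def by (rule abs_exp_square_diff_le)
  have s: "exp (- (x\<^sup>2 + y\<^sup>2) / 2) = E x * E y" for x y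
    by (simp add: E_def exp_add[symmetric] add_divide_distrib diff_divide_distrib)
  have "E a * E b - E c * E d = (E a - E c) * E b + E c * (E b - E d)" by (simp add: algebra_simps)
  also have "\<bar>\<dots>\<bar> \<le> \<bar>E a - E c\<bar> * \<bar>E b\<bar> + \<bar>E c\<bar> * \<bar>E b - E d\<bar>"
    unfolding abs_mult[symmetric] by (rule abs_triangle_ineq)
  also have "\<dots> \<le> \<bar>a - c\<bar> * 1 + 1 * \<bar>b - d\<bar>"
    by (intro add_mono mult_mono E1 Ed) simp_all
  finally show ?thesis unfolding s by simp
qed

context isonormal_gaussian_process
begin

text \<open>All equations are linear, so the weighted sum of the single-frequency solutions solves
  the summed problem. The index type is left open: primes are one instance, a single point the
  other, used to compute one expectation.\<close>

lemma radial_cos_poisson: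
  fixes f g :: 'h and P :: "'p set" and w \<tau> :: "'p \<Rightarrow> real"
  assumes ortho: "inner f f = 1" "inner g g = 1" "inner f g = 0"
    and P: "finite P" and \<tau>: "\<And>p. p \<in> P \<Longrightarrow> 0 < \<tau> p" and w: "\<And>p. p \<in> P \<Longrightarrow> 0 \<le> w p"
  defines "x \<equiv> \<lambda>r. \<Sum>p\<in>P. w p * (cos (\<tau> p * exp (- r / 2)) - sin (\<tau> p) / \<tau> p)"
  obtains \<phi> q :: "real \<Rightarrow> real" where
    "\<And>r. (\<phi> has_real_derivative q r) (at r)" "\<And>r. isCont q r" "(q \<longlongrightarrow> 0) at_top"
    "\<And>r. 2 * exp (- r / 2) * r * q r = (\<Sum>p\<in>P. w p * (sin (\<tau> p * exp (- r / 2)) - exp (- r / 2) * sin (\<tau> p)) / \<tau> p)"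
    "has_neg_OU_inverse M W (\<lambda>\<omega>. x (sq2 f g \<omega>)) (\<lambda>\<omega>. \<phi> (sq2 f g \<omega>) - expectation (\<lambda>\<omega>. \<phi> (sq2 f g \<omega>)))"
proof -
  \<comment> \<open>Packing the three functions into one triple lets a single choice over the index
    set provide all of them.\<close>
  define sol where "sol t s \<longleftrightarrow> (case s of (\<phi>, q, q') \<Rightarrow>
      (\<forall>r. (\<phi> has_real_derivative q r) (at r)) \<and> (\<forall>r. (q has_real_derivative q' r) (at r)) \<and> (\<forall>r. isCont q' r) \<and>
      \<phi> 0 = 0 \<and> (q \<longlongrightarrow> 0) at_top \<and>
      (\<forall>r. 2 * t * exp (- r / 2) * r * q r = sin (t * exp (- r / 2)) - exp (- r / 2) * sin t) \<and>
      (\<forall>r. 4 * r * q' r + (4 - 2 * r) * q r = - (cos (t * exp (- r / 2)) - sin t / t)))"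
    for t :: real and s :: "(real \<Rightarrow> real) \<times> (real \<Rightarrow> real) \<times> (real \<Rightarrow> real)"
  have "\<exists>s. sol t s" if t: "0 < t" for t
  proof -
    obtain \<phi> q q' :: "real \<Rightarrow> real" where
      "\<And>r. (\<phi> has_real_derivative q r) (at r)" "\<And>r. (q has_real_derivative q' r) (at r)" "\<And>r. isCont q' r"
      "\<phi> 0 = 0" "(q \<longlongrightarrow> 0) at_top"
      "\<And>r. 2 * t * exp (- r / 2) * r * q r = sin (t * exp (- r / 2)) - exp (- r / 2) * sin t"
      "\<And>r. 4 * r * q' r + (4 - 2 * r) * q r = - (cos (t * exp (- r / 2)) - sin t / t)"
      using radial_poisson_solution[OF t] by blast
    then have "sol t (\<phi>, q, q')" unfolding sol_def by simp
    then show ?thesis ..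
  qed
  then have "\<forall>p\<in>P. \<exists>s. sol (\<tau> p) s" using \<tau> by blast
  from bchoice[OF this] obtain s where s: "\<forall>p\<in>P. sol (\<tau> p) (s p)" ..
  define \<phi>0 where "\<phi>0 p = fst (s p)" for p
  define q0 where "q0 p = fst (snd (s p))" for p
  define q0' where "q0' p = snd (snd (s p))" for p
  have sol: "(\<phi>0 p has_real_derivative q0 p r) (at r)" "(q0 p has_real_derivative q0' p r) (at r)" "isCont (q0' p) r"
      "\<phi>0 p 0 = 0" "(q0 p \<longlongrightarrow> 0) at_top"
      "2 * \<tau> p * exp (- r / 2) * r * q0 p r = sin (\<tau> p * exp (- r / 2)) - exp (- r / 2) * sin (\<tau> p)"
      "4 * r * q0' p r + (4 - 2 * r) * q0 p r = - (cos (\<tau> p * exp (- r / 2)) - sin (\<tau> p) / \<tau> p)"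
    if "p \<in> P" for p r
    using s[rule_format, OF that] unfolding sol_def \<phi>0_def q0_def q0'_def case_prod_beta by blast+
  define \<phi> where "\<phi> r = (\<Sum>p\<in>P. w p * \<phi>0 p r)" for r
  define q where "q r = (\<Sum>p\<in>P. w p * q0 p r)" for r
  define q' where "q' r = (\<Sum>p\<in>P. w p * q0' p r)" for r
  have d\<phi>: "(\<phi> has_real_derivative q r) (at r)" for r
    unfolding \<phi>_def q_def by (intro DERIV_sum DERIV_cmult sol)
  have dq: "(q has_real_derivative q' r) (at r)" for r
    unfolding q_def q'_def by (intro DERIV_sum DERIV_cmult sol)
  have cq': "isCont q' r" for r unfolding q'_def by (intro continuous_intros sol)
  have cq: "isCont q r" for r by (rule DERIV_isCont[OF dq])
  have lq: "(q \<longlongrightarrow> 0) at_top"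
  proof -
    have "(q \<longlongrightarrow> (\<Sum>p\<in>P. w p * 0)) at_top" unfolding q_def by (intro tendsto_intros sol)
    then show ?thesis by simp
  qed
  have \<phi>00: "\<phi> 0 = 0" unfolding \<phi>_def by (intro sum.neutral) (simp add: sol)
  obtain C1 where C1: "\<And>r. 0 \<le> r \<Longrightarrow> \<bar>q r\<bar> \<le> C1" using bounded_on_halfline[OF cq lq] by blast
  define C where "C = max C1 (\<Sum>p\<in>P. w p * (1 + \<bar>sin (\<tau> p) / \<tau> p\<bar>))"
  have bq: "\<bar>q r\<bar> \<le> C" if "0 \<le> r" for r using C1[OF that] by (simp add: C_def)
  have bx: "\<bar>x r\<bar> \<le> C" for r
  proof -
    have "\<bar>x r\<bar> \<le> (\<Sum>p\<in>P. w p * (1 + \<bar>sin (\<tau> p) / \<tau> p\<bar>))"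
      unfolding x_def
    proof (rule order_trans[OF sum_abs sum_mono])
      fix p assume p: "p \<in> P"
      have "\<bar>cos (\<tau> p * exp (- r / 2)) - sin (\<tau> p) / \<tau> p\<bar> \<le> 1 + \<bar>sin (\<tau> p) / \<tau> p\<bar>"
        using abs_triangle_ineq4[of "cos (\<tau> p * exp (- r / 2))" "sin (\<tau> p) / \<tau> p"] abs_cos_le_one[of "\<tau> p * exp (- r / 2)"] by linarith
      then show "\<bar>w p * (cos (\<tau> p * exp (- r / 2)) - sin (\<tau> p) / \<tau> p)\<bar> \<le> w p * (1 + \<bar>sin (\<tau> p) / \<tau> p\<bar>)"
        unfolding abs_mult abs_of_nonneg[OF w[OF p]] by (rule mult_left_mono[OF _ w[OF p]])
    qed
    then show ?thesis by (simp add: C_def)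
  qed
  have ode: "4 * r * q' r + (4 - 2 * r) * q r = - x r" for r
  proof -
    have "4 * r * q' r + (4 - 2 * r) * q r = (\<Sum>p\<in>P. w p * (4 * r * q0' p r + (4 - 2 * r) * q0 p r))"
      unfolding q_def q'_def sum_distrib_left sum.distrib[symmetric] by (intro sum.cong refl) (simp add: algebra_simps)
    also have "\<dots> = (\<Sum>p\<in>P. w p * (- (cos (\<tau> p * exp (- r / 2)) - sin (\<tau> p) / \<tau> p)))"
      by (intro sum.cong refl) (simp only: sol)
    also have "\<dots> = - x r" unfolding x_def sum_negf[symmetric] by (simp only: mult_minus_right)
    finally show ?thesis .
  qed
  have lip: "\<bar>x (a\<^sup>2 + b\<^sup>2) - x (c\<^sup>2 + d\<^sup>2)\<bar> \<le> (\<Sum>p\<in>P. w p * \<tau> p) * (\<bar>a - c\<bar> + \<bar>b - d\<bar>)" for a b c d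
  proof -
    let ?u = "exp (- (a\<^sup>2 + b\<^sup>2) / 2)" and ?v = "exp (- (c\<^sup>2 + d\<^sup>2) / 2)"
    have "x (a\<^sup>2 + b\<^sup>2) - x (c\<^sup>2 + d\<^sup>2) = (\<Sum>p\<in>P. w p * (cos (\<tau> p * ?u) - cos (\<tau> p * ?v)))"
      unfolding x_def sum_subtractf[symmetric] by (intro sum.cong refl) (simp add: algebra_simps)
    also have "\<bar>\<dots>\<bar> \<le> (\<Sum>p\<in>P. w p * \<tau> p * (\<bar>a - c\<bar> + \<bar>b - d\<bar>))"
    proof (rule order_trans[OF sum_abs sum_mono])
      fix p assume p: "p \<in> P"
      have "\<bar>cos (\<tau> p * ?u) - cos (\<tau> p * ?v)\<bar> \<le> \<bar>\<tau> p * ?u - \<tau> p * ?v\<bar>" by (rule abs_cos_diff_le)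
      also have "\<dots> = \<tau> p * \<bar>?u - ?v\<bar>" using \<tau>[OF p] by (simp add: abs_mult right_diff_distrib[symmetric])
      also have "\<dots> \<le> \<tau> p * (\<bar>a - c\<bar> + \<bar>b - d\<bar>)"
        by (rule mult_left_mono[OF abs_exp_radius_diff_le]) (use \<tau>[OF p] in simp)
      finally show "\<bar>w p * (cos (\<tau> p * ?u) - cos (\<tau> p * ?v))\<bar> \<le> w p * \<tau> p * (\<bar>a - c\<bar> + \<bar>b - d\<bar>)"
        unfolding abs_mult abs_of_nonneg[OF w[OF p]] mult.assoc by (rule mult_left_mono[OF _ w[OF p]])
    qed
    also have "\<dots> = (\<Sum>p\<in>P. w p * \<tau> p) * (\<bar>a - c\<bar> + \<bar>b - d\<bar>)" by (simp only: sum_distrib_right)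
    finally show ?thesis .
  qed
  have key: "2 * exp (- r / 2) * r * q r = (\<Sum>p\<in>P. w p * (sin (\<tau> p * exp (- r / 2)) - exp (- r / 2) * sin (\<tau> p)) / \<tau> p)" for r
    unfolding q_def sum_distrib_left
  proof (rule sum.cong[OF refl])
    fix p assume p: "p \<in> P"
    show "2 * exp (- r / 2) * r * (w p * q0 p r) = w p * (sin (\<tau> p * exp (- r / 2)) - exp (- r / 2) * sin (\<tau> p)) / \<tau> p"
      unfolding sol(6)[OF p, symmetric] using \<tau>[OF p] by simp
  qed
  have "has_neg_OU_inverse M W (\<lambda>\<omega>. x (sq2 f g \<omega>)) (\<lambda>\<omega>. \<phi> (sq2 f g \<omega>) - expectation (\<lambda>\<omega>. \<phi> (sq2 f g \<omega>)))"
    by (rule radial_neg_OU_inverse[OF ortho d\<phi> \<phi>00 dq cq' bq bx ode lip])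
  from that[OF d\<phi> cq lq key this] show thesis .
qed

lemma unif_rv_eq: "unif_rv W f g \<omega> = exp (- sq2 f g \<omega> / 2)"
  unfolding unif_rv_def by (rule arg_cong[where f=exp]) linarith

text \<open>An element of the range of L is centered, so solvability of the equation for one
  frequency already fixes the mean of the cosine.\<close>

lemma expectation_cos_unif_rv:
  assumes ortho: "inner f f = 1" "inner g g = 1" "inner f g = 0" and \<tau>: "0 < \<tau>"
  shows "expectation (\<lambda>\<omega>. cos (\<tau> * unif_rv W f g \<omega>)) = sin \<tau> / \<tau>"
proof -
  obtain \<phi> where "has_neg_OU_inverse M W (\<lambda>\<omega>. \<Sum>p\<in>{()}. 1 * (cos (\<tau> * exp (- sq2 f g \<omega> / 2)) - sin \<tau> / \<tau>))
      (\<lambda>\<omega>. \<phi> (sq2 f g \<omega>) - expectation (\<lambda>\<omega>. \<phi> (sq2 f g \<omega>)))"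
    by (rule radial_cos_poisson[OF ortho, of "{()}" "\<lambda>_. \<tau>" "\<lambda>_. 1"]) (use \<tau> in auto)
  then have "expectation (\<lambda>\<omega>. cos (\<tau> * exp (- sq2 f g \<omega> / 2)) - sin \<tau> / \<tau>) = 0"
    by (simp add: has_neg_OU_inverse_def)
  moreover have "integrable M (\<lambda>\<omega>. cos (\<tau> * exp (- sq2 f g \<omega> / 2)))"
    by (rule integrable_const_bound[where B=1]) auto
  ultimately show ?thesis unfolding unif_rv_eq by (simp add: prob_space)
qed

end

lemma finite_primes_le: "finite (primes_le T)"
proof (rule finite_subset)
  show "primes_le T \<subseteq> {..nat \<lfloor>T\<rfloor>}" by (auto simp: primes_le_def le_nat_floor)
qed simp

lemma primes_le_ln_pos: "p \<in> primes_le T \<Longrightarrow> 0 < ln (real p)"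
  by (auto simp: primes_le_def dest: prime_gt_1_nat)

theorem proposition1:
  fixes M :: "'a measure"
    and W :: "'h::{real_inner, polish_space} \<Rightarrow> 'a \<Rightarrow> real"
    and f g :: 'h and U :: "'a \<Rightarrow> real" and T :: real and X :: "'a \<Rightarrow> real"
  assumes "isonormal_gaussian_process M W"
    and "norm f = 1" and "norm g = 1" and "inner f g = 0"
    and "U = unif_rv W f g"
    and "T > 0"
    and "X = prime_cos_sum M U T"
  shows "X \<in> malliavin_domain M W \<and>
    X \<in> neg_OU_inverse_domain M W \<and>
    neg_OU_inverse M W X \<in> malliavin_domain M W \<and>
    (AE \<omega> in M.
       inner (malliavin_deriv M W X \<omega>) (malliavin_deriv M W (neg_OU_inverse M W X) \<omega>) =
       (\<Sum>p\<^sub>1\<in>primes_le T. \<Sum>p\<^sub>2\<in>primes_le T.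
          1 / sqrt (real p\<^sub>1 * real p\<^sub>2) * (ln (real p\<^sub>2) / ln (real p\<^sub>1)) *
          (sin (T * U \<omega> * ln (real p\<^sub>2)) * sin (T * U \<omega> * ln (real p\<^sub>1))
           - U \<omega> * sin (T * U \<omega> * ln (real p\<^sub>2)) * sin (T * ln (real p\<^sub>1)))))"
  (is "_ \<and> _ \<and> _ \<and> (AE \<omega> in M. _ \<omega> = ?rhs \<omega>)")
proof -
  interpret isonormal_gaussian_process M W by fact
  have ortho: "inner f f = 1" "inner g g = 1" "inner f g = 0"
    using assms by (simp_all add: power2_norm_eq_inner[symmetric])
  define P where "P = primes_le T"
  define w where "w p = 1 / sqrt (real p)" for p :: nat
  define \<tau> where "\<tau> p = T * ln (real p)" for p :: nat
  let ?R = "\<lambda>\<omega>. (W f \<omega>)\<^sup>2 + (W g \<omega>)\<^sup>2"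
  let ?v = "\<lambda>\<omega>. W f \<omega> *\<^sub>R f + W g \<omega> *\<^sub>R g"
  have P: "finite P" unfolding P_def by (rule finite_primes_le)
  have lnp: "0 < ln (real p)" if "p \<in> P" for p using that unfolding P_def by (rule primes_le_ln_pos)
  have \<tau>: "0 < \<tau> p" if "p \<in> P" for p using lnp[OF that] \<open>T > 0\<close> by (simp add: \<tau>_def)
  have w: "0 \<le> w p" for p by (simp add: w_def)
  have U: "U \<omega> = exp (- ?R \<omega> / 2)" for \<omega> by (simp only: assms(5) unif_rv_eq)
  define x where "x r = (\<Sum>p\<in>P. w p * (cos (\<tau> p * exp (- r / 2)) - sin (\<tau> p) / \<tau> p))" for r
  have X: "X = (\<lambda>\<omega>. x (?R \<omega>))"
  proof
    fix \<omega>
    have "expectation (\<lambda>\<omega>. cos (T * U \<omega> * ln (real p)) / sqrt (real p)) = w p * (sin (\<tau> p) / \<tau> p)" if "p \<in> P" for p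
    proof -
      have "expectation (\<lambda>\<omega>. cos (T * U \<omega> * ln (real p)) / sqrt (real p)) = expectation (\<lambda>\<omega>. cos (\<tau> p * unif_rv W f g \<omega>)) * w p"
        unfolding assms(5) \<tau>_def w_def by (simp add: ac_simps)
      then show ?thesis using expectation_cos_unif_rv[OF ortho \<tau>[OF that]] by simp
    qed
    then show "X \<omega> = x (?R \<omega>)"
      unfolding assms(7) prime_cos_sum_def x_def P_def[symmetric] U[symmetric]
      by (intro sum.cong refl) (simp add: \<tau>_def w_def right_diff_distrib ac_simps)
  qed
  \<comment> \<open>The derivative of x, the exponential contributing the factor - exp (- r / 2) /
    2. That factor also supplies the limit at infinity which the radial differentiation rule asks
    for.\<close>
  define y where "y r = (\<Sum>p\<in>P. w p * (sin (\<tau> p * exp (- r / 2)) * (\<tau> p * exp (- r / 2) / 2)))" for r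
  have dx: "(x has_real_derivative y r) (at r)" for r
    unfolding x_def y_def
    by (intro DERIV_sum DERIV_cmult) (auto intro!: derivative_eq_intros)
  have cy: "isCont y r" for r unfolding y_def by (intro continuous_intros) auto
  have ly: "(y \<longlongrightarrow> 0) at_top"
  proof -
    have e: "((\<lambda>r::real. exp (- r / 2)) \<longlongrightarrow> 0) at_top" by real_asymp
    have "(y \<longlongrightarrow> (\<Sum>p\<in>P. w p * (sin (\<tau> p * 0) * (\<tau> p * 0 / 2)))) at_top"
      unfolding y_def by (intro tendsto_intros e) auto
    then show ?thesis by simp
  qed
  obtain \<phi> q where d\<phi>: "\<And>r. (\<phi> has_real_derivative q r) (at r)" and cq: "\<And>r. isCont q r" and lq: "(q \<longlongrightarrow> 0) at_top"
    and key: "\<And>r. 2 * exp (- r / 2) * r * q r = (\<Sum>p\<in>P. w p * (sin (\<tau> p * exp (- r / 2)) - exp (- r / 2) * sin (\<tau> p)) / \<tau> p)"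
    and inv: "has_neg_OU_inverse M W (\<lambda>\<omega>. x (?R \<omega>)) (\<lambda>\<omega>. \<phi> (?R \<omega>) - expectation (\<lambda>\<omega>. \<phi> (?R \<omega>)))"
    unfolding x_def by (rule radial_cos_poisson[OF ortho, of P \<tau> w]) (use P \<tau> w in blast)+
  define Y where "Y \<omega> = \<phi> (?R \<omega>) - expectation (\<lambda>\<omega>. \<phi> (?R \<omega>))" for \<omega>
  have DX: "has_malliavin_deriv M W X (\<lambda>\<omega>. (2 * y (?R \<omega>)) *\<^sub>R ?v \<omega>)"
    unfolding X by (rule has_malliavin_deriv_radial[OF dx cy ly])
  have invX: "has_neg_OU_inverse M W X Y" using inv unfolding X Y_def .
  then have invX': "has_neg_OU_inverse M W X (neg_OU_inverse M W X)"
    unfolding neg_OU_inverse_def by (rule someI[where P="has_neg_OU_inverse M W X"])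
  have DY: "has_malliavin_deriv M W Y (\<lambda>\<omega>. (2 * q (?R \<omega>)) *\<^sub>R ?v \<omega>)"
    unfolding Y_def
    by (rule has_malliavin_deriv_radial[where \<phi>="\<lambda>r. \<phi> r - expectation (\<lambda>\<omega>. \<phi> (?R \<omega>))", OF _ cq lq])
       (rule DERIV_cong[OF DERIV_diff[OF d\<phi> DERIV_const]], simp)
  \<comment> \<open>By uniqueness the picked inverse equals Y almost surely and inherits its
    derivative.\<close>
  have DY': "has_malliavin_deriv M W (neg_OU_inverse M W X) (\<lambda>\<omega>. (2 * q (?R \<omega>)) *\<^sub>R ?v \<omega>)"
  proof (rule has_malliavin_deriv_cong_AE[OF DY])
    show "neg_OU_inverse M W X \<in> borel_measurable M"
      using invX' by (simp add: has_neg_OU_inverse_def has_OU_generator_def L2_functional_def)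
    show "AE \<omega> in M. Y \<omega> = neg_OU_inverse M W X \<omega>" by (rule neg_OU_inverse_unique[OF invX invX'])
  qed
  have formula: "inner ((2 * y (?R \<omega>)) *\<^sub>R ?v \<omega>) ((2 * q (?R \<omega>)) *\<^sub>R ?v \<omega>) = ?rhs \<omega>" for \<omega>
  proof -
    define u where "u = U \<omega>"
    have ue: "exp (- ?R \<omega> / 2) = u" by (simp add: u_def U)
    have vv: "inner (?v \<omega>) (?v \<omega>) = ?R \<omega>"
      using ortho by (simp add: inner_add_left inner_add_right inner_commute[of g f] power2_eq_square)
    \<comment> \<open>2 y = s u contributes exactly the factor u that stands in front of R q in the
      integrated equation; the inner product of the radial field with itself contributes R. Hence
      the unknown q disappears from the product.\<close>
    define s where "s = (\<Sum>p\<in>P. w p * (sin (\<tau> p * u) * \<tau> p))"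
    have ys: "2 * y (?R \<omega>) = s * u"
      unfolding y_def ue s_def sum_distrib_left sum_distrib_right by (intro sum.cong refl) simp
    have "inner ((2 * y (?R \<omega>)) *\<^sub>R ?v \<omega>) ((2 * q (?R \<omega>)) *\<^sub>R ?v \<omega>) = (2 * y (?R \<omega>)) * ((2 * q (?R \<omega>)) * ?R \<omega>)"
      unfolding inner_scaleR_left inner_scaleR_right vv by (rule mult.left_commute)
    also have "\<dots> = (2 * exp (- ?R \<omega> / 2) * ?R \<omega> * q (?R \<omega>)) * s" unfolding ys ue by simp
    also have "\<dots> = (\<Sum>p\<^sub>1\<in>P. w p\<^sub>1 * (sin (\<tau> p\<^sub>1 * u) - u * sin (\<tau> p\<^sub>1)) / \<tau> p\<^sub>1) * s" unfolding ue using key[of "?R \<omega>", unfolded ue] by simp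
    also have "\<dots> = (\<Sum>p\<^sub>1\<in>P. \<Sum>p\<^sub>2\<in>P. w p\<^sub>1 * (sin (\<tau> p\<^sub>1 * u) - u * sin (\<tau> p\<^sub>1)) / \<tau> p\<^sub>1 * (w p\<^sub>2 * (sin (\<tau> p\<^sub>2 * u) * \<tau> p\<^sub>2)))"
      unfolding s_def by (rule sum_product)
    also have "\<dots> = (\<Sum>p\<^sub>1\<in>P. \<Sum>p\<^sub>2\<in>P. 1 / sqrt (real p\<^sub>1 * real p\<^sub>2) * (ln (real p\<^sub>2) / ln (real p\<^sub>1)) *
          (sin (T * u * ln (real p\<^sub>2)) * sin (T * u * ln (real p\<^sub>1)) - u * sin (T * u * ln (real p\<^sub>2)) * sin (T * ln (real p\<^sub>1))))"
    proof (intro sum.cong refl)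
      fix p1 p2
      \<comment> \<open>Differentiating X brings out the frequency of p2, while the inverse divides
        by the frequency of p1; the common factor T cancels and leaves the ratio of the
        logarithms.\<close>
      have t: "T * ln (real p2) / (T * ln (real p1)) = ln (real p2) / ln (real p1)" using \<open>T > 0\<close> by simp
      have "w p1 * (sin (\<tau> p1 * u) - u * sin (\<tau> p1)) / \<tau> p1 * (w p2 * (sin (\<tau> p2 * u) * \<tau> p2)) =
         (w p1 * w p2) * (\<tau> p2 / \<tau> p1) * (sin (\<tau> p2 * u) * sin (\<tau> p1 * u) - u * sin (\<tau> p2 * u) * sin (\<tau> p1))"
        by (simp add: algebra_simps diff_divide_distrib)
      also have "w p1 * w p2 = 1 / sqrt (real p1 * real p2)" by (simp add: w_def real_sqrt_mult)
      finally show "w p1 * (sin (\<tau> p1 * u) - u * sin (\<tau> p1)) / \<tau> p1 * (w p2 * (sin (\<tau> p2 * u) * \<tau> p2)) =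
        1 / sqrt (real p1 * real p2) * (ln (real p2) / ln (real p1)) *
          (sin (T * u * ln (real p2)) * sin (T * u * ln (real p1)) - u * sin (T * u * ln (real p2)) * sin (T * ln (real p1)))"
        unfolding \<tau>_def t mult.assoc[of T] mult.commute[of u "ln _"] .
    qed
    finally show ?thesis unfolding P_def u_def .
  qed
  have "AE \<omega> in M. inner (malliavin_deriv M W X \<omega>) (malliavin_deriv M W (neg_OU_inverse M W X) \<omega>) = ?rhs \<omega>"
    using malliavin_deriv_eq[OF DX] malliavin_deriv_eq[OF DY']
  proof eventually_elim
    case (elim \<omega>)
    show ?case unfolding elim by (rule formula)
  qed
  moreover have "X \<in> malliavin_domain M W" using DX unfolding malliavin_domain_def by blast
  moreover have "X \<in> neg_OU_inverse_domain M W" using invX unfolding neg_OU_inverse_domain_def by blast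
  moreover have "neg_OU_inverse M W X \<in> malliavin_domain M W" using DY' unfolding malliavin_domain_def by blast
  ultimately show ?thesis by blast
qed

end
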